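(* Every Noetherian Jacobson ring satisfies condition (Q). Consequently, every ring of fractions of a Noetherian Jacobson ring satisfies condition (C). In particular: (a) every Artinian ring satisfies (C); (b) if $k$ is a field or a Dedekind domain with infinitely many maximal ideals, then every $k$-algebra essentially of finite type satisfies (C).
   Context: All rings are commutative with unit. For a ring $A$ and $r\in\mathbb{N}$, a subset $Z\subset A^r$ is called positive-existential if it is a finite (possibly empty) union of sets of the form $\{t\in A^r\mid \exists x\in A^n,\ F_1(t,x)=\cdots=F_s(t,x)=0\}$, where $n,s\in\mathbb{N}$ and the $F_j$ are polynomials in $r+n$ indeterminates with coefficients in $A$. Condition (C) for a ring $A$: the subset $A\setminus\{0\}$ of $A$ is positive-existential. Condition (Q) for a ring $A$: every quotient of $A$ which is an integral domain satisfies (C). A ring is a Jacobson ring if each of its prime ideals is an intersection of maximal ideals. *)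

theory Defs
  imports
    "HOL-Algebra.Indexed_Polynomials"
    "HOL-Algebra.Generated_Rings"
    "HOL-Algebra.Ring_Divisibility"
begin

text \<open>All rings are commutative with unit: \<^locale>\<open>cring\<close> is imposed everywhere. The zero ring is
  allowed, as it is in \<^locale>\<open>cring\<close>.\<close>

section \<open>Positive-existential subsets and the conditions (C) and (Q)\<close>

text \<open>Points of \<open>A\<^sup>r\<close> are lists of length \<open>r\<close>, so that the point \<open>(t, x)\<close> of \<open>A\<^sup>r \<times> A\<^sup>n\<close> is \<open>t @ x\<close>.\<close>

definition points :: "('a, 'm) ring_scheme \<Rightarrow> nat \<Rightarrow> 'a list set" where
  "points A r = {t. length t = r \<and> set t \<subseteq> carrier A}"

text \<open>Polynomials in the indeterminates \<open>0, \<dots>, m - 1\<close> are the elements of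
  \<open>ring.indexed_pset A {..<m} (carrier A)\<close>: a monomial is the multiset of its indeterminates, and a
  polynomial is a (finitely supported) map from monomials to coefficients. The library offers no
  evaluation at a point with coordinates in the ring itself; \<open>ring.indexed_eval\<close> is a different
  operation.\<close>

definition monomial_value :: "('a, 'm) ring_scheme \<Rightarrow> nat multiset \<Rightarrow> 'a list \<Rightarrow> 'a" where
  "monomial_value A m p = (\<Otimes>\<^bsub>A\<^esub>i\<in>set_mset m. (p ! i) [^]\<^bsub>A\<^esub> count m i)"

definition poly_value :: "('a, 'm) ring_scheme \<Rightarrow> (nat multiset \<Rightarrow> 'a) \<Rightarrow> 'a list \<Rightarrow> 'a" where
  "poly_value A F p = (\<Oplus>\<^bsub>A\<^esub>m\<in>{m. F m \<noteq> \<zero>\<^bsub>A\<^esub>}. F m \<otimes>\<^bsub>A\<^esub> monomial_value A m p)"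

definition basic_positive_existential ::
    "('a, 'm) ring_scheme \<Rightarrow> nat \<Rightarrow> 'a list set \<Rightarrow> bool" where
  "basic_positive_existential A r Z \<longleftrightarrow>
     (\<exists>n Fs. set Fs \<subseteq> ring.indexed_pset A {..<r + n} (carrier A) \<and>
        Z = {t \<in> points A r. \<exists>x\<in>points A n. \<forall>F\<in>set Fs. poly_value A F (t @ x) = \<zero>\<^bsub>A\<^esub>})"

definition positive_existential ::
    "('a, 'm) ring_scheme \<Rightarrow> nat \<Rightarrow> 'a list set \<Rightarrow> bool" where
  "positive_existential A r Z \<longleftrightarrow>
     (\<exists>\<Z>. finite \<Z> \<and> (\<forall>Y\<in>\<Z>. basic_positive_existential A r Y) \<and> Z = \<Union>\<Z>)"

definition condition_C :: "('a, 'm) ring_scheme \<Rightarrow> bool" where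
  "condition_C A \<longleftrightarrow> positive_existential A 1 ((\<lambda>a. [a]) ` (carrier A - {\<zero>\<^bsub>A\<^esub>}))"

definition condition_Q :: "('a, 'm) ring_scheme \<Rightarrow> bool" where
  "condition_Q A \<longleftrightarrow> (\<forall>I. ideal I A \<and> domain (A Quot I) \<longrightarrow> condition_C (A Quot I))"


section \<open>Jacobson rings and Artinian rings\<close>

definition jacobson_ring :: "('a, 'm) ring_scheme \<Rightarrow> bool" where
  "jacobson_ring A \<longleftrightarrow> cring A \<and>
     (\<forall>P. primeideal P A \<longrightarrow> (\<exists>\<M>. (\<forall>M\<in>\<M>. maximalideal M A) \<and> P = \<Inter>\<M>))"

definition artinian_ring :: "('a, 'm) ring_scheme \<Rightarrow> bool" where
  "artinian_ring A \<longleftrightarrow> cring A \<and>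
     (\<forall>I :: nat \<Rightarrow> 'a set. (\<forall>n. ideal (I n) A \<and> I (Suc n) \<subseteq> I n) \<longrightarrow> (\<exists>n. \<forall>m\<ge>n. I m = I n))"


section \<open>Rings of fractions\<close>

text \<open>\<open>fraction A S a s\<close> is the class of \<open>(a, s)\<close> under the usual equivalence relation on
  \<open>A \<times> S\<close>, and \<open>fractions A S\<close> is the ring \<open>S\<^sup>-\<^sup>1A\<close>, for any multiplicative subset \<open>S\<close> (that is,
  \<open>submonoid S A\<close>; zero divisors, and even \<open>\<zero>\<close>, are allowed in \<open>S\<close>). The unions in \<open>mult\<close> and \<open>add\<close>
  are over families with a single value; \<open>fractions_mult\<close>, \<open>fractions_add\<close> and \<open>cring_fractions\<close> below
  confirm that this is the expected ring.\<close>

definition fraction :: "('a, 'm) ring_scheme \<Rightarrow> 'a set \<Rightarrow> 'a \<Rightarrow> 'a \<Rightarrow> ('a \<times> 'a) set" where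
  "fraction A S a s = {(b, t) \<in> carrier A \<times> S.
     \<exists>u\<in>S. u \<otimes>\<^bsub>A\<^esub> (t \<otimes>\<^bsub>A\<^esub> a) = u \<otimes>\<^bsub>A\<^esub> (s \<otimes>\<^bsub>A\<^esub> b)}"

definition fractions :: "('a, 'm) ring_scheme \<Rightarrow> 'a set \<Rightarrow> ('a \<times> 'a) set ring" where
  "fractions A S =
    \<lparr>carrier = (\<lambda>(a, s). fraction A S a s) ` (carrier A \<times> S),
     monoid.mult = (\<lambda>U V. \<Union>(a, s)\<in>U. \<Union>(b, t)\<in>V. fraction A S (a \<otimes>\<^bsub>A\<^esub> b) (s \<otimes>\<^bsub>A\<^esub> t)),
     one = fraction A S \<one>\<^bsub>A\<^esub> \<one>\<^bsub>A\<^esub>,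
     zero = fraction A S \<zero>\<^bsub>A\<^esub> \<one>\<^bsub>A\<^esub>,
     add = (\<lambda>U V. \<Union>(a, s)\<in>U. \<Union>(b, t)\<in>V.
              fraction A S ((t \<otimes>\<^bsub>A\<^esub> a) \<oplus>\<^bsub>A\<^esub> (s \<otimes>\<^bsub>A\<^esub> b)) (s \<otimes>\<^bsub>A\<^esub> t))\<rparr>"

locale mult_subset = cring A + submonoid S A for A (structure) and S
begin

lemma S_carr: "s \<in> S \<Longrightarrow> s \<in> carrier A"
  using subset by auto

lemma fraction_self: "\<lbrakk>a \<in> carrier A; s \<in> S\<rbrakk> \<Longrightarrow> (a, s) \<in> fraction A S a s"
  unfolding fraction_def using submonoid.one_closed[OF submonoid_axioms] by auto

lemma fraction_subset:
  assumes "a \<in> carrier A" "s \<in> S" "b \<in> carrier A" "t \<in> S"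
    and u: "u \<in> S" "u \<otimes> (t \<otimes> a) = u \<otimes> (s \<otimes> b)"
  shows "fraction A S a s \<subseteq> fraction A S b t"
proof (clarsimp simp: fraction_def)
  fix c v w assume c: "c \<in> carrier A" "v \<in> S" "w \<in> S" and w: "w \<otimes> (v \<otimes> a) = w \<otimes> (s \<otimes> c)"
  note carr = assms(1,3) c(1) S_carr[OF assms(2)] S_carr[OF assms(4)] S_carr[OF u(1)]
    S_carr[OF c(2)] S_carr[OF c(3)]
  have "(u \<otimes> w \<otimes> s) \<otimes> (v \<otimes> b) = (w \<otimes> v) \<otimes> (u \<otimes> (s \<otimes> b))"
    using carr by (simp add: m_ac)
  also have "\<dots> = (w \<otimes> v) \<otimes> (u \<otimes> (t \<otimes> a))" by (simp only: u(2))
  also have "\<dots> = (u \<otimes> t) \<otimes> (w \<otimes> (v \<otimes> a))" using carr by (simp add: m_ac)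
  also have "\<dots> = (u \<otimes> t) \<otimes> (w \<otimes> (s \<otimes> c))" by (simp only: w)
  also have "\<dots> = (u \<otimes> w \<otimes> s) \<otimes> (t \<otimes> c)" using carr by (simp add: m_ac)
  finally show "\<exists>u\<in>S. u \<otimes> (v \<otimes> b) = u \<otimes> (t \<otimes> c)"
    using u(1) c(3) assms(2) by (intro bexI[of _ "u \<otimes> w \<otimes> s"]) auto
qed

lemma fraction_eqI:
  assumes "a \<in> carrier A" "s \<in> S" "b \<in> carrier A" "t \<in> S"
    and "u \<in> S" "u \<otimes> (t \<otimes> a) = u \<otimes> (s \<otimes> b)"
  shows "fraction A S a s = fraction A S b t"
  using fraction_subset[OF assms] fraction_subset[OF assms(3,4,1,2,5) assms(6)[symmetric]] by auto

lemma fraction_eq_iff: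
  assumes "a \<in> carrier A" "s \<in> S" "b \<in> carrier A" "t \<in> S"
  shows "fraction A S a s = fraction A S b t \<longleftrightarrow> (\<exists>u\<in>S. u \<otimes> (t \<otimes> a) = u \<otimes> (s \<otimes> b))"
proof
  assume "fraction A S a s = fraction A S b t"
  with fraction_self[OF assms(3,4)] have "(b, t) \<in> fraction A S a s" by simp
  then show "\<exists>u\<in>S. u \<otimes> (t \<otimes> a) = u \<otimes> (s \<otimes> b)" by (simp add: fraction_def)
qed (use fraction_eqI[OF assms] in auto)

lemma fractionD:
  assumes "(b, t) \<in> fraction A S a s"
  shows "b \<in> carrier A" "t \<in> S" "\<exists>u\<in>S. u \<otimes> (t \<otimes> a) = u \<otimes> (s \<otimes> b)"
  using assms by (auto simp: fraction_def)

lemma UN2_const: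
  assumes "(a, s) \<in> U" "(b, t) \<in> V"
    and "\<And>a s b t. \<lbrakk>(a, s) \<in> U; (b, t) \<in> V\<rbrakk> \<Longrightarrow> f a s b t = c"
  shows "(\<Union>(a, s)\<in>U. \<Union>(b, t)\<in>V. f a s b t) = c"
  using assms by fastforce

lemma fractions_mult:
  assumes "a \<in> carrier A" "s \<in> S" "b \<in> carrier A" "t \<in> S"
  shows "fraction A S a s \<otimes>\<^bsub>fractions A S\<^esub> fraction A S b t = fraction A S (a \<otimes> b) (s \<otimes> t)"
  unfolding fractions_def monoid.simps
proof (rule UN2_const[OF fraction_self[OF assms(1,2)] fraction_self[OF assms(3,4)]])
  fix a' s' b' t' assume 1: "(a', s') \<in> fraction A S a s" and 2: "(b', t') \<in> fraction A S b t"
  obtain u where u: "u \<in> S" "u \<otimes> (s' \<otimes> a) = u \<otimes> (s \<otimes> a')" using fractionD(3)[OF 1] by auto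
  obtain v where v: "v \<in> S" "v \<otimes> (t' \<otimes> b) = v \<otimes> (t \<otimes> b')" using fractionD(3)[OF 2] by auto
  note * = assms fractionD(1,2)[OF 1] fractionD(1,2)[OF 2] u(1) v(1)
  note carr = assms(1,3) fractionD(1)[OF 1] fractionD(1)[OF 2] assms(2,4)[THEN S_carr]
    fractionD(2)[OF 1, THEN S_carr] fractionD(2)[OF 2, THEN S_carr] u(1)[THEN S_carr] v(1)[THEN S_carr]
  have "(u \<otimes> v) \<otimes> ((s' \<otimes> t') \<otimes> (a \<otimes> b)) = (u \<otimes> (s' \<otimes> a)) \<otimes> (v \<otimes> (t' \<otimes> b))"
    using carr by (simp add: m_ac)
  also have "\<dots> = (u \<otimes> (s \<otimes> a')) \<otimes> (v \<otimes> (t \<otimes> b'))" by (simp only: u(2) v(2))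
  also have "\<dots> = (u \<otimes> v) \<otimes> ((s \<otimes> t) \<otimes> (a' \<otimes> b'))"
    using carr by (simp add: m_ac)
  finally show "fraction A S (a' \<otimes> b') (s' \<otimes> t') = fraction A S (a \<otimes> b) (s \<otimes> t)"
    using * by (intro fraction_eqI[symmetric, where u = "u \<otimes> v"]) auto
qed

lemma fractions_add:
  assumes "a \<in> carrier A" "s \<in> S" "b \<in> carrier A" "t \<in> S"
  shows "fraction A S a s \<oplus>\<^bsub>fractions A S\<^esub> fraction A S b t =
    fraction A S ((t \<otimes> a) \<oplus> (s \<otimes> b)) (s \<otimes> t)"
  unfolding fractions_def ring.simps
proof (rule UN2_const[OF fraction_self[OF assms(1,2)] fraction_self[OF assms(3,4)]])
  fix a' s' b' t' assume 1: "(a', s') \<in> fraction A S a s" and 2: "(b', t') \<in> fraction A S b t"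
  obtain u where u: "u \<in> S" "u \<otimes> (s' \<otimes> a) = u \<otimes> (s \<otimes> a')" using fractionD(3)[OF 1] by auto
  obtain v where v: "v \<in> S" "v \<otimes> (t' \<otimes> b) = v \<otimes> (t \<otimes> b')" using fractionD(3)[OF 2] by auto
  note * = assms fractionD(1,2)[OF 1] fractionD(1,2)[OF 2] u(1) v(1)
  note carr = assms(1,3) fractionD(1)[OF 1] fractionD(1)[OF 2] assms(2,4)[THEN S_carr]
    fractionD(2)[OF 1, THEN S_carr] fractionD(2)[OF 2, THEN S_carr] u(1)[THEN S_carr] v(1)[THEN S_carr]
  have "(u \<otimes> v) \<otimes> ((s' \<otimes> t') \<otimes> ((t \<otimes> a) \<oplus> (s \<otimes> b)))
      = (v \<otimes> (t \<otimes> t')) \<otimes> (u \<otimes> (s' \<otimes> a)) \<oplus> (u \<otimes> (s \<otimes> s')) \<otimes> (v \<otimes> (t' \<otimes> b))"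
    using carr by (simp add: r_distr m_ac)
  also have "\<dots> = (v \<otimes> (t \<otimes> t')) \<otimes> (u \<otimes> (s \<otimes> a')) \<oplus> (u \<otimes> (s \<otimes> s')) \<otimes> (v \<otimes> (t \<otimes> b'))"
    by (simp only: u(2) v(2))
  also have "\<dots> = (u \<otimes> v) \<otimes> ((s \<otimes> t) \<otimes> ((t' \<otimes> a') \<oplus> (s' \<otimes> b')))"
    using carr by (simp add: r_distr m_ac)
  finally show "fraction A S ((t' \<otimes> a') \<oplus> (s' \<otimes> b')) (s' \<otimes> t')
      = fraction A S ((t \<otimes> a) \<oplus> (s \<otimes> b)) (s \<otimes> t)"
    using * carr by (intro fraction_eqI[symmetric, where u = "u \<otimes> v"]) auto
qed

lemma fraction_in_carrier:
  "\<lbrakk>a \<in> carrier A; s \<in> S\<rbrakk> \<Longrightarrow> fraction A S a s \<in> carrier (fractions A S)"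
  unfolding fractions_def by auto

lemma fractions_zero: "\<zero>\<^bsub>fractions A S\<^esub> = fraction A S \<zero> \<one>"
  and fractions_one: "\<one>\<^bsub>fractions A S\<^esub> = fraction A S \<one> \<one>"
  unfolding fractions_def by simp_all

lemma fractions_cases:
  assumes "x \<in> carrier (fractions A S)"
  obtains a s where "a \<in> carrier A" "s \<in> S" "x = fraction A S a s"
  using assms unfolding fractions_def by auto

lemma fraction_eqI1:
  assumes "a \<in> carrier A" "s \<in> S" "b \<in> carrier A" "t \<in> S" "t \<otimes> a = s \<otimes> b"
  shows "fraction A S a s = fraction A S b t"
  using assms by (intro fraction_eqI[where u = \<one>]) auto

lemma cring_fractions: "cring (fractions A S)"
proof (intro cringI abelian_groupI comm_monoidI)
  note simps = fractions_mult fractions_add fractions_zero fractions_one fraction_in_carrier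
  note [simp] = simps S_carr
  let ?F = "fractions A S"
  show "\<zero>\<^bsub>?F\<^esub> \<in> carrier ?F" "\<one>\<^bsub>?F\<^esub> \<in> carrier ?F" by simp_all
  fix x y assume x: "x \<in> carrier ?F" and y: "y \<in> carrier ?F"
  obtain a s where 1: "a \<in> carrier A" "s \<in> S" "x = fraction A S a s" by (rule fractions_cases[OF x])
  obtain b t where 2: "b \<in> carrier A" "t \<in> S" "y = fraction A S b t" by (rule fractions_cases[OF y])
  note carr = 1(1) 2(1) 1(2)[THEN S_carr] 2(2)[THEN S_carr]
  show "x \<oplus>\<^bsub>?F\<^esub> y \<in> carrier ?F" "x \<otimes>\<^bsub>?F\<^esub> y \<in> carrier ?F" using 1 2 by simp_all
  show "x \<oplus>\<^bsub>?F\<^esub> y = y \<oplus>\<^bsub>?F\<^esub> x" using 1 2 by (simp add: a_comm m_comm)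
  show "x \<otimes>\<^bsub>?F\<^esub> y = y \<otimes>\<^bsub>?F\<^esub> x" using 1 2 by (simp add: m_comm)
  show "\<zero>\<^bsub>?F\<^esub> \<oplus>\<^bsub>?F\<^esub> x = x" using 1 by simp
  show "\<one>\<^bsub>?F\<^esub> \<otimes>\<^bsub>?F\<^esub> x = x" using 1 by simp
  show "\<exists>y\<in>carrier ?F. y \<oplus>\<^bsub>?F\<^esub> x = \<zero>\<^bsub>?F\<^esub>"
  proof (rule bexI[of _ "fraction A S (\<ominus> a) s"])
    show "fraction A S (\<ominus> a) s \<oplus>\<^bsub>?F\<^esub> x = \<zero>\<^bsub>?F\<^esub>"
      using 1 fraction_eqI1[of \<zero> "s \<otimes> s" \<zero> \<one>] by (simp add: r_minus l_neg)
  qed (use 1 in simp)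
  fix z assume z: "z \<in> carrier ?F"
  obtain c v where 3: "c \<in> carrier A" "v \<in> S" "z = fraction A S c v" by (rule fractions_cases[OF z])
  show "x \<otimes>\<^bsub>?F\<^esub> y \<otimes>\<^bsub>?F\<^esub> z = x \<otimes>\<^bsub>?F\<^esub> (y \<otimes>\<^bsub>?F\<^esub> z)" using 1 2 3 by (simp add: m_assoc)
  show "x \<oplus>\<^bsub>?F\<^esub> y \<oplus>\<^bsub>?F\<^esub> z = x \<oplus>\<^bsub>?F\<^esub> (y \<oplus>\<^bsub>?F\<^esub> z)"
    using 1 2 3 by (simp add: m_ac r_distr a_assoc)
  show "(x \<oplus>\<^bsub>?F\<^esub> y) \<otimes>\<^bsub>?F\<^esub> z = x \<otimes>\<^bsub>?F\<^esub> z \<oplus>\<^bsub>?F\<^esub> y \<otimes>\<^bsub>?F\<^esub> z"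
    using 1 2 3 by simp (rule fraction_eqI1; simp add: m_ac r_distr l_distr)
qed

end


section \<open>Algebras essentially of finite type\<close>

text \<open>A \<open>k\<close>-algebra is a commutative ring \<open>B\<close> with a structure homomorphism \<open>\<phi>\<close> from \<open>k\<close> to \<open>B\<close>.\<close>

definition algebra_over ::
    "('k, 'm) ring_scheme \<Rightarrow> ('b, 'n) ring_scheme \<Rightarrow> ('k \<Rightarrow> 'b) \<Rightarrow> bool" where
  "algebra_over k B \<phi> \<longleftrightarrow> cring k \<and> cring B \<and> \<phi> \<in> ring_hom k B"

definition finite_type_algebra ::
    "('k, 'm) ring_scheme \<Rightarrow> ('b, 'n) ring_scheme \<Rightarrow> ('k \<Rightarrow> 'b) \<Rightarrow> bool" where
  "finite_type_algebra k B \<phi> \<longleftrightarrow> algebra_over k B \<phi> \<and>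
     (\<exists>G. finite G \<and> G \<subseteq> carrier B \<and> generate_ring B (\<phi> ` carrier k \<union> G) = carrier B)"

text \<open>\<open>B\<close> is isomorphic, as a \<open>k\<close>-algebra, to a ring of fractions of a \<open>k\<close>-algebra \<open>C\<close> of finite
  type. HOL cannot quantify over the type of the elements of \<open>C\<close> inside a formula, so that type is a
  parameter; leaving it free in the hypotheses of a theorem amounts to allowing any \<open>C\<close>.\<close>

definition essentially_finite_type_algebra ::
    "'c itself \<Rightarrow> ('k, 'm) ring_scheme \<Rightarrow> ('b, 'n) ring_scheme \<Rightarrow> ('k \<Rightarrow> 'b) \<Rightarrow> bool" where
  "essentially_finite_type_algebra (_ :: 'c itself) k B \<phi> \<longleftrightarrow> algebra_over k B \<phi> \<and>
     (\<exists>(C :: 'c ring) \<eta> S h. finite_type_algebra k C \<eta> \<and> submonoid S C \<and>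
        h \<in> ring_iso (fractions C S) B \<and>
        (\<forall>a\<in>carrier k. h (fraction C S (\<eta> a) \<one>\<^bsub>C\<^esub>) = \<phi> a))"


section \<open>Dedekind domains\<close>

text \<open>\<open>x\<close> in the \<open>A\<close>-algebra \<open>K\<close> with structure map \<open>\<iota>\<close> is a root of a monic polynomial over \<open>A\<close>.\<close>

definition integral_element ::
    "('a, 'm) ring_scheme \<Rightarrow> ('b, 'n) ring_scheme \<Rightarrow> ('a \<Rightarrow> 'b) \<Rightarrow> 'b \<Rightarrow> bool" where
  "integral_element A K \<iota> x \<longleftrightarrow> (\<exists>p \<in> carrier (poly_ring A).
     p \<noteq> [] \<and> lead_coeff p = \<one>\<^bsub>A\<^esub> \<and> ring.eval K (map \<iota> p) x = \<zero>\<^bsub>K\<^esub>)"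

definition integrally_closed_domain :: "('a, 'm) ring_scheme \<Rightarrow> bool" where
  "integrally_closed_domain A \<longleftrightarrow> domain A \<and>
     (let S = carrier A - {\<zero>\<^bsub>A\<^esub>}; K = fractions A S; \<iota> = (\<lambda>a. fraction A S a \<one>\<^bsub>A\<^esub>)
      in \<forall>x\<in>carrier K. integral_element A K \<iota> x \<longrightarrow> x \<in> \<iota> ` carrier A)"

text \<open>Fields satisfy this definition. Whether they count as Dedekind domains is a matter of convention,
  and irrelevant for rings with infinitely many maximal ideals.\<close>

definition dedekind_domain :: "('a, 'm) ring_scheme \<Rightarrow> bool" where
  "dedekind_domain A \<longleftrightarrow> noetherian_ring A \<and> integrally_closed_domain A \<and>
     (\<forall>P. primeideal P A \<and> P \<noteq> {\<zero>\<^bsub>A\<^esub>} \<longrightarrow> maximalideal P A)"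

end

theory Submission
  imports Defs
begin

text \<open>Let \<open>E\<close> be a localization of a Noetherian Jacobson ring \<open>A\<close>, or a quotient of \<open>A\<close>. By Noetherian induction
  the complement of every ideal \<open>I\<close> of \<open>E\<close> is positive-existential. The only hard case is a prime \<open>p\<close> that is
  not maximal. As \<open>A\<close> is Jacobson, some nonunit \<open>t \<noteq> 0\<close> of \<open>E / p\<close> has the form \<open>t = 1 - b\<close> with \<open>b\<close> a nonunit of
  the image \<open>D\<close> of \<open>A\<close> in \<open>E / p\<close>. The polynomial \<open>f(v) = b (v + t v\<^sup>N) - 1\<close> has a zero modulo every power of \<open>t\<close>
  by Newton iteration, and for large \<open>N\<close> it has no zero in the fraction field of \<open>D\<close>. By Krull's intersection
  theorem, \<open>x \<notin> p\<close> then holds if and only if \<open>x = z y\<close> modulo \<open>p\<close> for some \<open>z\<close> that divides a value of \<open>f\<close> and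
  some \<open>y \<notin> p + t E\<close>, and \<open>y \<notin> p + t E\<close> is positive-existential by induction.

  If \<open>v\<close> is a zero of \<open>f\<close> in the fraction field, then \<open>u = 1 / v\<close> is integral over \<open>D\<close> and \<open>u\<^sup>N = b (u\<^sup>N\<^sup>-\<^sup>1 + t)\<close>. At a
  minimal prime \<open>P\<close> of \<open>b D\<close> the second factor is close to a unit, so \<open>b\<close> is divisible by about \<open>u\<^sup>N\<close>; filtering
  by the ideals \<open>u\<^sup>i J + b\<^sup>n D\<close>, where \<open>J\<close> is the conductor of \<open>D[u]\<close>, bounds \<open>N\<close> by the finite length of
  \<open>(D / b D)\<^sub>P\<close>.\<close>

section \<open>Ideals of commutative rings\<close>

text \<open>The obstacle is that \<open>x \<noteq> 0\<close> has to be certified by equations alone.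
  Krull's theorem makes a nonzero \<open>x\<close> of \<open>E / p\<close> a product
  \<open>t^n y\<close> with \<open>y\<close> nonzero modulo \<open>t\<close>, but being a power of
  \<open>t\<close> is not an equation. Dividing a value of \<open>f\<close> replaces it: all values
  of \<open>f\<close> are nonzero, yet some are divisible by any given power of \<open>t\<close>.
  The two demands would contradict each other in a ring that is complete for \<open>t\<close>, where
  the approximate zeros converge. The Jacobson property excludes this: \<open>b\<close> is congruent
  to \<open>1\<close> modulo \<open>t\<close> and is nevertheless a nonunit of \<open>D\<close>, so
  there is a prime over \<open>b\<close> at which a zero can be refuted. In \<open>E\<close>, which
  may be local, \<open>b\<close> can well be a unit; therefore zeros are excluded in the fraction
  field of \<open>D\<close>, which contains \<open>E / p\<close>. For (a), Artinian rings are shown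
  to be Noetherian with all primes maximal. For (b), the base rings are Noetherian Jacobson rings,
  and both properties pass to algebras of finite type by Hilbert's basis theorem and the general
  Nullstellensatz, one generator at a time.\<close>

context cring
begin

lemma ideal_carr: "\<lbrakk>ideal I R; x \<in> I\<rbrakk> \<Longrightarrow> x \<in> carrier R"
  by (rule ideal.Icarr)

lemma ideal_zero: "ideal I R \<Longrightarrow> \<zero> \<in> I"
  by (simp add: additive_subgroup.zero_closed ideal.axioms(1))

lemma ideal_add: "\<lbrakk>ideal I R; x \<in> I; y \<in> I\<rbrakk> \<Longrightarrow> x \<oplus> y \<in> I"
  by (simp add: additive_subgroup.a_closed ideal.axioms(1))

lemma ideal_lmult: "\<lbrakk>ideal I R; x \<in> I; y \<in> carrier R\<rbrakk> \<Longrightarrow> y \<otimes> x \<in> I"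
  by (rule ideal.I_l_closed)

lemma ideal_rmult: "\<lbrakk>ideal I R; x \<in> I; y \<in> carrier R\<rbrakk> \<Longrightarrow> x \<otimes> y \<in> I"
  by (rule ideal.I_r_closed)

lemma ideal_neg: "\<lbrakk>ideal I R; x \<in> I\<rbrakk> \<Longrightarrow> \<ominus> x \<in> I"
  by (simp add: additive_subgroup.a_inv_closed ideal.axioms(1))

lemma ideal_minus: "\<lbrakk>ideal I R; x \<in> I; y \<in> I\<rbrakk> \<Longrightarrow> x \<ominus> y \<in> I"
  by (simp add: a_minus_def ideal_add ideal_neg)

lemma idealI_cring:
  assumes "I \<subseteq> carrier R" "\<zero> \<in> I" "\<And>x y. \<lbrakk>x \<in> I; y \<in> I\<rbrakk> \<Longrightarrow> x \<oplus> y \<in> I"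
    and mult: "\<And>x y. \<lbrakk>x \<in> I; y \<in> carrier R\<rbrakk> \<Longrightarrow> y \<otimes> x \<in> I"
  shows "ideal I R"
proof (rule idealI[OF ring_axioms])
  have inv: "\<ominus> x \<in> I" if "x \<in> I" for x
    using mult[OF that, of "\<ominus> \<one>"] that assms(1) by (auto simp: l_minus)
  show "subgroup I (add_monoid R)"
    by (rule add.subgroupI) (use assms inv in \<open>auto simp: a_inv_def[symmetric]\<close>)
  show "x \<otimes> a \<in> I" if "a \<in> I" "x \<in> carrier R" for a x using mult that by auto
  show "a \<otimes> x \<in> I" if "a \<in> I" "x \<in> carrier R" for a x
    using mult[OF that] that assms(1) m_comm[of a x] by auto
qed

definition adjoin :: "'a set \<Rightarrow> 'a \<Rightarrow> 'a set" where
  "adjoin I a = {x. \<exists>i\<in>I. \<exists>y\<in>carrier R. x = i \<oplus> a \<otimes> y}"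

definition colon :: "'a set \<Rightarrow> 'a \<Rightarrow> 'a set" where
  "colon I a = {x \<in> carrier R. a \<otimes> x \<in> I}"

lemma adjoinI: "\<lbrakk>i \<in> I; y \<in> carrier R\<rbrakk> \<Longrightarrow> i \<oplus> a \<otimes> y \<in> adjoin I a"
  unfolding adjoin_def by blast

lemma adjoinE:
  assumes "x \<in> adjoin I a"
  obtains i y where "i \<in> I" "y \<in> carrier R" "x = i \<oplus> a \<otimes> y"
  using assms unfolding adjoin_def by blast

lemma ideal_adjoin:
  assumes I: "ideal I R" and a: "a \<in> carrier R"
  shows "ideal (adjoin I a) R"
proof (rule idealI_cring)
  note [simp] = ideal_carr[OF I] a
  show "adjoin I a \<subseteq> carrier R" by (auto elim!: adjoinE)
  show "\<zero> \<in> adjoin I a" using adjoinI[OF ideal_zero[OF I] zero_closed, of a] by simp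
  fix x y assume x: "x \<in> adjoin I a"
  obtain i u where 1: "i \<in> I" "u \<in> carrier R" "x = i \<oplus> a \<otimes> u" by (rule adjoinE[OF x])
  { assume y: "y \<in> adjoin I a"
    obtain j v where 2: "j \<in> I" "v \<in> carrier R" "y = j \<oplus> a \<otimes> v" by (rule adjoinE[OF y])
    have "x \<oplus> y = (i \<oplus> j) \<oplus> a \<otimes> (u \<oplus> v)" using 1 2 by (simp add: r_distr a_ac)
    then show "x \<oplus> y \<in> adjoin I a" using adjoinI[OF ideal_add[OF I 1(1) 2(1)]] 1 2 by simp }
  { assume y: "y \<in> carrier R"
    have "y \<otimes> x = y \<otimes> i \<oplus> a \<otimes> (y \<otimes> u)" using 1 y by (simp add: r_distr m_ac)
    then show "y \<otimes> x \<in> adjoin I a" using adjoinI[OF ideal_lmult[OF I 1(1) y]] 1 y by simp }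
qed

lemma subset_adjoin: "\<lbrakk>ideal I R; a \<in> carrier R\<rbrakk> \<Longrightarrow> I \<subseteq> adjoin I a"
  using adjoinI[of _ I \<zero> a] ideal_carr by fastforce

lemma mem_adjoin: "\<lbrakk>ideal I R; a \<in> carrier R\<rbrakk> \<Longrightarrow> a \<in> adjoin I a"
  using adjoinI[OF ideal_zero one_closed, of I a] by simp

lemma mult_mem_adjoin: "\<lbrakk>ideal I R; a \<in> carrier R; y \<in> carrier R\<rbrakk> \<Longrightarrow> a \<otimes> y \<in> adjoin I a"
  using adjoinI[OF ideal_zero, of I y a] by simp

lemma adjoin_minimal: "\<lbrakk>ideal J R; I \<subseteq> J; a \<in> J\<rbrakk> \<Longrightarrow> adjoin I a \<subseteq> J"
  by (auto elim!: adjoinE intro!: ideal_add ideal_rmult)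

lemma adjoin_psubset: "\<lbrakk>ideal I R; a \<in> carrier R; a \<notin> I\<rbrakk> \<Longrightarrow> I \<subset> adjoin I a"
  using subset_adjoin mem_adjoin by blast

lemma adjoin_mono: "I \<subseteq> J \<Longrightarrow> adjoin I a \<subseteq> adjoin J a"
  unfolding adjoin_def by blast

lemma ideal_colon:
  assumes I: "ideal I R" and a: "a \<in> carrier R"
  shows "ideal (colon I a) R"
proof (rule idealI_cring)
  show "y \<otimes> x \<in> colon I a" if "x \<in> colon I a" "y \<in> carrier R" for x y
    using that a ideal_lmult[OF I, of "a \<otimes> x" y] by (simp add: colon_def m_lcomm)
qed (use a in \<open>auto simp: colon_def r_distr ideal_zero[OF I] intro!: ideal_add[OF I]\<close>)

lemma subset_colon: "\<lbrakk>ideal I R; a \<in> carrier R\<rbrakk> \<Longrightarrow> I \<subseteq> colon I a"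
  by (auto simp: colon_def ideal_carr ideal_lmult)

lemma ideal_UN_chain:
  fixes I :: "nat \<Rightarrow> 'a set"
  assumes I: "\<And>n. ideal (I n) R" and inc: "\<And>n. I n \<subseteq> I (Suc n)"
  shows "ideal (\<Union>n. I n) R"
proof (rule idealI_cring)
  fix x y assume "x \<in> (\<Union>n. I n)" "y \<in> (\<Union>n. I n)"
  then obtain m n where "x \<in> I m" "y \<in> I n" by auto
  then have "x \<in> I (max m n)" "y \<in> I (max m n)"
    using lift_Suc_mono_le[of I, OF inc] by (meson max.cobounded1 max.cobounded2 subsetD)+
  then show "x \<oplus> y \<in> (\<Union>n. I n)" using ideal_add[OF I] by blast
qed (use ideal_carr[OF I] ideal_zero[OF I] in auto, use ideal_lmult[OF I] in blast)

end

section \<open>Noetherian rings\<close>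

lemma (in cring) noetherian_chain:
  fixes I :: "nat \<Rightarrow> 'a set"
  assumes N: "noetherian_ring R" and I: "\<And>n. ideal (I n) R" and inc: "\<And>n. I n \<subseteq> I (Suc n)"
  shows "\<exists>n. \<forall>m\<ge>n. I m = I n"
proof -
  note mono = lift_Suc_mono_le[of I, OF inc]
  obtain A where A: "A \<subseteq> carrier R" "finite A" "(\<Union>n. I n) = Idl A"
    using noetherian_ring.finetely_gen[OF N ideal_UN_chain[of I, OF I inc]] by auto
  have "A \<subseteq> (\<Union>n. I n)" using A genideal_self[OF A(1)] by simp
  with \<open>finite A\<close> have "\<exists>n. A \<subseteq> I n"
  proof (induction A rule: finite_induct)
    case (insert a A)
    then obtain n m where "A \<subseteq> I n" "a \<in> I m" by auto
    then have "insert a A \<subseteq> I (max m n)"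
      using mono[of n "max m n"] mono[of m "max m n"] by auto
    then show ?case ..
  qed simp
  then obtain n where "A \<subseteq> I n" ..
  then have "(\<Union>n. I n) \<subseteq> I n" using A genideal_minimal[OF I] by simp
  then have "I m = I n" if "n \<le> m" for m using mono[OF that] by blast
  then show ?thesis by blast
qed

text \<open>An ideal that is not finitely generated yields a strictly increasing chain: keep adding
  an element outside the ideal generated so far. Asking for one repetition instead of stationarity
  keeps the later verifications short.\<close>

lemma (in ring) noetherian_ringI_chain:
  assumes ch: "\<And>I :: nat \<Rightarrow> 'a set. \<lbrakk>\<And>n. ideal (I n) R; \<And>n. I n \<subseteq> I (Suc n)\<rbrakk> \<Longrightarrow> \<exists>n. I (Suc n) = I n"
  shows "noetherian_ring R"
proof (rule noetherian_ringI, rule ccontr)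
  fix J assume J: "ideal J R" and nfg: "\<not> (\<exists>A \<subseteq> carrier R. finite A \<and> J = Idl A)"
  have "\<exists>x. x \<in> J - Idl A" if "finite A" "A \<subseteq> J" for A
    using that nfg genideal_minimal[OF J that(2)] ideal.Icarr[OF J] by blast
  then obtain f where f: "\<And>A. finite A \<Longrightarrow> A \<subseteq> J \<Longrightarrow> f A \<in> J - Idl A" by metis
  define S where "S n = ((\<lambda>A. insert (f A) A) ^^ n) {}" for n
  have S: "finite (S n)" "S n \<subseteq> J" for n
    by (induction n) (use f in \<open>auto simp: S_def\<close>)
  have Sc: "S n \<subseteq> carrier R" for n using S(2) ideal.Icarr[OF J] by blast
  have Suc: "S (Suc n) = insert (f (S n)) (S n)" for n by (simp add: S_def)
  obtain n where "Idl (S (Suc n)) = Idl (S n)"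
    using ch[of "\<lambda>n. Idl (S n)"] genideal_ideal[OF Sc] subset_Idl_subset[OF Sc] Suc
    by (metis subset_insertI)
  moreover have "f (S n) \<in> Idl (S (Suc n))" using genideal_self[OF Sc] Suc by blast
  ultimately show False using f[OF S] by auto
qed

context cring
begin

lemma noetherian_induct [consumes 2, case_names less]:
  assumes N: "noetherian_ring R" and I: "ideal I R"
    and step: "\<And>I. \<lbrakk>ideal I R; \<And>J. \<lbrakk>ideal J R; I \<subset> J\<rbrakk> \<Longrightarrow> P J\<rbrakk> \<Longrightarrow> P I"
  shows "P I"
proof (rule ccontr)
  assume "\<not> P I"
  define f where "f J = (SOME K. ideal K R \<and> J \<subset> K \<and> \<not> P K)" for J
  define S where "S n = (f ^^ n) I" for n
  have f: "ideal (f J) R \<and> J \<subset> f J \<and> \<not> P (f J)" if "ideal J R" "\<not> P J" for J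
    unfolding f_def by (rule someI_ex) (use step[OF that(1)] that(2) in blast)
  have S: "ideal (S n) R \<and> \<not> P (S n)" for n
    by (induction n) (use f I \<open>\<not> P I\<close> in \<open>auto simp: S_def\<close>)
  then have lt: "S n \<subset> S (Suc n)" for n using f[of "S n"] by (simp add: S_def)
  obtain n where "\<forall>m\<ge>n. S m = S n"
    using noetherian_chain[OF N, of S] S lt by blast
  then have "S (Suc n) = S n" using le_SucI[of n n] by blast
  then show False using lt[of n] by blast
qed

text \<open>Devissage: if \<open>a \<otimes> b \<in> I\<close> with neither factor in
  \<open>I\<close>, then \<open>adjoin I a\<close>, \<open>adjoin I b\<close> and
  \<open>colon I a\<close> are strictly larger than \<open>I\<close>, the last one because it
  contains \<open>b\<close>. A property then has to be checked only at primes and across such a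
  splitting. This drives the arguments on minimal primes, finite length, complements of ideals and
  Dedekind domains.\<close>

lemma noetherian_prime_induct [consumes 2, case_names carrier prime split]:
  assumes "noetherian_ring R" and "ideal I R"
    and "P (carrier R)"
    and prime: "\<And>I. \<lbrakk>primeideal I R; \<And>J. \<lbrakk>ideal J R; I \<subset> J\<rbrakk> \<Longrightarrow> P J\<rbrakk> \<Longrightarrow> P I"
    and split: "\<And>I a b. \<lbrakk>ideal I R; a \<in> carrier R; b \<in> carrier R; a \<otimes> b \<in> I; a \<notin> I; b \<notin> I;
        P (adjoin I a); P (adjoin I b); P (colon I a)\<rbrakk> \<Longrightarrow> P I"
  shows "P I"
  using assms(1,2)
proof (induction rule: noetherian_induct)
  case (less I)
  consider "primeideal I R" | "I = carrier R" | a b where "a \<in> carrier R" "b \<in> carrier R"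
      "a \<otimes> b \<in> I" "a \<notin> I" "b \<notin> I"
    using ideal.primeidealCD[OF less.hyps is_cring] by blast
  then show ?case
  proof cases
    case (3 a b)
    have "I \<subset> colon I a" using subset_colon[OF less.hyps 3(1)] 3 by (auto simp: colon_def)
    then show ?thesis
      using split[OF less.hyps 3] less.IH ideal_adjoin[OF less.hyps] ideal_colon[OF less.hyps]
        adjoin_psubset[OF less.hyps] 3 by presburger
  qed (use assms(3) prime less.IH in auto)
qed

lemma exists_maximalideal_over:
  assumes "noetherian_ring R" "ideal I R" "I \<noteq> carrier R"
  obtains M where "maximalideal M R" "I \<subseteq> M"
proof -
  have "I \<noteq> carrier R \<longrightarrow> (\<exists>M. maximalideal M R \<and> I \<subseteq> M)"
    using assms(1,2)
  proof (induction rule: noetherian_induct)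
    case (less I)
    show ?case
    proof (cases "maximalideal I R")
      case False
      show ?thesis
      proof
        assume "I \<noteq> carrier R"
        with False obtain J where "ideal J R" "I \<subseteq> J" "J \<noteq> I" "J \<noteq> carrier R"
          using maximalidealI[OF less.hyps] by blast
        then show "\<exists>M. maximalideal M R \<and> I \<subseteq> M" using less.IH[of J] by blast
      qed
    qed blast
  qed
  then show thesis using assms(3) that by blast
qed

lemma maximalideal_inverse:
  assumes M: "maximalideal M R" and a: "a \<in> carrier R" "a \<notin> M"
  obtains y where "y \<in> carrier R" "\<one> \<ominus> a \<otimes> y \<in> M"
proof -
  have I: "ideal M R" using M by (rule maximalideal.axioms)
  have "adjoin M a = carrier R"
    using maximalideal.I_maximal[OF M ideal_adjoin[OF I a(1)] subset_adjoin[OF I a(1)]]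
      mem_adjoin[OF I a(1)] a(2) ideal_carr[OF ideal_adjoin[OF I a(1)]] by blast
  then obtain i y where y: "i \<in> M" "y \<in> carrier R" "\<one> = i \<oplus> a \<otimes> y" using adjoinE by blast
  then have "\<one> \<ominus> a \<otimes> y = i" using a ideal_carr[OF I y(1)] by algebra
  then show ?thesis using that y by simp
qed

text \<open>Unlike \<open>Idl (y ` {..<n})\<close>, this lets membership be analysed one generator at a time.\<close>

primrec seq_ideal :: "(nat \<Rightarrow> 'a) \<Rightarrow> nat \<Rightarrow> 'a set" where
  "seq_ideal y 0 = {\<zero>}"
| "seq_ideal y (Suc n) = adjoin (seq_ideal y n) (y n)"

lemma ideal_seq_ideal: "(\<And>n. y n \<in> carrier R) \<Longrightarrow> ideal (seq_ideal y n) R"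
  by (induction n) (auto intro: zeroideal ideal_adjoin)

lemma noetherian_seq:
  assumes "noetherian_ring R" "\<And>n. y n \<in> carrier R"
  obtains n where "y n \<in> seq_ideal y n"
proof -
  note ideal = ideal_seq_ideal[of y, OF assms(2)]
  obtain n where "\<forall>m\<ge>n. seq_ideal y m = seq_ideal y n"
    using noetherian_chain[OF assms(1), of "seq_ideal y"] ideal subset_adjoin[OF ideal assms(2)]
    by auto
  then have "seq_ideal y (Suc n) = seq_ideal y n" using le_SucI[of n n] by blast
  then have "y n \<in> seq_ideal y n" using mem_adjoin[OF ideal_seq_ideal] assms(2) by auto
  then show thesis by (rule that)
qed

end

section \<open>Primes over an ideal and local length\<close>

context cring
begin

lemma primeideal_power:
  assumes P: "primeideal P R" and x: "x \<in> carrier R" "x [^] (n::nat) \<in> P"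
  shows "x \<in> P"
  using x(2)
proof (induction n)
  case 0
  then show ?case using primeideal.I_notcarr[OF P] ideal.one_imp_carrier[OF primeideal.axioms(1)[OF P]]
    by simp
next
  case (Suc n)
  then show ?case using primeideal.I_prime[OF P, of "x [^] n" x] x(1) by auto
qed

lemma primeideal_one_notin: "primeideal P R \<Longrightarrow> \<one> \<notin> P"
  using primeideal.I_notcarr ideal.one_imp_carrier[OF primeideal.axioms(1)] by blast

lemma primeideal_split:
  assumes Q: "primeideal Q R" "I \<subseteq> Q" and a: "a \<in> carrier R" "b \<in> carrier R" "a \<otimes> b \<in> I"
  shows "adjoin I a \<subseteq> Q \<or> adjoin I b \<subseteq> Q"
proof -
  have "a \<in> Q \<or> b \<in> Q" using primeideal.I_prime[OF Q(1) a(1,2)] Q(2) a(3) by blast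
  then show ?thesis using adjoin_minimal[OF primeideal.axioms(1)[OF Q(1)] Q(2)] by blast
qed

text \<open>Minimality of the members of the family is not asked for, so that the two families of a
  splitting can simply be united: a prime over \<open>I\<close> contains \<open>a\<close> or
  \<open>b\<close> when \<open>a \<otimes> b \<in> I\<close>.\<close>

lemma finite_primes_below:
  assumes "noetherian_ring R" "ideal I R"
  shows "\<exists>\<Q>. finite \<Q> \<and> (\<forall>Q\<in>\<Q>. primeideal Q R \<and> I \<subseteq> Q) \<and>
    (\<forall>Q'. primeideal Q' R \<and> I \<subseteq> Q' \<longrightarrow> (\<exists>Q\<in>\<Q>. Q \<subseteq> Q'))"
  using assms
proof (induction rule: noetherian_prime_induct)
  case carrier
  have "\<not> (primeideal Q' R \<and> carrier R \<subseteq> Q')" for Q'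
    using primeideal_one_notin[of Q'] one_closed by blast
  then show ?case by (intro exI[of _ "{}"]) blast
next
  case (prime I)
  then show ?case by (intro exI[of _ "{I}"]) blast
next
  case (split I a b)
  from split(7) obtain Q1 where Q1: "finite Q1" "\<forall>Q\<in>Q1. primeideal Q R \<and> adjoin I a \<subseteq> Q"
    "\<forall>Q'. primeideal Q' R \<and> adjoin I a \<subseteq> Q' \<longrightarrow> (\<exists>Q\<in>Q1. Q \<subseteq> Q')"
    by (elim exE conjE) (rule that)
  from split(8) obtain Q2 where Q2: "finite Q2" "\<forall>Q\<in>Q2. primeideal Q R \<and> adjoin I b \<subseteq> Q"
    "\<forall>Q'. primeideal Q' R \<and> adjoin I b \<subseteq> Q' \<longrightarrow> (\<exists>Q\<in>Q2. Q \<subseteq> Q')"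
    by (elim exE conjE) (rule that)
  have 1: "primeideal Q R \<and> I \<subseteq> Q" if "Q \<in> Q1 \<union> Q2" for Q
    using that Q1(2) Q2(2) subset_adjoin[OF split(1,2)] subset_adjoin[OF split(1,3)] by blast
  have 2: "\<exists>Q\<in>Q1 \<union> Q2. Q \<subseteq> Q'" if "primeideal Q' R" "I \<subseteq> Q'" for Q'
    using primeideal_split[OF that split(2,3,4)] Q1(3) Q2(3) that(1) by blast
  have "finite (Q1 \<union> Q2)" using Q1(1) Q2(1) by simp
  moreover have "\<forall>Q\<in>Q1 \<union> Q2. primeideal Q R \<and> I \<subseteq> Q" by (intro ballI 1)
  moreover have "\<forall>Q'. primeideal Q' R \<and> I \<subseteq> Q' \<longrightarrow> (\<exists>Q\<in>Q1 \<union> Q2. Q \<subseteq> Q')"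
    by (intro allI impI 2) (erule conjunct1 conjunct2)+
  ultimately show ?case by (intro exI[of _ "Q1 \<union> Q2"] conjI)
qed

lemma exists_minimal_prime_over:
  assumes "noetherian_ring R" "ideal I R" "I \<noteq> carrier R"
  obtains P where "primeideal P R" "I \<subseteq> P" "\<And>Q. \<lbrakk>primeideal Q R; I \<subseteq> Q; Q \<subseteq> P\<rbrakk> \<Longrightarrow> Q = P"
proof -
  obtain \<Q> where Q: "finite \<Q>" "\<forall>Q\<in>\<Q>. primeideal Q R \<and> I \<subseteq> Q"
    "\<forall>Q'. primeideal Q' R \<and> I \<subseteq> Q' \<longrightarrow> (\<exists>Q\<in>\<Q>. Q \<subseteq> Q')"
    using finite_primes_below[OF assms(1,2)] by (elim exE conjE) (rule that)
  obtain M where "maximalideal M R" "I \<subseteq> M" by (rule exists_maximalideal_over[OF assms])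
  then have "\<Q> \<noteq> {}" using Q(3) maximalideal_prime by blast
  then obtain P where P: "P \<in> \<Q>" "\<forall>Q\<in>\<Q>. Q \<subseteq> P \<longrightarrow> P = Q"
    using finite_has_minimal[OF Q(1)] by blast
  show thesis
  proof (rule that[of P])
    fix Q' assume "primeideal Q' R" "I \<subseteq> Q'" "Q' \<subseteq> P"
    moreover obtain Q where "Q \<in> \<Q>" "Q \<subseteq> Q'" using Q(3) calculation by blast
    ultimately show "Q' = P" using P(2) by blast
  qed (use P Q in auto)
qed

text \<open>\<open>local_subset P E F\<close> says \<open>E\<^sub>P \<subseteq> F\<^sub>P\<close> when \<open>E\<close> is finitely generated, and \<open>length_le P E F l\<close> that
  \<open>E\<^sub>P / F\<^sub>P\<close> has length at most \<open>l\<close>.\<close>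

definition local_subset :: "'a set \<Rightarrow> 'a set \<Rightarrow> 'a set \<Rightarrow> bool" where
  "local_subset P E F \<longleftrightarrow> (\<exists>y\<in>carrier R - P. \<forall>x\<in>E. y \<otimes> x \<in> F)"

definition ideal_chain :: "'a set \<Rightarrow> 'a set \<Rightarrow> (nat \<Rightarrow> 'a set) \<Rightarrow> bool" where
  "ideal_chain E F I \<longleftrightarrow> (\<forall>n. ideal (I n) R \<and> I (Suc n) \<subseteq> I n \<and> F \<subseteq> I n \<and> I n \<subseteq> E)"

definition length_le :: "'a set \<Rightarrow> 'a set \<Rightarrow> 'a set \<Rightarrow> nat \<Rightarrow> bool" where
  "length_le P E F l \<longleftrightarrow> (\<forall>I T. ideal_chain E F I \<longrightarrow> finite T \<longrightarrow>
     (\<forall>n\<in>T. \<not> local_subset P (I n) (I (Suc n))) \<longrightarrow> card T \<le> l)"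

lemma length_leD:
  "\<lbrakk>length_le P E F l; ideal_chain E F I; finite T; \<And>n. n \<in> T \<Longrightarrow> \<not> local_subset P (I n) (I (Suc n))\<rbrakk>
   \<Longrightarrow> card T \<le> l"
  unfolding length_le_def by blast

lemma set_addI: "\<lbrakk>x \<in> I; y \<in> J\<rbrakk> \<Longrightarrow> x \<oplus> y \<in> set_add R I J"
  unfolding set_add_def' by blast

text \<open>A localized modular law. If \<open>y x = j + f\<close>, then \<open>f = y x - j\<close>
  lies in \<open>I \<inter> F\<close>, and a second denominator \<open>z\<close> moves it into
  \<open>J\<close>.\<close>

lemma local_subset_mult:
  assumes P: "primeideal P R" and I: "ideal I R" "ideal J R" "ideal F R" "J \<subseteq> I"
    and 1: "local_subset P (set_add R I F) (set_add R J F)"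
    and 2: "local_subset P (I \<inter> F) (J \<inter> F)"
  shows "local_subset P I J"
proof -
  obtain y where y: "y \<in> carrier R - P" "\<And>x. x \<in> set_add R I F \<Longrightarrow> y \<otimes> x \<in> set_add R J F"
    using 1 unfolding local_subset_def by blast
  obtain z where z: "z \<in> carrier R - P" "\<And>x. x \<in> I \<inter> F \<Longrightarrow> z \<otimes> x \<in> J \<inter> F"
    using 2 unfolding local_subset_def by blast
  have "(z \<otimes> y) \<otimes> x \<in> J" if x: "x \<in> I" for x
  proof -
    have xc: "x \<in> carrier R" using ideal_carr[OF I(1) x] .
    have "x \<in> set_add R I F"
      using set_addI[OF x ideal_zero[OF I(3)]] xc by simp
    then obtain j f where j: "j \<in> J" "f \<in> F" "y \<otimes> x = j \<oplus> f"
      using y(2) unfolding set_add_def' by blast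
    note c = ideal_carr[OF I(2) j(1)] ideal_carr[OF I(3) j(2)]
    have yx: "y \<otimes> x \<in> I" using ideal_lmult[OF I(1) x] y by blast
    have "y \<otimes> x \<ominus> j = f" using j(3) c by algebra
    moreover have "y \<otimes> x \<ominus> j \<in> I" using ideal_minus[OF I(1) yx] j(1) I(4) by blast
    ultimately have "f \<in> I \<inter> F" using j(2) by simp
    then have "z \<otimes> f \<in> J" using z(2) by blast
    moreover have "(z \<otimes> y) \<otimes> x = z \<otimes> j \<oplus> z \<otimes> f"
      using y z xc c j(3) by (metis Diff_iff m_assoc r_distr)
    ultimately show ?thesis using ideal_add[OF I(2) ideal_lmult[OF I(2) j(1)]] z(1) by auto
  qed
  moreover have "z \<otimes> y \<in> carrier R - P" using y(1) z(1) primeideal.I_prime[OF P] by blast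
  ultimately show ?thesis unfolding local_subset_def by blast
qed

text \<open>Additivity of length. The chain is mapped to the ideals \<open>I n + F\<close> and
  \<open>I n \<inter> F\<close>; by \<open>local_subset_mult\<close> every strict step stays strict
  in one of the two. Because strict steps are marked by a set instead of being required throughout,
  both images are still admissible chains although some of their steps collapse.\<close>

lemma length_le_trans:
  assumes P: "primeideal P R" and F: "ideal F R" "ideal E R" "G \<subseteq> F" "F \<subseteq> E"
    and 1: "length_le P E F l" and 2: "length_le P F G l'"
  shows "length_le P E G (l + l')"
  unfolding length_le_def
proof (intro allI impI)
  fix I T assume ch: "ideal_chain E G I" and T: "finite T"
    and ns: "\<forall>n\<in>T. \<not> local_subset P (I n) (I (Suc n))"
  have I: "ideal (I n) R" "I (Suc n) \<subseteq> I n" "G \<subseteq> I n" "I n \<subseteq> E" for n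
    using ch unfolding ideal_chain_def by auto
  define T1 where "T1 = {n\<in>T. \<not> local_subset P (set_add R (I n) F) (set_add R (I (Suc n)) F)}"
  define T2 where "T2 = {n\<in>T. \<not> local_subset P (I n \<inter> F) (I (Suc n) \<inter> F)}"
  have "ideal_chain E F (\<lambda>n. set_add R (I n) F)"
    unfolding ideal_chain_def
  proof (intro allI conjI)
    fix n
    show "ideal (set_add R (I n) F) R" by (rule add_ideals[OF I(1) F(1)])
    show "set_add R (I (Suc n)) F \<subseteq> set_add R (I n) F"
      using I(2)[of n] unfolding set_add_def' by blast
    show "F \<subseteq> set_add R (I n) F"
    proof
      fix f assume f: "f \<in> F"
      then have "f = \<zero> \<oplus> f" using ideal_carr[OF F(1)] by simp
      then show "f \<in> set_add R (I n) F" using set_addI[OF ideal_zero[OF I(1)] f] by simp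
    qed
    show "set_add R (I n) F \<subseteq> E"
      using I(4)[of n] F(4) ideal_add[OF F(2)] unfolding set_add_def' by blast
  qed
  then have c1: "card T1 \<le> l" by (rule length_leD[OF 1]) (auto simp: T1_def T)
  have "ideal_chain F G (\<lambda>n. I n \<inter> F)"
    unfolding ideal_chain_def using I(2,3) F(3) i_intersect[OF I(1) F(1)] by blast
  then have c2: "card T2 \<le> l'" by (rule length_leD[OF 2]) (auto simp: T2_def T)
  have "T \<subseteq> T1 \<union> T2"
    using ns local_subset_mult[OF P I(1) I(1) F(1) I(2)] unfolding T1_def T2_def by blast
  then have "card T \<le> card (T1 \<union> T2)" using T by (intro card_mono) (auto simp: T1_def T2_def)
  also have "\<dots> \<le> card T1 + card T2" by (rule card_Un_le)
  finally show "card T \<le> l + l'" using c1 c2 by simp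
qed

lemma colon_subset: "colon I a \<subseteq> carrier R"
  by (auto simp: colon_def)

lemma colon_mono: "I \<subseteq> J \<Longrightarrow> colon I a \<subseteq> colon J a"
  by (auto simp: colon_def)

text \<open>Multiplication by \<open>a\<close> identifies \<open>R / (I : a)\<close> with
  \<open>(I + a R) / I\<close>, and \<open>colon\<close> pulls chains back along it.\<close>

lemma length_le_adjoin:
  assumes P: "primeideal P R" and I: "ideal I R" "a \<in> carrier R"
    and 1: "length_le P (carrier R) (colon I a) l"
  shows "length_le P (adjoin I a) I l"
  unfolding length_le_def
proof (intro allI impI)
  fix S T assume ch: "ideal_chain (adjoin I a) I S" and T: "finite T"
    and ns: "\<forall>n\<in>T. \<not> local_subset P (S n) (S (Suc n))"
  have S: "ideal (S n) R" "S (Suc n) \<subseteq> S n" "I \<subseteq> S n" "S n \<subseteq> adjoin I a" for n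
    using ch unfolding ideal_chain_def by auto
  have "ideal_chain (carrier R) (colon I a) (\<lambda>n. colon (S n) a)"
    unfolding ideal_chain_def
    using ideal_colon[OF S(1) I(2)] colon_mono[OF S(2)] colon_mono[OF S(3)] colon_subset by simp
  moreover have "\<not> local_subset P (colon (S n) a) (colon (S (Suc n)) a)" if n: "n \<in> T" for n
  proof
    assume "local_subset P (colon (S n) a) (colon (S (Suc n)) a)"
    then obtain y where y: "y \<in> carrier R - P"
      "\<And>x. x \<in> colon (S n) a \<Longrightarrow> y \<otimes> x \<in> colon (S (Suc n)) a"
      unfolding local_subset_def by blast
    have "y \<otimes> x \<in> S (Suc n)" if x: "x \<in> S n" for x
    proof -
      from x S(4) have "x \<in> adjoin I a" by blast
      then obtain j d where d: "j \<in> I" "d \<in> carrier R" "x = j \<oplus> a \<otimes> d" by (rule adjoinE)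
      note c = ideal_carr[OF I(1) d(1)] I(2) d(2)
      have "a \<otimes> d = x \<ominus> j" using d(3) c by algebra
      then have "a \<otimes> d \<in> S n" using ideal_minus[OF S(1) x] d(1) S(3) by auto
      then have "y \<otimes> d \<in> colon (S (Suc n)) a" using y(2) d(2) by (auto simp: colon_def)
      then have "a \<otimes> (y \<otimes> d) \<in> S (Suc n)" by (simp add: colon_def)
      moreover have "y \<otimes> j \<in> S (Suc n)" using ideal_lmult[OF S(1)] S(3) d(1) y(1) by blast
      moreover have "y \<otimes> x = y \<otimes> j \<oplus> a \<otimes> (y \<otimes> d)" using d(3) c y(1) by (simp add: r_distr m_lcomm)
      ultimately show ?thesis using ideal_add[OF S(1)] by simp
    qed
    then show False using ns n y(1) unfolding local_subset_def by blast
  qed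
  ultimately show "card T \<le> l" using length_leD[OF 1 _ T] by blast
qed

text \<open>At \<open>P\<close> the ring \<open>R / P\<close> becomes a field: an ideal properly
  above \<open>P\<close> contains some \<open>y \<notin> P\<close>, and multiplication by
  \<open>y\<close> moves everything into it. So a strict step must arrive at \<open>P\<close>
  itself, after which the chain is constant.\<close>

lemma length_le_minimal_prime:
  assumes P: "primeideal P R"
  shows "length_le P (carrier R) P 1"
  unfolding length_le_def
proof (intro allI impI)
  fix I T assume ch: "ideal_chain (carrier R) P I" and T: "finite T"
    and ns: "\<forall>n\<in>T. \<not> local_subset P (I n) (I (Suc n))"
  have I: "ideal (I n) R" "I (Suc n) \<subseteq> I n" "P \<subseteq> I n" for n
    using ch unfolding ideal_chain_def by auto
  have anti: "n \<le> m \<Longrightarrow> I m \<subseteq> I n" for n m by (rule lift_Suc_antimono_le[of I, OF I(2)])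
  have eq: "I (Suc n) = P" if "n \<in> T" for n
  proof (rule ccontr)
    assume "I (Suc n) \<noteq> P"
    then obtain y where y: "y \<in> I (Suc n)" "y \<notin> P" using I(3) by blast
    then have "local_subset P (I n) (I (Suc n))"
      unfolding local_subset_def using ideal_rmult[OF I(1) y(1)] ideal_carr[OF I(1)] by blast
    then show False using ns that by blast
  qed
  have "\<not> n < m" if "n \<in> T" "m \<in> T" for n m
  proof
    assume "n < m"
    then have "I m \<subseteq> P" using anti[of "Suc n" m] eq[OF that(1)] by simp
    then have "I m \<subseteq> I (Suc m)" using I(3) by blast
    then have "local_subset P (I m) (I (Suc m))"
      unfolding local_subset_def
      using primeideal_one_notin[OF P] ideal_carr[OF I(1)] by (intro bexI[of _ \<one>]) auto
    then show False using ns that by blast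
  qed
  then have "\<forall>n\<in>T. \<forall>m\<in>T. n = m" by (meson linorder_neqE_nat)
  then show "card T \<le> 1" using card_le_Suc0_iff_eq[OF T] by simp
qed

lemma length_le_zero:
  assumes P: "primeideal P R" and I: "ideal I R" "y \<in> I" "y \<notin> P"
  shows "length_le P (carrier R) I 0"
  unfolding length_le_def
proof (intro allI impI)
  fix S T assume ch: "ideal_chain (carrier R) I S" and T: "finite T"
    and ns: "\<forall>n\<in>T. \<not> local_subset P (S n) (S (Suc n))"
  have S: "ideal (S n) R" "I \<subseteq> S n" for n using ch unfolding ideal_chain_def by auto
  have "local_subset P (S n) (S (Suc n))" for n
    unfolding local_subset_def
    using ideal_rmult[OF S(1), of y "Suc n"] S(2) I ideal_carr[OF S(1)] by blast
  then have "T = {}" using ns by blast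
  then show "card T \<le> 0" by simp
qed

text \<open>The induction runs over the ideals above \<open>I0\<close>. A prime among them is
  \<open>P\<close>, of length one, or by minimality of \<open>P\<close> not contained in
  \<open>P\<close>, of length zero. A splitting adds the lengths of \<open>R / (I + a R)\<close> and
  of \<open>(I + a R) / I\<close>, which is a copy of \<open>R / (I : a)\<close>.\<close>

lemma finite_local_length:
  assumes N: "noetherian_ring R" and I0: "ideal I0 R"
    and P: "primeideal P R" "\<And>Q. \<lbrakk>primeideal Q R; I0 \<subseteq> Q; Q \<subseteq> P\<rbrakk> \<Longrightarrow> Q = P"
  shows "\<exists>l. length_le P (carrier R) I0 l"
proof -
  have "I0 \<subseteq> I \<longrightarrow> (\<exists>l. length_le P (carrier R) I l)" if "ideal I R" for I
    using N that
  proof (induction rule: noetherian_prime_induct)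
    case carrier
    show ?case using length_le_zero[OF P(1) oneideal one_closed primeideal_one_notin[OF P(1)]] by blast
  next
    case (prime I)
    show ?case
    proof
      assume "I0 \<subseteq> I"
      then consider "I = P" | y where "y \<in> I" "y \<notin> P" using P(2)[OF prime(1)] by blast
      then show "\<exists>l. length_le P (carrier R) I l"
      proof cases
        case 1
        then show ?thesis using length_le_minimal_prime[OF P(1)] by blast
      next
        case 2
        then show ?thesis using length_le_zero[OF P(1) primeideal.axioms(1)[OF prime(1)]] by blast
      qed
    qed
  next
    case (split I a b)
    show ?case
    proof
      assume s: "I0 \<subseteq> I"
      note sa = subset_adjoin[OF split(1,2)]
      from split(7) s sa obtain l where l: "length_le P (carrier R) (adjoin I a) l" by blast
      have "I0 \<subseteq> colon I a" using subset_colon[OF split(1,2)] s by blast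
      with split(9) obtain m where "length_le P (carrier R) (colon I a) m" by blast
      then have m: "length_le P (adjoin I a) I m" by (rule length_le_adjoin[OF P(1) split(1,2)])
      have "length_le P (carrier R) I (l + m)"
        using length_le_trans[OF P(1) ideal_adjoin[OF split(1,2)] oneideal sa _ l m]
          ideal_carr[OF ideal_adjoin[OF split(1,2)]] by blast
      then show "\<exists>l. length_le P (carrier R) I l" ..
    qed
  qed
  then show ?thesis using I0 by blast
qed

text \<open>Each successive quotient of the ideals \<open>q + b^n R\<close> is a copy of
  \<open>R / (q + b R)\<close>, because \<open>b\<close> is not a zero divisor modulo the prime
  \<open>q\<close>.\<close>

lemma length_le_power:
  assumes P: "primeideal P R" and q: "primeideal q R" and b: "b \<in> carrier R" "b \<notin> q"
    and l: "length_le P (carrier R) (adjoin q b) l"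
  shows "length_le P (carrier R) (adjoin q (b [^] n)) (n * l)"
proof (induction n)
  case 0
  have "\<one> \<in> adjoin q (b [^] (0::nat))"
    using mem_adjoin[OF primeideal.axioms(1)[OF q], of \<one>] by simp
  then show ?case
    using length_le_zero[OF P ideal_adjoin[OF primeideal.axioms(1)[OF q], of "b [^] (0::nat)"]]
      primeideal_one_notin[OF P] b by simp
next
  case (Suc n)
  have qi: "ideal q R" by (rule primeideal.axioms(1)[OF q])
  let ?I = "adjoin q (b [^] Suc n)"
  have bn: "b [^] n \<in> carrier R" "b [^] Suc n \<in> carrier R" using b by auto
  have I: "ideal ?I R" by (rule ideal_adjoin[OF qi bn(2)])
  have "colon ?I (b [^] n) = adjoin q b"
  proof
    show "colon ?I (b [^] n) \<subseteq> adjoin q b"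
    proof
      fix x assume "x \<in> colon ?I (b [^] n)"
      then have x: "x \<in> carrier R" "b [^] n \<otimes> x \<in> ?I" by (auto simp: colon_def)
      from x(2) obtain i y where y: "i \<in> q" "y \<in> carrier R" "b [^] n \<otimes> x = i \<oplus> b [^] Suc n \<otimes> y"
        by (rule adjoinE)
      note ic = ideal_carr[OF qi y(1)]
      have "b [^] n \<otimes> (x \<ominus> b \<otimes> y) = b [^] n \<otimes> x \<ominus> b [^] Suc n \<otimes> y"
        using x(1) y(2) bn b by (simp add: m_assoc a_minus_def r_distr r_minus)
      also have "\<dots> = i" using y x(1) bn ic by algebra
      finally have "x \<ominus> b \<otimes> y \<in> q"
        using primeideal.I_prime[OF q bn(1), of "x \<ominus> b \<otimes> y"] y(1,2) x(1) b
          primeideal_power[OF q b(1)] by auto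
      then have "(x \<ominus> b \<otimes> y) \<oplus> b \<otimes> y \<in> adjoin q b" using y(2) by (rule adjoinI)
      moreover have "(x \<ominus> b \<otimes> y) \<oplus> b \<otimes> y = x" using x(1) y(2) b by algebra
      ultimately show "x \<in> adjoin q b" by simp
    qed
    have "q \<subseteq> colon ?I (b [^] n)"
      using subset_colon[OF I bn(1)] subset_adjoin[OF qi bn(2)] by blast
    moreover have "b \<in> colon ?I (b [^] n)"
      using b(1) mem_adjoin[OF qi bn(2)] by (simp add: colon_def)
    ultimately show "adjoin q b \<subseteq> colon ?I (b [^] n)"
      by (rule adjoin_minimal[OF ideal_colon[OF I bn(1)]])
  qed
  then have 1: "length_le P (adjoin ?I (b [^] n)) ?I l"
    using length_le_adjoin[OF P I bn(1)] l by simp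
  have "b [^] Suc n \<in> adjoin q (b [^] n)"
    using mult_mem_adjoin[OF qi bn(1) b(1)] b by simp
  then have "?I \<subseteq> adjoin q (b [^] n)"
    using adjoin_minimal[OF ideal_adjoin[OF qi bn(1)] subset_adjoin[OF qi bn(1)]] by blast
  then have "adjoin ?I (b [^] n) \<subseteq> adjoin q (b [^] n)"
    using adjoin_minimal[OF ideal_adjoin[OF qi bn(1)]] mem_adjoin[OF qi bn(1)] by blast
  moreover have "adjoin q (b [^] n) \<subseteq> adjoin ?I (b [^] n)"
    using subset_adjoin[OF qi bn(2)] by (rule adjoin_mono)
  ultimately have "adjoin ?I (b [^] n) = adjoin q (b [^] n)" by blast
  with 1 have 2: "length_le P (adjoin q (b [^] n)) ?I l" by simp
  have "length_le P (carrier R) ?I (n * l + l)"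
    using length_le_trans[OF P ideal_adjoin[OF qi bn(1)] oneideal \<open>?I \<subseteq> _\<close> _ Suc.IH 2]
      ideal_carr[OF ideal_adjoin[OF qi bn(1)]] by blast
  then show ?case by (simp add: add.commute)
qed

end

section \<open>The conductor of an integral element\<close>

text \<open>Here \<open>u\<close> is integral over the image of \<open>R\<close>, with \<open>u\<^sup>N = b (u\<^sup>N\<^sup>-\<^sup>1 + d)\<close> for \<open>N = M + 2\<close>; \<open>T\<close> is the
  conductor of \<open>R[u]\<close>, as a subset of \<open>S\<close>, and \<open>J\<close> its preimage.\<close>

locale conductor = ring_hom_cring R S h + S?: domain S
  for R (structure) and S (structure) and h +
  fixes b d u M
  assumes b: "b \<in> carrier R" and d: "d \<in> carrier R" and u: "u \<in> carrier S" "u \<noteq> \<zero>\<^bsub>S\<^esub>"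
    and u_pow: "u [^]\<^bsub>S\<^esub> Suc (Suc M) = h b \<otimes>\<^bsub>S\<^esub> (u [^]\<^bsub>S\<^esub> Suc M \<oplus>\<^bsub>S\<^esub> h d)"
begin

declare hom_pow [simp del]

definition T where "T = {t \<in> carrier S. \<forall>i::nat. u [^]\<^bsub>S\<^esub> i \<otimes>\<^bsub>S\<^esub> t \<in> h ` carrier R}"

definition J where "J = {x \<in> carrier R. h x \<in> T}"

definition eps where "eps = u [^]\<^bsub>S\<^esub> Suc M \<oplus>\<^bsub>S\<^esub> h d"

lemma eps_closed [simp]: "eps \<in> carrier S"
  unfolding eps_def using u d by simp

lemma u_closed [simp]: "u \<in> carrier S" "u [^]\<^bsub>S\<^esub> (n::nat) \<in> carrier S"
  using u by auto

lemma u_pow_nonzero: "u [^]\<^bsub>S\<^esub> (n::nat) \<noteq> \<zero>\<^bsub>S\<^esub>"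
  by (induction n) (use u in \<open>simp_all add: S.integral_iff\<close>)

lemma u_pow_eps: "u [^]\<^bsub>S\<^esub> Suc (Suc M) = h b \<otimes>\<^bsub>S\<^esub> eps"
  unfolding eps_def by (rule u_pow)

lemma T_closed: "t \<in> T \<Longrightarrow> t \<in> carrier S"
  by (simp add: T_def)

lemma T_add: "\<lbrakk>t \<in> T; t' \<in> T\<rbrakk> \<Longrightarrow> t \<oplus>\<^bsub>S\<^esub> t' \<in> T"
  unfolding T_def
proof (safe, goal_cases)
  case (2 i)
  from 2(2,4) obtain x y where xy: "x \<in> carrier R" "u [^]\<^bsub>S\<^esub> i \<otimes>\<^bsub>S\<^esub> t = h x"
    "y \<in> carrier R" "u [^]\<^bsub>S\<^esub> i \<otimes>\<^bsub>S\<^esub> t' = h y" by (meson imageE)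
  then have "u [^]\<^bsub>S\<^esub> i \<otimes>\<^bsub>S\<^esub> (t \<oplus>\<^bsub>S\<^esub> t') = h (x \<oplus> y)" using 2(1,3) by (simp add: S.r_distr)
  then show ?case using xy by blast
qed simp

lemma T_scale: "\<lbrakk>t \<in> T; a \<in> carrier R\<rbrakk> \<Longrightarrow> h a \<otimes>\<^bsub>S\<^esub> t \<in> T"
  unfolding T_def
proof (safe, goal_cases)
  case (2 i)
  from 2(3) obtain x where x: "x \<in> carrier R" "u [^]\<^bsub>S\<^esub> i \<otimes>\<^bsub>S\<^esub> t = h x" by (meson imageE)
  then have "u [^]\<^bsub>S\<^esub> i \<otimes>\<^bsub>S\<^esub> (h a \<otimes>\<^bsub>S\<^esub> t) = h (a \<otimes> x)"
    using 2(1,2) by (simp add: S.m_lcomm)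
  then show ?case using x 2(1) by blast
qed simp

lemma T_zero: "\<zero>\<^bsub>S\<^esub> \<in> T"
  unfolding T_def using R.zero_closed hom_zero by (force intro: image_eqI[of _ _ \<zero>])

lemma T_u: "t \<in> T \<Longrightarrow> u \<otimes>\<^bsub>S\<^esub> t \<in> T"
  unfolding T_def
proof (safe, goal_cases)
  case (2 i)
  have "u [^]\<^bsub>S\<^esub> i \<otimes>\<^bsub>S\<^esub> (u \<otimes>\<^bsub>S\<^esub> t) = u [^]\<^bsub>S\<^esub> (Suc i) \<otimes>\<^bsub>S\<^esub> t"
    using 2(1) by (simp add: S.m_assoc)
  then show ?case using 2(2) by metis
qed simp

lemma T_u_pow: "t \<in> T \<Longrightarrow> u [^]\<^bsub>S\<^esub> (n::nat) \<otimes>\<^bsub>S\<^esub> t \<in> T"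
proof (induction n)
  case (Suc n)
  then show ?case using T_u[of "u [^]\<^bsub>S\<^esub> n \<otimes>\<^bsub>S\<^esub> t"] T_closed
    by (simp add: S.m_assoc S.m_lcomm)
qed (simp add: T_closed)

lemma T_eps: "t \<in> T \<Longrightarrow> eps \<otimes>\<^bsub>S\<^esub> t \<in> T"
  unfolding eps_def using T_add[OF T_u_pow T_scale[OF _ d], of t t "Suc M"] T_closed[of t] d
  by (simp add: S.l_distr del: S.nat_pow_Suc)

lemma T_eps_pow: "t \<in> T \<Longrightarrow> eps [^]\<^bsub>S\<^esub> (n::nat) \<otimes>\<^bsub>S\<^esub> t \<in> T"
proof (induction n)
  case (Suc n)
  then show ?case using T_eps[of "eps [^]\<^bsub>S\<^esub> n \<otimes>\<^bsub>S\<^esub> t"] T_closed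
    by (simp add: S.m_assoc S.m_lcomm)
qed (simp add: T_closed)

lemma T_image: "t \<in> T \<Longrightarrow> \<exists>x\<in>J. h x = t"
proof -
  assume t: "t \<in> T"
  then have "u [^]\<^bsub>S\<^esub> (0::nat) \<otimes>\<^bsub>S\<^esub> t \<in> h ` carrier R" unfolding T_def by blast
  then show ?thesis using t T_closed[OF t] by (auto simp: J_def)
qed

lemma ideal_J: "ideal J R"
  by (rule R.idealI_cring) (auto simp: J_def T_zero T_add T_scale)

lemma T_minus:
  assumes "t \<in> T" "t' \<in> T" shows "t \<ominus>\<^bsub>S\<^esub> t' \<in> T"
proof -
  obtain x y where xy: "x \<in> J" "h x = t" "y \<in> J" "h y = t'" using assms T_image by blast
  then have "x \<ominus> y \<in> J" using R.ideal_minus[OF ideal_J] by blast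
  moreover have "h (x \<ominus> y) = t \<ominus>\<^bsub>S\<^esub> t'" using xy by (simp add: J_def a_minus_def)
  ultimately show ?thesis by (auto simp: J_def)
qed

text \<open>Here \<open>u\<close> is the fraction of \<open>s\<close> by \<open>c\<close>, and
  \<open>c^i\<close> clears the denominator of \<open>u^i\<close>. By the integral equation all
  powers of \<open>u\<close> are combinations of those with exponent at most \<open>M + 1\<close>,
  so the single factor \<open>c^(M+1)\<close> is enough. It provides a nonzero element of the
  conductor.\<close>

lemma T_nonzero:
  assumes "s \<in> carrier R" "c \<in> carrier R" "h c \<otimes>\<^bsub>S\<^esub> u = h s"
  shows "h (c [^] Suc M) \<in> T"
proof -
  have comm3: "\<lbrakk>x \<in> carrier S; y \<in> carrier S; z \<in> carrier S\<rbrakk> \<Longrightarrow> x \<otimes>\<^bsub>S\<^esub> (y \<otimes>\<^bsub>S\<^esub> z) = y \<otimes>\<^bsub>S\<^esub> x \<otimes>\<^bsub>S\<^esub> z"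
    for x y z by (simp add: S.m_ac)
  have "u [^]\<^bsub>S\<^esub> i \<otimes>\<^bsub>S\<^esub> h (c [^] Suc M) \<in> h ` carrier R" for i :: nat
  proof (induction i rule: less_induct)
    case (less i)
    show ?case
    proof (cases "i \<le> Suc M")
      case True
      then have "c [^] i \<otimes> c [^] (Suc M - i) = c [^] Suc M"
        using assms R.nat_pow_mult[of c i "Suc M - i"] by (simp del: R.nat_pow_Suc)
      then have "h (c [^] Suc M) = h (c [^] i) \<otimes>\<^bsub>S\<^esub> h (c [^] (Suc M - i))"
        using assms hom_mult R.nat_pow_closed by metis
      moreover have "h (c [^] i) \<otimes>\<^bsub>S\<^esub> u [^]\<^bsub>S\<^esub> i = (h c \<otimes>\<^bsub>S\<^esub> u) [^]\<^bsub>S\<^esub> i"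
        using assms S.nat_pow_distrib[of "h c" u i] by (simp add: hom_pow)
      moreover have "u [^]\<^bsub>S\<^esub> i \<otimes>\<^bsub>S\<^esub> (h (c [^] i) \<otimes>\<^bsub>S\<^esub> h (c [^] (Suc M - i)))
          = (h (c [^] i) \<otimes>\<^bsub>S\<^esub> u [^]\<^bsub>S\<^esub> i) \<otimes>\<^bsub>S\<^esub> h (c [^] (Suc M - i))"
        by (rule comm3) (use assms in simp_all)
      ultimately have "u [^]\<^bsub>S\<^esub> i \<otimes>\<^bsub>S\<^esub> h (c [^] Suc M)
          = (h c \<otimes>\<^bsub>S\<^esub> u) [^]\<^bsub>S\<^esub> i \<otimes>\<^bsub>S\<^esub> h (c [^] (Suc M - i))" by simp
      also have "\<dots> = h (s [^] i \<otimes> c [^] (Suc M - i))"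
        using assms by (simp add: hom_pow)
      finally show ?thesis using assms by (metis R.m_closed R.nat_pow_closed imageI)
    next
      case False
      then obtain j where i: "i = j + Suc (Suc M)" by (metis add.commute le_Suc_ex not_less_eq_eq)
      let ?c = "h (c [^] Suc M)"
      have "j + Suc M < i" "j < i" using i by auto
      then obtain x y where xy: "x \<in> carrier R" "y \<in> carrier R"
        "u [^]\<^bsub>S\<^esub> (j + Suc M) \<otimes>\<^bsub>S\<^esub> ?c = h x" "u [^]\<^bsub>S\<^esub> j \<otimes>\<^bsub>S\<^esub> ?c = h y"
        using less by (meson imageE)
      have cc: "?c \<in> carrier S" using assms by simp
      have "u [^]\<^bsub>S\<^esub> i \<otimes>\<^bsub>S\<^esub> ?c = u [^]\<^bsub>S\<^esub> j \<otimes>\<^bsub>S\<^esub> (u [^]\<^bsub>S\<^esub> Suc (Suc M)) \<otimes>\<^bsub>S\<^esub> ?c"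
        unfolding i S.nat_pow_mult[OF u(1)] ..
      also have "\<dots> = h b \<otimes>\<^bsub>S\<^esub> ((u [^]\<^bsub>S\<^esub> j \<otimes>\<^bsub>S\<^esub> u [^]\<^bsub>S\<^esub> Suc M) \<otimes>\<^bsub>S\<^esub> ?c \<oplus>\<^bsub>S\<^esub> h d \<otimes>\<^bsub>S\<^esub> (u [^]\<^bsub>S\<^esub> j \<otimes>\<^bsub>S\<^esub> ?c))"
        unfolding u_pow using b d cc by (simp add: S.r_distr S.l_distr S.m_ac del: S.nat_pow_Suc)
      also have "\<dots> = h (b \<otimes> (x \<oplus> d \<otimes> y))"
        unfolding S.nat_pow_mult[OF u(1)] xy(3,4) using xy(1,2) b d by simp
      finally show ?thesis using xy b d by blast
    qed
  qed
  then show ?thesis using assms unfolding T_def by simp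
qed

text \<open>As \<open>eps = d + u u^M\<close>, it acts on \<open>T\<close> like \<open>d\<close>
  modulo \<open>u T\<close>, and \<open>d\<close> will lie outside the prime \<open>P\<close> at
  which lengths are measured.\<close>

lemma T_eps_pow_mod_u:
  assumes "t \<in> T"
  shows "\<exists>t'\<in>T. eps [^]\<^bsub>S\<^esub> (n::nat) \<otimes>\<^bsub>S\<^esub> t = h (d [^] n) \<otimes>\<^bsub>S\<^esub> t \<oplus>\<^bsub>S\<^esub> u \<otimes>\<^bsub>S\<^esub> t'"
proof (induction n)
  case 0
  show ?case by (rule bexI[OF _ T_zero]) (use T_closed[OF assms] in simp)
next
  case (Suc n)
  then obtain t' where t': "t' \<in> T"
    "eps [^]\<^bsub>S\<^esub> n \<otimes>\<^bsub>S\<^esub> t = h (d [^] n) \<otimes>\<^bsub>S\<^esub> t \<oplus>\<^bsub>S\<^esub> u \<otimes>\<^bsub>S\<^esub> t'" by blast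
  let ?dt = "h (d [^] n) \<otimes>\<^bsub>S\<^esub> t"
  define t'' where "t'' = u [^]\<^bsub>S\<^esub> M \<otimes>\<^bsub>S\<^esub> ?dt \<oplus>\<^bsub>S\<^esub> eps \<otimes>\<^bsub>S\<^esub> t'"
  have dt: "?dt \<in> T" using T_scale[OF assms] d by simp
  note c = T_closed[OF assms] T_closed[OF t'(1)] T_closed[OF dt] d
  have "eps [^]\<^bsub>S\<^esub> Suc n \<otimes>\<^bsub>S\<^esub> t = eps \<otimes>\<^bsub>S\<^esub> (?dt \<oplus>\<^bsub>S\<^esub> u \<otimes>\<^bsub>S\<^esub> t')"
    unfolding t'(2)[symmetric] using c by (simp add: S.m_ac)
  also have "\<dots> = (u [^]\<^bsub>S\<^esub> Suc M \<oplus>\<^bsub>S\<^esub> h d) \<otimes>\<^bsub>S\<^esub> ?dt \<oplus>\<^bsub>S\<^esub> u \<otimes>\<^bsub>S\<^esub> (eps \<otimes>\<^bsub>S\<^esub> t')"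
    using c unfolding eps_def[symmetric] by (simp add: S.r_distr S.m_lcomm)
  also have "\<dots> = h (d [^] Suc n) \<otimes>\<^bsub>S\<^esub> t \<oplus>\<^bsub>S\<^esub> u \<otimes>\<^bsub>S\<^esub> t''"
    using c unfolding t''_def by (simp add: S.l_distr S.r_distr S.m_ac S.a_ac)
  finally show ?case using T_add[OF T_u_pow[OF dt] T_eps[OF t'(1)]] unfolding t''_def by blast
qed

definition I where
  "I n i = {x \<in> carrier R. \<exists>t\<in>T. \<exists>y\<in>carrier R.
     h x = u [^]\<^bsub>S\<^esub> (i::nat) \<otimes>\<^bsub>S\<^esub> t \<oplus>\<^bsub>S\<^esub> h (b [^] (n::nat)) \<otimes>\<^bsub>S\<^esub> h y}"

lemma I_I: "\<lbrakk>x \<in> carrier R; t \<in> T; y \<in> carrier R;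
    h x = u [^]\<^bsub>S\<^esub> i \<otimes>\<^bsub>S\<^esub> t \<oplus>\<^bsub>S\<^esub> h (b [^] n) \<otimes>\<^bsub>S\<^esub> h y\<rbrakk> \<Longrightarrow> x \<in> I n i"
  unfolding I_def by blast

lemma ideal_I: "ideal (I n i) R"
proof (rule R.idealI_cring)
  show "I n i \<subseteq> carrier R" by (auto simp: I_def)
  show "\<zero> \<in> I n i" by (rule I_I[OF _ T_zero, of _ \<zero>]) (use b in simp_all)
  fix x x' assume "x \<in> I n i"
  then obtain t y where 1: "x \<in> carrier R" "t \<in> T" "y \<in> carrier R"
    "h x = u [^]\<^bsub>S\<^esub> i \<otimes>\<^bsub>S\<^esub> t \<oplus>\<^bsub>S\<^esub> h (b [^] n) \<otimes>\<^bsub>S\<^esub> h y" unfolding I_def by blast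
  have B: "h (b [^] n) \<in> carrier S" using b by simp
  { assume "x' \<in> I n i"
    then obtain t' y' where 2: "x' \<in> carrier R" "t' \<in> T" "y' \<in> carrier R"
      "h x' = u [^]\<^bsub>S\<^esub> i \<otimes>\<^bsub>S\<^esub> t' \<oplus>\<^bsub>S\<^esub> h (b [^] n) \<otimes>\<^bsub>S\<^esub> h y'" unfolding I_def by blast
    show "x \<oplus> x' \<in> I n i"
      by (rule I_I[OF _ T_add[OF 1(2) 2(2)] R.a_closed[OF 1(3) 2(3)]])
        (use 1 2 B T_closed[OF 1(2)] T_closed[OF 2(2)] in \<open>simp_all add: S.r_distr S.a_ac\<close>) }
  { assume x': "x' \<in> carrier R"
    show "x' \<otimes> x \<in> I n i"
      by (rule I_I[OF _ T_scale[OF 1(2) x'] R.m_closed[OF x' 1(3)]])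
        (use 1 x' B T_closed[OF 1(2)] in \<open>simp_all add: S.r_distr S.m_ac\<close>) }
qed

lemma I_Suc: "I n (Suc i) \<subseteq> I n i"
proof
  fix x assume "x \<in> I n (Suc i)"
  then obtain t y where 1: "x \<in> carrier R" "t \<in> T" "y \<in> carrier R"
    "h x = u [^]\<^bsub>S\<^esub> Suc i \<otimes>\<^bsub>S\<^esub> t \<oplus>\<^bsub>S\<^esub> h (b [^] n) \<otimes>\<^bsub>S\<^esub> h y" unfolding I_def by blast
  show "x \<in> I n i"
    by (rule I_I[OF 1(1) T_u[OF 1(2)] 1(3)]) (use 1 T_closed[OF 1(2)] b in \<open>simp add: S.m_assoc\<close>)
qed

lemma I_above: "R.adjoin (a_kernel R S h) (b [^] n) \<subseteq> I n i"
proof (rule R.adjoin_minimal[OF ideal_I])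
  show "a_kernel R S h \<subseteq> I n i"
  proof
    fix x assume "x \<in> a_kernel R S h"
    then have "x \<in> carrier R" "h x = \<zero>\<^bsub>S\<^esub>" unfolding a_kernel_def' by blast+
    then show "x \<in> I n i"
      by (intro I_I[of x "\<zero>\<^bsub>S\<^esub>" \<zero> i n] T_zero) (simp_all add: b)
  qed
  show "b [^] n \<in> I n i"
    by (intro I_I[of "b [^] n" "\<zero>\<^bsub>S\<^esub>" \<one> i n] T_zero) (simp_all add: b)
qed

text \<open>If the step at \<open>i\<close> collapsed at \<open>P\<close>, then for some
  \<open>y \<notin> P\<close> the element \<open>y d^m\<close> would map \<open>T\<close> into
  \<open>u T\<close>. Iteration gives \<open>w \<notin> P\<close> mapping \<open>T\<close> into
  \<open>b T\<close>; as \<open>R\<close> is Noetherian and \<open>T\<close> is nonzero, a power of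
  \<open>w\<close> is then a multiple of \<open>b\<close> modulo the kernel, hence in
  \<open>P\<close>.\<close>

lemma not_local_subset_I:
  assumes N: "noetherian_ring R" and P: "primeideal P R" "a_kernel R S h \<subseteq> P" "b \<in> P" "d \<notin> P"
    and x0: "x0 \<in> J" "h x0 \<noteq> \<zero>\<^bsub>S\<^esub>"
    and k: "R.colon J (b [^] (k + m)) = R.colon J (b [^] k)" and i: "i < Suc (Suc M) * m"
  shows "\<not> R.local_subset P (I (k + m) i) (I (k + m) (Suc i))"
proof
  let ?n = "k + m"
  note Pi = primeideal.axioms(1)[OF P(1)]
  assume "R.local_subset P (I ?n i) (I ?n (Suc i))"
  then obtain y where y: "y \<in> carrier R" "y \<notin> P" "\<And>x. x \<in> I ?n i \<Longrightarrow> y \<otimes> x \<in> I ?n (Suc i)"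
    unfolding R.local_subset_def by blast
  have step: "\<exists>t'\<in>T. h (y \<otimes> d [^] m) \<otimes>\<^bsub>S\<^esub> t = u \<otimes>\<^bsub>S\<^esub> t'" if t: "t \<in> T" for t
  proof -
    note tc = T_closed[OF t]
    obtain z where z: "z \<in> J" "h z = u [^]\<^bsub>S\<^esub> i \<otimes>\<^bsub>S\<^esub> t" using T_image[OF T_u_pow[OF t]] by blast
    have "z \<in> I ?n i"
      by (rule I_I[OF _ t R.zero_closed]) (use z tc b in \<open>auto simp: J_def\<close>)
    then have "y \<otimes> z \<in> I ?n (Suc i)" by (rule y(3))
    then obtain t1 y1 where 1: "t1 \<in> T" "y1 \<in> carrier R"
      "h (y \<otimes> z) = u [^]\<^bsub>S\<^esub> Suc i \<otimes>\<^bsub>S\<^esub> t1 \<oplus>\<^bsub>S\<^esub> h (b [^] ?n) \<otimes>\<^bsub>S\<^esub> h y1" unfolding I_def by blast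
    note t1c = T_closed[OF 1(1)]
    have bc: "h (b [^] ?n) \<in> carrier S" "h (b [^] k) \<in> carrier S" "h b \<in> carrier S" using b by auto
    have zc: "z \<in> carrier R" using z(1) by (simp add: J_def)
    have "h (b [^] ?n \<otimes> y1) = h y \<otimes>\<^bsub>S\<^esub> h z \<ominus>\<^bsub>S\<^esub> u [^]\<^bsub>S\<^esub> Suc i \<otimes>\<^bsub>S\<^esub> t1"
    proof -
      have eq: "h y \<otimes>\<^bsub>S\<^esub> h z = u [^]\<^bsub>S\<^esub> Suc i \<otimes>\<^bsub>S\<^esub> t1 \<oplus>\<^bsub>S\<^esub> h (b [^] ?n \<otimes> y1)"
        using 1 y(1) zc b by simp
      have c: "h (b [^] ?n \<otimes> y1) \<in> carrier S" "u [^]\<^bsub>S\<^esub> Suc i \<otimes>\<^bsub>S\<^esub> t1 \<in> carrier S"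
        using 1(2) b t1c by simp_all
      show ?thesis unfolding eq using c by algebra
    qed
    also have "\<dots> \<in> T"
      using T_minus[OF T_scale[of "h z" y] T_u_pow[OF 1(1), of "Suc i"]] z(1) y(1) by (simp add: J_def)
    \<comment> \<open>An elementary substitute for the Artin-Rees lemma: stability of the colon
      ideals lowers the exponent from \<open>k + m\<close> to \<open>k\<close>, so that
      \<open>b^m\<close> is left over as a factor.\<close>
    finally have "y1 \<in> R.colon J (b [^] ?n)" using 1(2) b by (simp add: R.colon_def J_def)
    then have "y1 \<in> R.colon J (b [^] k)" unfolding k .
    then have bk: "h (b [^] k) \<otimes>\<^bsub>S\<^esub> h y1 \<in> T" using 1(2) b by (simp add: R.colon_def J_def)
    \<comment> \<open>By the integral equation, \<open>b^m eps^m\<close> is the power of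
      \<open>u\<close> with exponent \<open>(M + 2) m > i\<close>. After multiplication by
      \<open>eps^m\<close>, the term with the leftover \<open>b^m\<close> is therefore divisible by
      \<open>u^(i+1)\<close> too.\<close>
    obtain j where j: "Suc (Suc M) * m = i + Suc j" using i less_imp_Suc_add[OF i] by auto
    have be: "h (b [^] m) \<otimes>\<^bsub>S\<^esub> eps [^]\<^bsub>S\<^esub> m = u [^]\<^bsub>S\<^esub> i \<otimes>\<^bsub>S\<^esub> (u \<otimes>\<^bsub>S\<^esub> u [^]\<^bsub>S\<^esub> j)"
    proof -
      have "h (b [^] m) \<otimes>\<^bsub>S\<^esub> eps [^]\<^bsub>S\<^esub> m = (h b \<otimes>\<^bsub>S\<^esub> eps) [^]\<^bsub>S\<^esub> m"
        using b by (simp add: S.nat_pow_distrib hom_pow)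
      also have "\<dots> = u [^]\<^bsub>S\<^esub> (Suc (Suc M) * m)"
        unfolding u_pow_eps[symmetric] by (rule S.nat_pow_pow) simp
      finally show ?thesis unfolding j using S.nat_pow_mult[of u i "Suc j"] S.m_comm[of u] by simp
    qed
    obtain t2 where t2: "t2 \<in> T"
      "eps [^]\<^bsub>S\<^esub> m \<otimes>\<^bsub>S\<^esub> t = h (d [^] m) \<otimes>\<^bsub>S\<^esub> t \<oplus>\<^bsub>S\<^esub> u \<otimes>\<^bsub>S\<^esub> t2" using T_eps_pow_mod_u[OF t] by blast
    note t2c = T_closed[OF t2(1)]
    define t3 where "t3 = eps [^]\<^bsub>S\<^esub> m \<otimes>\<^bsub>S\<^esub> t1 \<oplus>\<^bsub>S\<^esub> u [^]\<^bsub>S\<^esub> j \<otimes>\<^bsub>S\<^esub> (h (b [^] k) \<otimes>\<^bsub>S\<^esub> h y1)"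
    have t3: "t3 \<in> T" unfolding t3_def by (intro T_add T_eps_pow T_u_pow 1 bk)
    note t3c = T_closed[OF t3]
    have hy: "h y \<in> carrier S" "h y1 \<in> carrier S" "h (d [^] m) \<in> carrier S" using y 1 d by auto
    have bn: "h (b [^] ?n) = h (b [^] m) \<otimes>\<^bsub>S\<^esub> h (b [^] k)"
      using b R.nat_pow_mult[of b m k] by (simp add: add.commute flip: hom_mult)
    have "u [^]\<^bsub>S\<^esub> i \<otimes>\<^bsub>S\<^esub> (h y \<otimes>\<^bsub>S\<^esub> (eps [^]\<^bsub>S\<^esub> m \<otimes>\<^bsub>S\<^esub> t)) = eps [^]\<^bsub>S\<^esub> m \<otimes>\<^bsub>S\<^esub> h (y \<otimes> z)"
      using y z(2) zc tc by (simp add: S.m_ac)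
    also have "\<dots> = eps [^]\<^bsub>S\<^esub> m \<otimes>\<^bsub>S\<^esub> (u [^]\<^bsub>S\<^esub> Suc i \<otimes>\<^bsub>S\<^esub> t1)
        \<oplus>\<^bsub>S\<^esub> (h (b [^] m) \<otimes>\<^bsub>S\<^esub> eps [^]\<^bsub>S\<^esub> m) \<otimes>\<^bsub>S\<^esub> (h (b [^] k) \<otimes>\<^bsub>S\<^esub> h y1)"
      unfolding 1(3) bn using b t1c hy by (simp add: S.r_distr S.m_ac)
    also have "\<dots> = u [^]\<^bsub>S\<^esub> i \<otimes>\<^bsub>S\<^esub> (u \<otimes>\<^bsub>S\<^esub> t3)"
      unfolding be t3_def using bc t1c hy by (simp add: S.r_distr S.m_ac)
    finally have "h y \<otimes>\<^bsub>S\<^esub> (eps [^]\<^bsub>S\<^esub> m \<otimes>\<^bsub>S\<^esub> t) = u \<otimes>\<^bsub>S\<^esub> t3"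
      using S.m_lcancel[of "u [^]\<^bsub>S\<^esub> i"] hy tc t3c u u_pow_nonzero by simp
    then have "h y \<otimes>\<^bsub>S\<^esub> (h (d [^] m) \<otimes>\<^bsub>S\<^esub> t \<oplus>\<^bsub>S\<^esub> u \<otimes>\<^bsub>S\<^esub> t2) = u \<otimes>\<^bsub>S\<^esub> t3"
      unfolding t2(2) .
    moreover have "h y \<otimes>\<^bsub>S\<^esub> (h (d [^] m) \<otimes>\<^bsub>S\<^esub> t)
        = h y \<otimes>\<^bsub>S\<^esub> (h (d [^] m) \<otimes>\<^bsub>S\<^esub> t \<oplus>\<^bsub>S\<^esub> u \<otimes>\<^bsub>S\<^esub> t2) \<ominus>\<^bsub>S\<^esub> u \<otimes>\<^bsub>S\<^esub> (h y \<otimes>\<^bsub>S\<^esub> t2)"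
      using hy tc t2c u(1) by algebra
    moreover have "u \<otimes>\<^bsub>S\<^esub> t3 \<ominus>\<^bsub>S\<^esub> u \<otimes>\<^bsub>S\<^esub> (h y \<otimes>\<^bsub>S\<^esub> t2) = u \<otimes>\<^bsub>S\<^esub> (t3 \<ominus>\<^bsub>S\<^esub> h y \<otimes>\<^bsub>S\<^esub> t2)"
      using hy t2c t3c u(1) by algebra
    ultimately have "h y \<otimes>\<^bsub>S\<^esub> (h (d [^] m) \<otimes>\<^bsub>S\<^esub> t) = u \<otimes>\<^bsub>S\<^esub> (t3 \<ominus>\<^bsub>S\<^esub> h y \<otimes>\<^bsub>S\<^esub> t2)"
      by (simp only:)
    then have "h (y \<otimes> d [^] m) \<otimes>\<^bsub>S\<^esub> t = u \<otimes>\<^bsub>S\<^esub> (t3 \<ominus>\<^bsub>S\<^esub> h y \<otimes>\<^bsub>S\<^esub> t2)"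
      using y d tc by (simp add: S.m_assoc)
    then show ?thesis using T_minus[OF t3 T_scale[OF t2(1) y(1)]] by blast
  qed
  \<comment> \<open>The exponent \<open>M + 2\<close> is that of the integral equation, since
    \<open>u^(M+2) T = b eps T\<close> lies in \<open>b T\<close>.\<close>
  define w where "w = (y \<otimes> d [^] m) [^] Suc (Suc M)"
  have w0: "y \<otimes> d [^] m \<in> carrier R" using y d by simp
  have wc: "w \<in> carrier R" unfolding w_def using w0 by (rule R.nat_pow_closed)
  have wP: "w \<notin> P"
    using R.primeideal_power[OF P(1) w0] primeideal.I_prime[OF P(1) y(1), of "d [^] m"]
      R.primeideal_power[OF P(1) d] y(2) P(4) d unfolding w_def by (meson R.nat_pow_closed)
  have "\<exists>t'\<in>T. h ((y \<otimes> d [^] m) [^] n) \<otimes>\<^bsub>S\<^esub> t = u [^]\<^bsub>S\<^esub> n \<otimes>\<^bsub>S\<^esub> t'" if t: "t \<in> T" for t and n :: nat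
  proof (induction n)
    case 0
    show ?case using t by (intro bexI[of _ t]) simp_all
  next
    case (Suc n)
    then obtain t' where t': "t' \<in> T" "h ((y \<otimes> d [^] m) [^] n) \<otimes>\<^bsub>S\<^esub> t = u [^]\<^bsub>S\<^esub> n \<otimes>\<^bsub>S\<^esub> t'" by blast
    obtain t'' where t'': "t'' \<in> T" "h (y \<otimes> d [^] m) \<otimes>\<^bsub>S\<^esub> t' = u \<otimes>\<^bsub>S\<^esub> t''" using step[OF t'(1)] by blast
    note c = T_closed[OF t] T_closed[OF t'(1)] T_closed[OF t''(1)] hom_closed[OF w0]
    have "h ((y \<otimes> d [^] m) [^] Suc n) \<otimes>\<^bsub>S\<^esub> t
        = h (y \<otimes> d [^] m) \<otimes>\<^bsub>S\<^esub> (h ((y \<otimes> d [^] m) [^] n) \<otimes>\<^bsub>S\<^esub> t)"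
      using c w0 by (simp del: hom_mult add: hom_mult[OF R.nat_pow_closed[OF w0] w0] S.m_ac)
    also have "\<dots> = u [^]\<^bsub>S\<^esub> n \<otimes>\<^bsub>S\<^esub> (h (y \<otimes> d [^] m) \<otimes>\<^bsub>S\<^esub> t')"
      unfolding t'(2) using c by (rule_tac S.m_lcomm) simp_all
    also have "\<dots> = u [^]\<^bsub>S\<^esub> Suc n \<otimes>\<^bsub>S\<^esub> t''" unfolding t''(2) using c by (simp add: S.m_assoc)
    finally show ?case using t''(1) by blast
  qed
  from this[of _ "Suc (Suc M)"] have wT: "\<exists>t'\<in>T. h w \<otimes>\<^bsub>S\<^esub> t = h b \<otimes>\<^bsub>S\<^esub> t'" if "t \<in> T" for t
    using that T_eps T_closed b unfolding w_def u_pow_eps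
    by (metis S.m_assoc eps_closed hom_closed)
  then have "\<exists>x'\<in>J. h w \<otimes>\<^bsub>S\<^esub> h x = h b \<otimes>\<^bsub>S\<^esub> h x'" if "x \<in> J" for x
    using that T_image unfolding J_def by (metis (no_types, lifting) mem_Collect_eq)
  then obtain f where f: "\<And>x. x \<in> J \<Longrightarrow> f x \<in> J \<and> h w \<otimes>\<^bsub>S\<^esub> h x = h b \<otimes>\<^bsub>S\<^esub> h (f x)" by metis
  \<comment> \<open>Repeated division of \<open>w x\<close> by \<open>b\<close> inside
    \<open>J\<close> gives \<open>b^n e n = w^n x0\<close> after applying \<open>h\<close>. A
    dependence of some \<open>e n\<close> on its predecessors takes the place of the determinant
    trick: multiplied by \<open>b^n\<close>, it turns \<open>w^n x0\<close> into a multiple of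
    \<open>b x0\<close>.\<close>
  define e where "e n = (f ^^ n) x0" for n
  have e: "e n \<in> J" for n by (induction n) (use x0 f in \<open>auto simp: e_def\<close>)
  have ec: "e n \<in> carrier R" for n using e by (simp add: J_def)
  have x0c: "x0 \<in> carrier R" using x0 by (simp add: J_def)
  have e2: "h (b [^] n) \<otimes>\<^bsub>S\<^esub> h (e n) = h (w [^] n) \<otimes>\<^bsub>S\<^esub> h x0" for n
  proof (induction n)
    case (Suc n)
    have "h (b [^] Suc n) \<otimes>\<^bsub>S\<^esub> h (e (Suc n)) = h (b [^] n) \<otimes>\<^bsub>S\<^esub> (h b \<otimes>\<^bsub>S\<^esub> h (e (Suc n)))"
      using b ec by (simp add: S.m_assoc)
    also have "\<dots> = h (b [^] n) \<otimes>\<^bsub>S\<^esub> (h w \<otimes>\<^bsub>S\<^esub> h (e n))" using f[OF e[of n]] by (simp add: e_def)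
    also have "\<dots> = h w \<otimes>\<^bsub>S\<^esub> (h (b [^] n) \<otimes>\<^bsub>S\<^esub> h (e n))" using b ec wc by (simp add: S.m_lcomm)
    also have "\<dots> = h (w [^] Suc n) \<otimes>\<^bsub>S\<^esub> h x0" unfolding Suc using wc x0c by (simp add: S.m_ac)
    finally show ?case .
  qed (use x0c in \<open>simp add: e_def\<close>)
  obtain n where n: "e n \<in> R.seq_ideal e n" by (rule R.noetherian_seq[OF N ec])
  have "\<exists>y\<in>carrier R. h (b [^] n) \<otimes>\<^bsub>S\<^esub> h z = h b \<otimes>\<^bsub>S\<^esub> (h y \<otimes>\<^bsub>S\<^esub> h x0)"
    if "z \<in> R.seq_ideal e n" for z n
    using that
  proof (induction n arbitrary: z)
    case 0
    then show ?case using b x0c by (intro bexI[of _ \<zero>]) simp_all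
  next
    case (Suc n)
    then obtain z' y where z: "z' \<in> R.seq_ideal e n" "y \<in> carrier R" "z = z' \<oplus> e n \<otimes> y"
      by (auto elim: R.adjoinE)
    obtain y' where y': "y' \<in> carrier R" "h (b [^] n) \<otimes>\<^bsub>S\<^esub> h z' = h b \<otimes>\<^bsub>S\<^esub> (h y' \<otimes>\<^bsub>S\<^esub> h x0)"
      using Suc.IH[OF z(1)] by blast
    have zc: "z' \<in> carrier R" using R.ideal_carr[OF R.ideal_seq_ideal[OF ec] z(1)] .
    have "h (b [^] Suc n) \<otimes>\<^bsub>S\<^esub> h z
        = h b \<otimes>\<^bsub>S\<^esub> (h (b [^] n) \<otimes>\<^bsub>S\<^esub> h z' \<oplus>\<^bsub>S\<^esub> h y \<otimes>\<^bsub>S\<^esub> (h (b [^] n) \<otimes>\<^bsub>S\<^esub> h (e n)))"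
      using z b zc ec by (simp add: S.r_distr S.m_ac)
    also have "\<dots> = h b \<otimes>\<^bsub>S\<^esub> (h (b \<otimes> y' \<oplus> y \<otimes> w [^] n) \<otimes>\<^bsub>S\<^esub> h x0)"
      unfolding y'(2) e2 using z b y'(1) wc x0c by (simp add: S.r_distr S.l_distr S.m_ac)
    finally show ?case using z(2) y'(1) wc b by blast
  qed
  from this[OF n] obtain z where z: "z \<in> carrier R"
    "h (w [^] n) \<otimes>\<^bsub>S\<^esub> h x0 = h b \<otimes>\<^bsub>S\<^esub> (h z \<otimes>\<^bsub>S\<^esub> h x0)" unfolding e2 by blast
  then have "h (w [^] n) = h (b \<otimes> z)"
    using S.m_rcancel[of "h x0" "h (w [^] n)" "h (b \<otimes> z)"] x0 x0c wc b by (simp add: S.m_assoc)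
  then have "h (w [^] n \<ominus> b \<otimes> z) = \<zero>\<^bsub>S\<^esub>"
    using wc b z(1) by (simp add: a_minus_def S.r_neg)
  moreover have "w [^] n \<ominus> b \<otimes> z \<in> carrier R" using wc b z(1) by simp
  ultimately have "w [^] n \<ominus> b \<otimes> z \<in> a_kernel R S h" unfolding a_kernel_def' by blast
  then have "w [^] n \<ominus> b \<otimes> z \<in> P" by (rule subsetD[OF P(2)])
  then have "(w [^] n \<ominus> b \<otimes> z) \<oplus> b \<otimes> z \<in> P"
    by (rule R.ideal_add[OF Pi _ R.ideal_rmult[OF Pi P(3) z(1)]])
  moreover have "(w [^] n \<ominus> b \<otimes> z) \<oplus> b \<otimes> z = w [^] n"
    using R.nat_pow_closed[OF wc, of n] b z(1) by algebra
  ultimately have "w [^] n \<in> P" by (simp only:)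
  then show False using R.primeideal_power[OF P(1) wc] wP by blast
qed

end

section \<open>Choice of the exponent by counting lengths\<close>

context ring_hom_cring
begin

lemma primeideal_kernel:
  assumes "domain S" shows "primeideal (a_kernel R S h) R"
proof (rule primeidealI[OF ring.kernel_is_ideal R.is_cring])
  interpret S: domain S by fact
  have "\<one> \<notin> a_kernel R S h" unfolding a_kernel_def' using S.one_not_zero by simp
  then show "carrier R \<noteq> a_kernel R S h" using R.one_closed by blast
  fix x y assume "x \<in> carrier R" "y \<in> carrier R" "x \<otimes> y \<in> a_kernel R S h"
  then show "x \<in> a_kernel R S h \<or> y \<in> a_kernel R S h"
    unfolding a_kernel_def' by (simp add: S.integral_iff)
qed

text \<open>The elements \<open>s\<close> and \<open>c\<close> express that \<open>v\<close> is a
  fraction over the image of \<open>R\<close>, so no fraction field has to be constructed. At a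
  minimal prime over \<open>b\<close> a zero \<open>v\<close> would produce a chain with
  \<open>N m\<close> strict steps above \<open>b^(k+m)\<close>, where the length is at most
  \<open>(k + m) l\<close>.\<close>

lemma exists_exponent:
  assumes N: "noetherian_ring R" and S: "domain S" and b: "b \<in> carrier R"
    and nu: "R.adjoin (a_kernel R S h) b \<noteq> carrier R"
  shows "\<exists>N::nat. \<forall>v\<in>carrier S. \<forall>s\<in>carrier R. \<forall>c\<in>carrier R. h s \<noteq> \<zero>\<^bsub>S\<^esub> \<longrightarrow> h s \<otimes>\<^bsub>S\<^esub> v = h c \<longrightarrow>
    h b \<otimes>\<^bsub>S\<^esub> (v \<oplus>\<^bsub>S\<^esub> h (\<one> \<ominus> b) \<otimes>\<^bsub>S\<^esub> v [^]\<^bsub>S\<^esub> N) \<noteq> \<one>\<^bsub>S\<^esub>"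
proof (cases "h b = \<zero>\<^bsub>S\<^esub>")
  case True
  interpret S: domain S by fact
  show ?thesis using True b S.one_not_zero by (intro exI[of _ 0]) simp
next
  case False
  interpret S: domain S by fact
  let ?q = "a_kernel R S h"
  define d where "d = \<one> \<ominus> b"
  have d: "d \<in> carrier R" unfolding d_def using b by simp
  note q = primeideal_kernel[OF S]
  have bq: "b \<notin> ?q" using False unfolding a_kernel_def' by simp
  note qb = R.ideal_adjoin[OF ring.kernel_is_ideal b]
  obtain P where P: "primeideal P R" "R.adjoin ?q b \<subseteq> P"
    "\<And>Q. \<lbrakk>primeideal Q R; R.adjoin ?q b \<subseteq> Q; Q \<subseteq> P\<rbrakk> \<Longrightarrow> Q = P"
    by (rule R.exists_minimal_prime_over[OF N qb nu]) (rule that)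
  note Pi = primeideal.axioms(1)[OF P(1)]
  have qP: "?q \<subseteq> P" using R.subset_adjoin[OF ring.kernel_is_ideal b] P(2) by (rule subset_trans)
  have bP: "b \<in> P" using R.mem_adjoin[OF ring.kernel_is_ideal b] P(2) by (rule rev_subsetD)
  have dP: "d \<notin> P"
  proof
    assume "d \<in> P"
    then have "d \<oplus> b \<in> P" using bP by (rule R.ideal_add[OF Pi])
    moreover have "d \<oplus> b = \<one>" unfolding d_def using b by algebra
    ultimately show False using R.primeideal_one_notin[OF P(1)] by simp
  qed
  obtain l where l: "R.length_le P (carrier R) (R.adjoin ?q b) l"
    using R.finite_local_length[OF N qb P(1,3)] by (rule exE)
  have "h b \<otimes>\<^bsub>S\<^esub> (v \<oplus>\<^bsub>S\<^esub> h d \<otimes>\<^bsub>S\<^esub> v [^]\<^bsub>S\<^esub> Suc (Suc l)) \<noteq> \<one>\<^bsub>S\<^esub>"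
    if v: "v \<in> carrier S" and sc: "s \<in> carrier R" "c \<in> carrier R" "h s \<noteq> \<zero>\<^bsub>S\<^esub>" "h s \<otimes>\<^bsub>S\<^esub> v = h c"
    for v s c
  proof
    assume eq: "h b \<otimes>\<^bsub>S\<^esub> (v \<oplus>\<^bsub>S\<^esub> h d \<otimes>\<^bsub>S\<^esub> v [^]\<^bsub>S\<^esub> Suc (Suc l)) = \<one>\<^bsub>S\<^esub>"
    \<comment> \<open>This is the inverse of \<open>v\<close>, written as a polynomial in
      \<open>v\<close> because \<open>S\<close> is only a domain.\<close>
    define u where "u = h b \<otimes>\<^bsub>S\<^esub> (\<one>\<^bsub>S\<^esub> \<oplus>\<^bsub>S\<^esub> h d \<otimes>\<^bsub>S\<^esub> v [^]\<^bsub>S\<^esub> Suc l)"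
    have hc: "h b \<in> carrier S" "h d \<in> carrier S" "v [^]\<^bsub>S\<^esub> Suc l \<in> carrier S" using b d v by auto
    have u: "u \<in> carrier S" unfolding u_def using hc by simp
    have "v \<otimes>\<^bsub>S\<^esub> u = h b \<otimes>\<^bsub>S\<^esub> (v \<oplus>\<^bsub>S\<^esub> h d \<otimes>\<^bsub>S\<^esub> v [^]\<^bsub>S\<^esub> Suc (Suc l))"
      unfolding u_def using hc v by (simp add: S.r_distr S.m_ac)
    then have uv: "v \<otimes>\<^bsub>S\<^esub> u = \<one>\<^bsub>S\<^esub>" unfolding eq .
    have u0: "u \<noteq> \<zero>\<^bsub>S\<^esub>" using uv v by auto
    have v0: "v \<noteq> \<zero>\<^bsub>S\<^esub>" using uv u by auto
    have "u [^]\<^bsub>S\<^esub> Suc l \<otimes>\<^bsub>S\<^esub> v [^]\<^bsub>S\<^esub> Suc l = \<one>\<^bsub>S\<^esub>"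
      using S.nat_pow_distrib[OF v u, of "Suc l"] unfolding uv S.nat_pow_one
      using S.m_comm u v by (metis S.nat_pow_closed)
    then have "u [^]\<^bsub>S\<^esub> Suc l \<otimes>\<^bsub>S\<^esub> u = h b \<otimes>\<^bsub>S\<^esub> (u [^]\<^bsub>S\<^esub> Suc l \<oplus>\<^bsub>S\<^esub> h d)"
    proof -
      assume 1: "u [^]\<^bsub>S\<^esub> Suc l \<otimes>\<^bsub>S\<^esub> v [^]\<^bsub>S\<^esub> Suc l = \<one>\<^bsub>S\<^esub>"
      have ul: "u [^]\<^bsub>S\<^esub> Suc l \<in> carrier S" using u by (rule S.nat_pow_closed)
      have "u [^]\<^bsub>S\<^esub> Suc l \<otimes>\<^bsub>S\<^esub> u
          = h b \<otimes>\<^bsub>S\<^esub> (u [^]\<^bsub>S\<^esub> Suc l \<oplus>\<^bsub>S\<^esub> h d \<otimes>\<^bsub>S\<^esub> (u [^]\<^bsub>S\<^esub> Suc l \<otimes>\<^bsub>S\<^esub> v [^]\<^bsub>S\<^esub> Suc l))"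
        by (subst (2) u_def) (use hc ul in \<open>simp add: S.r_distr S.m_ac del: S.nat_pow_Suc\<close>)
      then show ?thesis unfolding 1 using hc by simp
    qed
    then have "u [^]\<^bsub>S\<^esub> Suc (Suc l) = h b \<otimes>\<^bsub>S\<^esub> (u [^]\<^bsub>S\<^esub> Suc l \<oplus>\<^bsub>S\<^esub> h d)"
      by (simp only: S.nat_pow_Suc)
    then interpret C: conductor R S h b d u l
      using b d u u0 by unfold_locales
    have cu: "h c \<otimes>\<^bsub>S\<^esub> u = h s"
      unfolding sc(4)[symmetric] using uv u v sc(1) by (simp add: S.m_assoc)
    have "h c \<noteq> \<zero>\<^bsub>S\<^esub>" using cu sc u by auto
    then have hcp: "h (c [^] Suc l) \<noteq> \<zero>\<^bsub>S\<^esub>"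
      using S.integral sc(2) by (induction l) (auto simp: S.integral_iff)
    have x0: "c [^] Suc l \<in> C.J"
      using C.T_nonzero[OF sc(1,2) cu] R.nat_pow_closed[OF sc(2)] unfolding C.J_def by blast
    have bn: "b [^] n \<in> carrier R" for n :: nat using b by simp
    have mono: "R.colon C.J (b [^] n) \<subseteq> R.colon C.J (b [^] Suc n)" for n :: nat
    proof
      fix x assume x: "x \<in> R.colon C.J (b [^] n)"
      then have xc: "x \<in> carrier R" "b [^] n \<otimes> x \<in> C.J" unfolding R.colon_def by blast+
      have "b [^] Suc n \<otimes> x = b \<otimes> (b [^] n \<otimes> x)" using b xc by (simp add: R.m_ac)
      then show "x \<in> R.colon C.J (b [^] Suc n)"
        unfolding R.colon_def using xc R.ideal_lmult[OF C.ideal_J xc(2) b] by simp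
    qed
    have "\<exists>k::nat. \<forall>n\<ge>k. R.colon C.J (b [^] n) = R.colon C.J (b [^] k)"
      by (rule R.noetherian_chain[OF N, of "\<lambda>n::nat. R.colon C.J (b [^] n)"])
        (rule R.ideal_colon[OF C.ideal_J bn], rule mono)
    then obtain k :: nat where k: "\<forall>n\<ge>k. R.colon C.J (b [^] n) = R.colon C.J (b [^] k)" by (rule exE)
    \<comment> \<open>The count below reads \<open>(l + 2) m \<le> (k + m) l\<close>, that is,
      \<open>2 m \<le> k l\<close>. The exponent \<open>l + 2\<close> exceeds \<open>l\<close>, so
      the left side outgrows the right one, and this \<open>m\<close> is large enough.\<close>
    define m where "m = k * l + 1"
    have k': "R.colon C.J (b [^] (k + m)) = R.colon C.J (b [^] k)" using k by (meson le_add1)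
    have ch: "R.ideal_chain (carrier R) (R.adjoin ?q (b [^] (k + m))) (C.I (k + m))"
      unfolding R.ideal_chain_def
      using C.ideal_I C.I_Suc C.I_above R.ideal_carr[OF C.ideal_I] by (meson subsetI)
    have "card {..<Suc (Suc l) * m} \<le> (k + m) * l"
    proof (rule R.length_leD[OF R.length_le_power[OF P(1) q b bq l] ch])
      fix i assume "i \<in> {..<Suc (Suc l) * m}"
      then show "\<not> R.local_subset P (C.I (k + m) i) (C.I (k + m) (Suc i))"
        by (intro C.not_local_subset_I[OF N P(1) qP bP dP x0 hcp k']) simp
    qed simp
    then have "2 * m \<le> k * l" by (simp add: algebra_simps)
    then show False unfolding m_def by simp
  qed
  then show ?thesis unfolding d_def[symmetric] by (intro exI[of _ "Suc (Suc l)"]) blast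
qed

end

section \<open>Positive-existential predicates\<close>

context cring
begin

text \<open>Only values on points matter for positive-existential sets. Identities are thus checked
  pointwise, and formal polynomials enter only through the three constructors of
  \<open>indexed_pset\<close>.\<close>

definition polyfun :: "nat \<Rightarrow> ('a list \<Rightarrow> 'a) \<Rightarrow> bool" where
  "polyfun m f \<longleftrightarrow> (\<exists>F\<in>indexed_pset {..<m} (carrier R). \<forall>p\<in>points R m. poly_value R F p = f p)"

lemma points_nth: "\<lbrakk>p \<in> points R m; i < m\<rbrakk> \<Longrightarrow> p ! i \<in> carrier R"
  by (auto simp: points_def)

lemma indexed_pset_support:
  assumes "F \<in> indexed_pset {..<m} (carrier R)"
  shows "finite {k. F k \<noteq> \<zero>}" and "F k \<noteq> \<zero> \<Longrightarrow> set_mset k \<subseteq> {..<m}" and "F k \<in> carrier R"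
proof -
  from assms show "finite {k. F k \<noteq> \<zero>}"
  proof induction
    case (indexed_const c)
    have "{k. indexed_const c k \<noteq> \<zero>} \<subseteq> {{#}}" by (auto simp: indexed_const_def)
    then show ?case by (rule finite_subset) simp
  next
    case (indexed_padd P Q)
    have "{k. indexed_padd P Q k \<noteq> \<zero>} \<subseteq> {k. P k \<noteq> \<zero>} \<union> {k. Q k \<noteq> \<zero>}"
      by (auto simp: indexed_padd_def)
    then show ?case by (rule finite_subset) (use indexed_padd.IH in simp)
  next
    case (indexed_pmult P i)
    have "{k. indexed_pmult P i k \<noteq> \<zero>} \<subseteq> add_mset i ` {k. P k \<noteq> \<zero>}"
      by (auto simp: indexed_pmult_def image_iff split: if_splits dest: multi_member_split)
    then show ?case by (rule finite_subset) (use indexed_pmult.IH in simp)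
  qed
  from assms show "F k \<noteq> \<zero> \<Longrightarrow> set_mset k \<subseteq> {..<m}"
  proof (induction arbitrary: k)
    case (indexed_padd P Q)
    then show ?case by (metis r_zero zero_closed indexed_padd_def)
  next
    case (indexed_pmult P i)
    then have "i \<in># k" "P (k - {#i#}) \<noteq> \<zero>" by (auto simp: indexed_pmult_def split: if_splits)
    then show ?case
      using indexed_pmult.IH[of "k - {#i#}"] indexed_pmult.hyps(2)
      by (metis insert_DiffM insert_subset set_mset_add_mset_insert)
  qed (auto simp: indexed_const_def split: if_splits)
  show "F k \<in> carrier R"
    using indexed_pset_in_carrier[OF subset_refl assms] by (rule carrier_coeffE)
qed

lemma monomial_value_eq:
  assumes "p \<in> points R m" "set_mset k \<subseteq> {..<m}"
  shows "monomial_value R k p = (\<Otimes>i\<in>{..<m}. (p ! i) [^] count k i)"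
  unfolding monomial_value_def
  by (rule finprod_mono_neutral_cong_left)
    (use assms points_nth[OF assms(1)] in \<open>auto simp: not_in_iff\<close>)

lemma monomial_value_closed:
  assumes "p \<in> points R m" "set_mset k \<subseteq> {..<m}"
  shows "monomial_value R k p \<in> carrier R"
  unfolding monomial_value_eq[OF assms] using points_nth[OF assms(1)] by (intro finprod_closed) auto

lemma monomial_value_add_mset:
  assumes "p \<in> points R m" "set_mset k \<subseteq> {..<m}" "i < m"
  shows "monomial_value R (add_mset i k) p = monomial_value R k p \<otimes> p ! i"
proof -
  note c = points_nth[OF assms(1)]
  have "monomial_value R (add_mset i k) p
      = (\<Otimes>j\<in>{..<m}. (p ! j) [^] count k j \<otimes> (if i = j then p ! j else \<one>))"
    unfolding monomial_value_eq[OF assms(1), of "add_mset i k", simplified, OF conjI, OF assms(3,2)]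
    by (rule finprod_cong') (use c in auto)
  also have "\<dots> = (\<Otimes>j\<in>{..<m}. (p ! j) [^] count k j) \<otimes> (\<Otimes>j\<in>{..<m}. if i = j then p ! j else \<one>)"
    by (rule finprod_multf) (use c in auto)
  also have "(\<Otimes>j\<in>{..<m}. if i = j then p ! j else \<one>) = p ! i"
    by (rule finprod_singleton) (use c assms(3) in auto)
  finally show ?thesis unfolding monomial_value_eq[OF assms(1,2)] .
qed

text \<open>With a common finite index set the values of several polynomials can be added term by
  term, although their supports differ.\<close>

lemma poly_value_superset:
  assumes F: "F \<in> indexed_pset {..<m} (carrier R)" and p: "p \<in> points R m"
    and M: "finite M" "{k. F k \<noteq> \<zero>} \<subseteq> M" "\<And>k. k \<in> M \<Longrightarrow> set_mset k \<subseteq> {..<m}"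
  shows "poly_value R F p = (\<Oplus>k\<in>M. F k \<otimes> monomial_value R k p)"
  unfolding poly_value_def
  by (rule add.finprod_mono_neutral_cong_left)
    (use M monomial_value_closed[OF p M(3)] indexed_pset_support(3)[OF F] in auto)

lemma poly_value_const:
  assumes "c \<in> carrier R" "p \<in> points R m"
  shows "poly_value R (indexed_const c) p = c"
proof -
  have F: "indexed_const c \<in> indexed_pset {..<m} (carrier R)"
    using assms(1) by (rule indexed_pset.indexed_const)
  have "poly_value R (indexed_const c) p = (\<Oplus>k\<in>{{#}}. indexed_const c k \<otimes> monomial_value R k p)"
    by (rule poly_value_superset[OF F assms(2)]) (auto simp: indexed_const_def)
  then show ?thesis using assms(1) by (simp add: indexed_const_def monomial_value_def)
qed

lemma poly_value_padd:
  assumes F: "F \<in> indexed_pset {..<m} (carrier R)" and G: "G \<in> indexed_pset {..<m} (carrier R)"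
    and p: "p \<in> points R m"
  shows "poly_value R (indexed_padd F G) p = poly_value R F p \<oplus> poly_value R G p"
proof -
  note FG = indexed_pset.indexed_padd[OF F G]
  define M where "M = {k. F k \<noteq> \<zero>} \<union> {k. G k \<noteq> \<zero>}"
  have M: "finite M" "\<And>k. k \<in> M \<Longrightarrow> set_mset k \<subseteq> {..<m}"
    unfolding M_def using indexed_pset_support(1,2)[OF F] indexed_pset_support(1,2)[OF G] by auto
  note c = indexed_pset_support(3)[OF F] indexed_pset_support(3)[OF G] monomial_value_closed[OF p M(2)]
  have "poly_value R (indexed_padd F G) p = (\<Oplus>k\<in>M. indexed_padd F G k \<otimes> monomial_value R k p)"
    by (rule poly_value_superset[OF FG p M(1) _ M(2)]) (auto simp: M_def indexed_padd_def)
  also have "\<dots> = (\<Oplus>k\<in>M. F k \<otimes> monomial_value R k p \<oplus> G k \<otimes> monomial_value R k p)"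
    by (rule add.finprod_cong') (use c in \<open>auto simp: indexed_padd_def l_distr\<close>)
  also have "\<dots> = (\<Oplus>k\<in>M. F k \<otimes> monomial_value R k p) \<oplus> (\<Oplus>k\<in>M. G k \<otimes> monomial_value R k p)"
    by (rule add.finprod_multf) (use c in auto)
  also have "(\<Oplus>k\<in>M. F k \<otimes> monomial_value R k p) = poly_value R F p"
    by (rule poly_value_superset[OF F p M(1) _ M(2), symmetric]) (auto simp: M_def)
  also have "(\<Oplus>k\<in>M. G k \<otimes> monomial_value R k p) = poly_value R G p"
    by (rule poly_value_superset[OF G p M(1) _ M(2), symmetric]) (auto simp: M_def)
  finally show ?thesis .
qed

lemma poly_value_closed:
  assumes F: "F \<in> indexed_pset {..<m} (carrier R)" and p: "p \<in> points R m"
  shows "poly_value R F p \<in> carrier R"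
  unfolding poly_value_def
  using indexed_pset_support(3)[OF F] monomial_value_closed[OF p indexed_pset_support(2)[OF F]]
  by (intro finsum_closed) auto

lemma poly_value_pmult:
  assumes F: "F \<in> indexed_pset {..<m} (carrier R)" and i: "i < m" and p: "p \<in> points R m"
  shows "poly_value R (indexed_pmult F i) p = poly_value R F p \<otimes> p ! i"
proof -
  note Fi = indexed_pset.indexed_pmult[OF F, of i, simplified, OF i]
  define M where "M = {k. F k \<noteq> \<zero>}"
  have M: "finite M" "\<And>k. k \<in> M \<Longrightarrow> set_mset k \<subseteq> {..<m}"
    unfolding M_def using indexed_pset_support(1,2)[OF F] by auto
  note c = indexed_pset_support(3)[OF F] monomial_value_closed[OF p M(2)] points_nth[OF p i]
  have "poly_value R (indexed_pmult F i) p
      = (\<Oplus>k\<in>add_mset i ` M. indexed_pmult F i k \<otimes> monomial_value R k p)"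
  proof (rule poly_value_superset[OF Fi p])
    show "{k. indexed_pmult F i k \<noteq> \<zero>} \<subseteq> add_mset i ` M"
      by (auto simp: M_def indexed_pmult_def image_iff split: if_splits dest: multi_member_split)
  qed (use M(1) in simp, use M(2) i in fastforce)
  also have "\<dots> = (\<Oplus>k\<in>M. indexed_pmult F i (add_mset i k) \<otimes> monomial_value R (add_mset i k) p)"
    by (rule add.finprod_reindex)
      (use c M monomial_value_add_mset[OF p M(2) i] in \<open>auto simp: indexed_pmult_def inj_on_def\<close>)
  also have "\<dots> = (\<Oplus>k\<in>M. (F k \<otimes> monomial_value R k p) \<otimes> p ! i)"
    by (rule add.finprod_cong')
      (use c monomial_value_add_mset[OF p M(2) i] in \<open>auto simp: indexed_pmult_def m_assoc\<close>)
  also have "\<dots> = (\<Oplus>k\<in>M. F k \<otimes> monomial_value R k p) \<otimes> p ! i"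
    by (rule finsum_ldistr[symmetric]) (use c M in auto)
  finally show ?thesis unfolding M_def poly_value_def .
qed

section \<open>Closure properties of polynomial functions\<close>

lemma polyfun_closed: "\<lbrakk>polyfun m f; p \<in> points R m\<rbrakk> \<Longrightarrow> f p \<in> carrier R"
  unfolding polyfun_def using poly_value_closed by metis

lemma polyfun_cong: "\<lbrakk>polyfun m f; \<And>p. p \<in> points R m \<Longrightarrow> f p = g p\<rbrakk> \<Longrightarrow> polyfun m g"
  unfolding polyfun_def by metis

lemma polyfun_const: "c \<in> carrier R \<Longrightarrow> polyfun m (\<lambda>p. c)"
  unfolding polyfun_def using poly_value_const indexed_pset.indexed_const by meson

lemma polyfun_add: "\<lbrakk>polyfun m f; polyfun m g\<rbrakk> \<Longrightarrow> polyfun m (\<lambda>p. f p \<oplus> g p)"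
  unfolding polyfun_def
proof (elim bexE)
  fix F G assume FG: "F \<in> indexed_pset {..<m} (carrier R)" "G \<in> indexed_pset {..<m} (carrier R)"
    and "\<forall>p\<in>points R m. poly_value R F p = f p" "\<forall>p\<in>points R m. poly_value R G p = g p"
  then have "\<forall>p\<in>points R m. poly_value R (indexed_padd F G) p = f p \<oplus> g p"
    by (simp add: poly_value_padd)
  then show "\<exists>F\<in>indexed_pset {..<m} (carrier R). \<forall>p\<in>points R m. poly_value R F p = f p \<oplus> g p"
    using indexed_pset.indexed_padd[OF FG] by (rule rev_bexI[rotated])
qed

lemma polyfun_mult_var: "\<lbrakk>polyfun m f; i < m\<rbrakk> \<Longrightarrow> polyfun m (\<lambda>p. f p \<otimes> p ! i)"
  unfolding polyfun_def
proof (elim bexE)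
  fix F assume F: "F \<in> indexed_pset {..<m} (carrier R)" "i < m"
    and "\<forall>p\<in>points R m. poly_value R F p = f p"
  then have "\<forall>p\<in>points R m. poly_value R (indexed_pmult F i) p = f p \<otimes> p ! i"
    by (simp add: poly_value_pmult)
  then show "\<exists>F\<in>indexed_pset {..<m} (carrier R). \<forall>p\<in>points R m. poly_value R F p = f p \<otimes> p ! i"
    using indexed_pset.indexed_pmult[OF F(1), of i] F(2) by (intro rev_bexI) auto
qed

text \<open>The case \<open>cong\<close> is unavoidable: a polynomial determines its function only
  on points, while the other cases produce specific functions on all lists.\<close>

lemma polyfun_induct [consumes 1, case_names const add mult_var cong]:
  assumes "polyfun m f"
    and const: "\<And>c. c \<in> carrier R \<Longrightarrow> P (\<lambda>p. c)"
    and add: "\<And>f g. \<lbrakk>polyfun m f; polyfun m g; P f; P g\<rbrakk> \<Longrightarrow> P (\<lambda>p. f p \<oplus> g p)"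
    and mult: "\<And>f i. \<lbrakk>polyfun m f; i < m; P f\<rbrakk> \<Longrightarrow> P (\<lambda>p. f p \<otimes> p ! i)"
    and cong: "\<And>f g. \<lbrakk>P f; \<And>p. p \<in> points R m \<Longrightarrow> f p = g p\<rbrakk> \<Longrightarrow> P g"
  shows "P f"
proof -
  have pf: "polyfun m (poly_value R F)" if "F \<in> indexed_pset {..<m} (carrier R)" for F
    using that unfolding polyfun_def by blast
  obtain F where F: "F \<in> indexed_pset {..<m} (carrier R)" "\<forall>p\<in>points R m. poly_value R F p = f p"
    using assms(1) unfolding polyfun_def by blast
  from F(1) have "P (poly_value R F)"
  proof induction
    case (indexed_const c)
    show ?case by (rule cong[OF const[OF indexed_const]]) (simp add: poly_value_const[OF indexed_const])
  next
    case (indexed_padd F G)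
    show ?case
      by (rule cong[OF add[OF pf pf]]) (use indexed_padd poly_value_padd in auto)
  next
    case (indexed_pmult F i)
    show ?case
      by (rule cong[OF mult[OF pf]]) (use indexed_pmult poly_value_pmult in auto)
  qed
  then show ?thesis by (rule cong) (use F(2) in blast)
qed

lemma polyfun_var: "i < m \<Longrightarrow> polyfun m (\<lambda>p. p ! i)"
  by (rule polyfun_cong[OF polyfun_mult_var[OF polyfun_const[OF one_closed]]], assumption,
      rule l_one, erule points_nth)

lemma polyfun_mult:
  assumes "polyfun m f" "polyfun m g"
  shows "polyfun m (\<lambda>p. f p \<otimes> g p)"
  using assms(2)
proof (induction rule: polyfun_induct)
  case (const c)
  from assms(1) show ?case
  proof (induction rule: polyfun_induct)
    case (const c')
    then show ?case using \<open>c \<in> carrier R\<close> by (intro polyfun_const) auto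
  next
    case (add f g)
    then show ?case
      by (intro polyfun_cong[OF polyfun_add[OF add(3,4)]]) (simp add: l_distr polyfun_closed \<open>c \<in> carrier R\<close>)
  next
    case (mult_var f i)
    then show ?case
      by (intro polyfun_cong[OF polyfun_mult_var[OF mult_var(3,2)]])
        (simp add: m_ac polyfun_closed points_nth \<open>c \<in> carrier R\<close>)
  next
    case (cong f g)
    then show ?case by (intro polyfun_cong[OF cong(1)]) simp
  qed
next
  case (add g g')
  then show ?case
    by (intro polyfun_cong[OF polyfun_add[OF add(3,4)]]) (simp add: r_distr polyfun_closed[OF assms(1)] polyfun_closed)
next
  case (mult_var g i)
  then show ?case
    by (intro polyfun_cong[OF polyfun_mult_var[OF mult_var(3,2)]])
      (simp add: m_assoc polyfun_closed[OF assms(1)] polyfun_closed points_nth)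
next
  case (cong g g')
  then show ?case by (intro polyfun_cong[OF cong(1)]) simp
qed

lemma polyfun_minus: "\<lbrakk>polyfun m f; polyfun m g\<rbrakk> \<Longrightarrow> polyfun m (\<lambda>p. f p \<ominus> g p)"
  by (rule polyfun_cong[OF polyfun_add[OF _ polyfun_mult[OF polyfun_const[of "\<ominus> \<one>"]]], of m f g])
    (simp_all add: a_minus_def l_minus polyfun_closed)

lemma polyfun_pow: "polyfun m f \<Longrightarrow> polyfun m (\<lambda>p. f p [^] (n::nat))"
  by (induction n) (simp_all add: polyfun_const polyfun_mult)

lemma polyfun_subst:
  assumes f: "polyfun (length gs) f" and gs: "\<And>g. g \<in> set gs \<Longrightarrow> polyfun m g"
  shows "polyfun m (\<lambda>p. f (map (\<lambda>g. g p) gs))"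
  using f
proof (induction rule: polyfun_induct)
  case (const c)
  then show ?case by (rule polyfun_const)
next
  case (add f g)
  show ?case by (rule polyfun_add[OF add(3,4)])
next
  case (mult_var f i)
  then show ?case
    by (intro polyfun_cong[OF polyfun_mult[OF mult_var(3) gs[OF nth_mem[OF mult_var(2)]]]]) simp
next
  case (cong f g)
  have "map (\<lambda>g. g p) gs \<in> points R (length gs)" if "p \<in> points R m" for p
    using polyfun_closed[OF gs that] by (auto simp: points_def)
  then show ?case by (intro polyfun_cong[OF cong(1)] cong(2))
qed

lemma points_append: "\<lbrakk>t \<in> points R m; x \<in> points R n\<rbrakk> \<Longrightarrow> t @ x \<in> points R (m + n)"
  by (auto simp: points_def)

lemma points_split:
  assumes "p \<in> points R (m + n)"
  obtains t x where "t \<in> points R m" "x \<in> points R n" "p = t @ x"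
proof
  show "take m p \<in> points R m" "drop m p \<in> points R n"
    using assms by (auto simp: points_def dest: in_set_takeD in_set_dropD)
qed simp

text \<open>The first \<open>m\<close> coordinates pass through \<open>gs\<close>, the next
  \<open>k\<close> are skipped and the last \<open>n\<close> are kept. This covers substitution in
  front of existential witnesses (\<open>k = 0\<close>) and, with projections for \<open>gs\<close>,
  the skipping of the witnesses of another condition.\<close>

lemma polyfun_append:
  assumes f: "polyfun (length gs + n) f" and gs: "\<And>g. g \<in> set gs \<Longrightarrow> polyfun m g"
  shows "polyfun (m + k + n) (\<lambda>p. f (map (\<lambda>g. g (take m p)) gs @ drop (m + k) p))"
proof -
  let ?gs = "map (\<lambda>g p. g (map ((!) p) [0..<m])) gs @ map (\<lambda>i p. p ! i) [m + k..<m + k + n]"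
  have 1: "polyfun (m + k + n) g" if "g \<in> set ?gs" for g
  proof -
    from that consider g' where "g' \<in> set gs" "g = (\<lambda>p. g' (map ((!) p) [0..<m]))"
      | i where "i < m + k + n" "g = (\<lambda>p. p ! i)" by auto
    then show ?thesis
    proof cases
      case 1
      have "polyfun (m + k + n) (\<lambda>p. g' (map (\<lambda>g. g p) (map (\<lambda>i p. p ! i) [0..<m])))"
        by (rule polyfun_subst) (use gs[OF 1(1)] in \<open>auto intro: polyfun_var\<close>)
      then show ?thesis unfolding 1(2) by (simp add: comp_def)
    qed (simp add: polyfun_var)
  qed
  have "polyfun (m + k + n) (\<lambda>p. f (map (\<lambda>g. g p) ?gs))"
    by (rule polyfun_subst[OF _ 1]) (use f in simp)
  then show ?thesis
  proof (rule polyfun_cong)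
    fix p assume p: "p \<in> points R (m + k + n)"
    then have l: "length p = m + k + n" by (simp add: points_def)
    have 1: "map ((!) p) [0..<m] = take m p" using l by (intro nth_equalityI) auto
    have 2: "map ((!) p) [m + k..<m + k + n] = drop (m + k) p" using l by (intro nth_equalityI) auto
    show "f (map (\<lambda>g. g p) ?gs) = f (map (\<lambda>g. g (take m p)) gs @ drop (m + k) p)"
      by (simp add: comp_def 1 2)
  qed
qed

text \<open>Predicates instead of sets make a change of variables a composition of functions; \<open>bpe\<close> and \<open>pe\<close> are the
  counterparts of \<^const>\<open>basic_positive_existential\<close> and \<^const>\<open>positive_existential\<close>.\<close>

definition bpe :: "nat \<Rightarrow> ('a list \<Rightarrow> bool) \<Rightarrow> bool" where
  "bpe m Q \<longleftrightarrow> (\<exists>n fs. (\<forall>f\<in>set fs. polyfun (m + n) f) \<and>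
     (\<forall>t\<in>points R m. Q t \<longleftrightarrow> (\<exists>x\<in>points R n. \<forall>f\<in>set fs. f (t @ x) = \<zero>)))"

lemma bpeE:
  assumes "bpe m Q"
  obtains n fs where "\<And>f. f \<in> set fs \<Longrightarrow> polyfun (m + n) f"
    "\<And>t. t \<in> points R m \<Longrightarrow> Q t \<longleftrightarrow> (\<exists>x\<in>points R n. \<forall>f\<in>set fs. f (t @ x) = \<zero>)"
  using assms unfolding bpe_def by blast

lemma bpeI:
  assumes "\<And>f. f \<in> set fs \<Longrightarrow> polyfun (m + n) f"
    "\<And>t. t \<in> points R m \<Longrightarrow> Q t \<longleftrightarrow> (\<exists>x\<in>points R n. \<forall>f\<in>set fs. f (t @ x) = \<zero>)"
  shows "bpe m Q"
  unfolding bpe_def using assms by blast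

lemma points_0 [simp]: "points R 0 = {[]}"
  by (auto simp: points_def)

lemma bpe_cong: "\<lbrakk>bpe m Q; \<And>t. t \<in> points R m \<Longrightarrow> Q t \<longleftrightarrow> Q' t\<rbrakk> \<Longrightarrow> bpe m Q'"
  by (erule bpeE, rule bpeI) auto

lemma bpe_zero: "polyfun m f \<Longrightarrow> bpe m (\<lambda>t. f t = \<zero>)"
  by (rule bpeI[of "[f]" m 0]) auto

lemma polyfun_take_drop:
  assumes "polyfun (m + n) f"
  shows "polyfun (m + k + n) (\<lambda>p. f (take m p @ drop (m + k) p))"
proof -
  have "polyfun (m + k + n) (\<lambda>p. f (map (\<lambda>g. g (take m p)) (map (\<lambda>i p. p ! i) [0..<m]) @ drop (m + k) p))"
    by (rule polyfun_append) (use assms in \<open>auto intro: polyfun_var\<close>)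
  then show ?thesis
  proof (rule polyfun_cong)
    fix p assume "p \<in> points R (m + k + n)"
    then have "map (\<lambda>g. g (take m p)) (map (\<lambda>i p. p ! i) [0..<m]) = take m p"
      by (intro nth_equalityI) (auto simp: points_def)
    then show "f (map (\<lambda>g. g (take m p)) (map (\<lambda>i p. p ! i) [0..<m]) @ drop (m + k) p)
      = f (take m p @ drop (m + k) p)" by simp
  qed
qed

lemma polyfun_take: "polyfun m f \<Longrightarrow> polyfun (m + k) (\<lambda>p. f (take m p))"
  by (rule polyfun_cong[OF polyfun_take_drop[of m 0 f k, simplified]]) (auto simp: points_def)

lemma ex_points_add:
  "(\<exists>z\<in>points R (k + n). P z) \<longleftrightarrow> (\<exists>x\<in>points R k. \<exists>y\<in>points R n. P (x @ y))"
proof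
  assume "\<exists>z\<in>points R (k + n). P z"
  then obtain z where z: "z \<in> points R (k + n)" "P z" by blast
  obtain x y where "x \<in> points R k" "y \<in> points R n" "z = x @ y" by (rule points_split[OF z(1)])
  then show "\<exists>x\<in>points R k. \<exists>y\<in>points R n. P (x @ y)" using z(2) by blast
qed (use points_append in blast)

lemma bpe_conj:
  assumes "bpe m P" "bpe m Q"
  shows "bpe m (\<lambda>t. P t \<and> Q t)"
proof -
  obtain k fs where 1: "\<And>f. f \<in> set fs \<Longrightarrow> polyfun (m + k) f"
    "\<And>t. t \<in> points R m \<Longrightarrow> P t \<longleftrightarrow> (\<exists>x\<in>points R k. \<forall>f\<in>set fs. f (t @ x) = \<zero>)"
    using assms(1) by (rule bpeE) blast
  obtain n gs where 2: "\<And>f. f \<in> set gs \<Longrightarrow> polyfun (m + n) f"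
    "\<And>t. t \<in> points R m \<Longrightarrow> Q t \<longleftrightarrow> (\<exists>x\<in>points R n. \<forall>f\<in>set gs. f (t @ x) = \<zero>)"
    using assms(2) by (rule bpeE) blast
  \<comment> \<open>The witnesses of \<open>P\<close> come first, those of \<open>Q\<close> after
    them.\<close>
  let ?fs = "map (\<lambda>f p. f (take (m + k) p)) fs @ map (\<lambda>g p. g (take m p @ drop (m + k) p)) gs"
  show ?thesis
  proof (rule bpeI[of ?fs m "k + n"])
    show "polyfun (m + (k + n)) f" if "f \<in> set ?fs" for f
      using that polyfun_take[OF 1(1), of _ n] polyfun_take_drop[OF 2(1), of _ k]
      by (auto simp: add.assoc)
    fix t assume t: "t \<in> points R m"
    then have lt: "length t = m" by (simp add: points_def)
    have "(\<forall>f\<in>set ?fs. f (t @ x @ y) = \<zero>) \<longleftrightarrow> (\<forall>f\<in>set fs. f (t @ x) = \<zero>) \<and> (\<forall>g\<in>set gs. g (t @ y) = \<zero>)"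
      if "x \<in> points R k" for x y using lt that by (auto simp: ball_Un points_def)
    then have "(\<exists>z\<in>points R (k + n). \<forall>f\<in>set ?fs. f (t @ z) = \<zero>) \<longleftrightarrow>
      (\<exists>x\<in>points R k. \<exists>y\<in>points R n. (\<forall>f\<in>set fs. f (t @ x) = \<zero>) \<and> (\<forall>g\<in>set gs. g (t @ y) = \<zero>))"
      unfolding ex_points_add by (intro bex_cong) simp_all
    then show "P t \<and> Q t \<longleftrightarrow> (\<exists>x\<in>points R (k + n). \<forall>f\<in>set ?fs. f (t @ x) = \<zero>)"
      using 1(2)[OF t] 2(2)[OF t] by blast
  qed
qed

lemma bpe_ex:
  assumes "bpe (m + k) Q"
  shows "bpe m (\<lambda>t. \<exists>x\<in>points R k. Q (t @ x))"
proof -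
  obtain n fs where 1: "\<And>f. f \<in> set fs \<Longrightarrow> polyfun (m + k + n) f"
    "\<And>t. t \<in> points R (m + k) \<Longrightarrow> Q t \<longleftrightarrow> (\<exists>x\<in>points R n. \<forall>f\<in>set fs. f (t @ x) = \<zero>)"
    using assms by (rule bpeE) blast
  show ?thesis
  proof (rule bpeI[of fs m "k + n"])
    show "polyfun (m + (k + n)) f" if "f \<in> set fs" for f using 1(1)[OF that] by (simp add: add.assoc)
    fix t assume t: "t \<in> points R m"
    show "(\<exists>x\<in>points R k. Q (t @ x)) \<longleftrightarrow> (\<exists>x\<in>points R (k + n). \<forall>f\<in>set fs. f (t @ x) = \<zero>)"
      unfolding ex_points_add using 1(2)[OF points_append[OF t]] by simp
  qed
qed

lemma bpe_subst:
  assumes "bpe (length gs) Q" "\<And>g. g \<in> set gs \<Longrightarrow> polyfun m g"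
  shows "bpe m (\<lambda>t. Q (map (\<lambda>g. g t) gs))"
proof -
  obtain n fs where 1: "\<And>f. f \<in> set fs \<Longrightarrow> polyfun (length gs + n) f"
    "\<And>t. t \<in> points R (length gs) \<Longrightarrow> Q t \<longleftrightarrow> (\<exists>x\<in>points R n. \<forall>f\<in>set fs. f (t @ x) = \<zero>)"
    using assms(1) by (rule bpeE) blast
  let ?fs = "map (\<lambda>f p. f (map (\<lambda>g. g (take m p)) gs @ drop m p)) fs"
  show ?thesis
  proof (rule bpeI[of ?fs m n])
    show "polyfun (m + n) f" if "f \<in> set ?fs" for f
      using that polyfun_append[OF 1(1) assms(2), where k = 0] by auto
    fix t assume t: "t \<in> points R m"
    then have lt: "length t = m" by (simp add: points_def)
    have "map (\<lambda>g. g t) gs \<in> points R (length gs)"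
      using polyfun_closed[OF assms(2) t] by (auto simp: points_def)
    then show "Q (map (\<lambda>g. g t) gs) \<longleftrightarrow> (\<exists>x\<in>points R n. \<forall>f\<in>set ?fs. f (t @ x) = \<zero>)"
      using 1(2) lt by simp
  qed
qed

definition pe :: "nat \<Rightarrow> ('a list \<Rightarrow> bool) \<Rightarrow> bool" where
  "pe m Q \<longleftrightarrow> (\<exists>Qs. (\<forall>B\<in>set Qs. bpe m B) \<and> (\<forall>t\<in>points R m. Q t \<longleftrightarrow> (\<exists>B\<in>set Qs. B t)))"

lemma peE:
  assumes "pe m Q"
  obtains Qs where "\<And>B. B \<in> set Qs \<Longrightarrow> bpe m B" "\<And>t. t \<in> points R m \<Longrightarrow> Q t \<longleftrightarrow> (\<exists>B\<in>set Qs. B t)"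
  using assms unfolding pe_def by blast

lemma peI:
  assumes "\<And>B. B \<in> set Qs \<Longrightarrow> bpe m B" "\<And>t. t \<in> points R m \<Longrightarrow> Q t \<longleftrightarrow> (\<exists>B\<in>set Qs. B t)"
  shows "pe m Q"
  unfolding pe_def using assms by blast

lemma pe_cong: "\<lbrakk>pe m Q; \<And>t. t \<in> points R m \<Longrightarrow> Q t \<longleftrightarrow> Q' t\<rbrakk> \<Longrightarrow> pe m Q'"
  by (erule peE, rule peI) auto

lemma bpe_imp_pe: "bpe m Q \<Longrightarrow> pe m Q"
  by (rule peI[of "[Q]"]) auto

lemma pe_False: "pe m (\<lambda>t. False)"
  by (rule peI[of "[]"]) auto

lemma pe_disj:
  assumes "pe m P" "pe m Q"
  shows "pe m (\<lambda>t. P t \<or> Q t)"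
proof -
  obtain Ps where "\<And>B. B \<in> set Ps \<Longrightarrow> bpe m B" "\<And>t. t \<in> points R m \<Longrightarrow> P t \<longleftrightarrow> (\<exists>B\<in>set Ps. B t)"
    using assms(1) by (rule peE) blast
  moreover obtain Qs where "\<And>B. B \<in> set Qs \<Longrightarrow> bpe m B" "\<And>t. t \<in> points R m \<Longrightarrow> Q t \<longleftrightarrow> (\<exists>B\<in>set Qs. B t)"
    using assms(2) by (rule peE) blast
  ultimately show ?thesis by (intro peI[of "Ps @ Qs"]) auto
qed

lemma pe_conj:
  assumes "pe m P" "pe m Q"
  shows "pe m (\<lambda>t. P t \<and> Q t)"
proof -
  obtain Ps where 1: "\<And>B. B \<in> set Ps \<Longrightarrow> bpe m B" "\<And>t. t \<in> points R m \<Longrightarrow> P t \<longleftrightarrow> (\<exists>B\<in>set Ps. B t)"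
    using assms(1) by (rule peE) blast
  obtain Qs where 2: "\<And>B. B \<in> set Qs \<Longrightarrow> bpe m B" "\<And>t. t \<in> points R m \<Longrightarrow> Q t \<longleftrightarrow> (\<exists>B\<in>set Qs. B t)"
    using assms(2) by (rule peE) blast
  show ?thesis
    by (rule peI[of "map (\<lambda>(B, C) t. B t \<and> C t) (List.product Ps Qs)"])
      (use 1 2 in \<open>auto intro!: bpe_conj\<close>)
qed

lemma pe_ex:
  assumes "pe (m + k) Q"
  shows "pe m (\<lambda>t. \<exists>x\<in>points R k. Q (t @ x))"
proof -
  obtain Qs where 1: "\<And>B. B \<in> set Qs \<Longrightarrow> bpe (m + k) B"
    "\<And>t. t \<in> points R (m + k) \<Longrightarrow> Q t \<longleftrightarrow> (\<exists>B\<in>set Qs. B t)"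
    using assms by (rule peE) blast
  show ?thesis
    by (rule peI[of "map (\<lambda>B t. \<exists>x\<in>points R k. B (t @ x)) Qs"])
      (use 1 points_append in \<open>auto intro!: bpe_ex\<close>)
qed

lemma pe_subst:
  assumes "pe (length gs) Q" "\<And>g. g \<in> set gs \<Longrightarrow> polyfun m g"
  shows "pe m (\<lambda>t. Q (map (\<lambda>g. g t) gs))"
proof -
  obtain Qs where 1: "\<And>B. B \<in> set Qs \<Longrightarrow> bpe (length gs) B"
    "\<And>t. t \<in> points R (length gs) \<Longrightarrow> Q t \<longleftrightarrow> (\<exists>B\<in>set Qs. B t)"
    using assms(1) by (rule peE) blast
  have "map (\<lambda>g. g t) gs \<in> points R (length gs)" if "t \<in> points R m" for t
    using polyfun_closed[OF assms(2) that] by (auto simp: points_def)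
  then show ?thesis
    by (intro peI[of "map (\<lambda>B t. B (map (\<lambda>g. g t) gs)) Qs"])
      (use 1 assms(2) in \<open>auto intro!: bpe_subst\<close>)
qed

section \<open>From predicates back to sets\<close>

lemma bpe_imp_basic_positive_existential:
  assumes "bpe m Q"
  shows "basic_positive_existential R m {t \<in> points R m. Q t}"
proof -
  obtain n fs where 1: "\<And>f. f \<in> set fs \<Longrightarrow> polyfun (m + n) f"
    "\<And>t. t \<in> points R m \<Longrightarrow> Q t \<longleftrightarrow> (\<exists>x\<in>points R n. \<forall>f\<in>set fs. f (t @ x) = \<zero>)"
    using assms by (rule bpeE) blast
  then have "\<forall>f\<in>set fs. \<exists>F\<in>indexed_pset {..<m + n} (carrier R). \<forall>p\<in>points R (m + n). poly_value R F p = f p"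
    unfolding polyfun_def by blast
  then obtain G where G: "\<And>f. f \<in> set fs \<Longrightarrow> G f \<in> indexed_pset {..<m + n} (carrier R)"
    "\<And>f p. \<lbrakk>f \<in> set fs; p \<in> points R (m + n)\<rbrakk> \<Longrightarrow> poly_value R (G f) p = f p" by metis
  have "{t \<in> points R m. Q t} =
    {t \<in> points R m. \<exists>x\<in>points R n. \<forall>F\<in>set (map G fs). poly_value R F (t @ x) = \<zero>}"
    using 1(2) G(2) points_append by auto
  moreover have "set (map G fs) \<subseteq> indexed_pset {..<m + n} (carrier R)" using G(1) by auto
  ultimately show ?thesis unfolding basic_positive_existential_def by blast
qed

lemma pe_imp_positive_existential:
  assumes "pe m Q"
  shows "positive_existential R m {t \<in> points R m. Q t}"
proof -
  obtain Qs where 1: "\<And>B. B \<in> set Qs \<Longrightarrow> bpe m B"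
    "\<And>t. t \<in> points R m \<Longrightarrow> Q t \<longleftrightarrow> (\<exists>B\<in>set Qs. B t)"
    using assms by (rule peE) blast
  show ?thesis unfolding positive_existential_def
    by (rule exI[of _ "(\<lambda>B. {t \<in> points R m. B t}) ` set Qs"])
      (use 1 bpe_imp_basic_positive_existential in auto)
qed

text \<open>Writing the zero ideal here makes the premise an instance of the general statement about
  complements of ideals.\<close>

lemma condition_CI:
  assumes "pe 1 (\<lambda>t. t ! 0 \<notin> {\<zero>})"
  shows "condition_C R"
proof -
  have "(\<lambda>a. [a]) ` (carrier R - {\<zero>}) = {t \<in> points R 1. t ! 0 \<notin> {\<zero>}}"
    by (auto simp: points_def length_Suc_conv image_iff)
  then show ?thesis unfolding condition_C_def using pe_imp_positive_existential[OF assms] by simp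
qed

lemma Idl_insert:
  assumes "insert a G \<subseteq> carrier R"
  shows "Idl (insert a G) = adjoin (Idl G) a"
proof
  note G = genideal_ideal[of G]
  show "Idl (insert a G) \<subseteq> adjoin (Idl G) a"
    using assms subset_adjoin[OF G, of a] mem_adjoin[OF G, of a] genideal_self[of G]
    by (intro genideal_minimal[OF ideal_adjoin[OF G]]) auto
  show "adjoin (Idl G) a \<subseteq> Idl (insert a G)"
    using assms genideal_self[OF assms] subset_Idl_subset[OF assms, of G]
    by (intro adjoin_minimal[OF genideal_ideal[OF assms]]) auto
qed

text \<open>One witness per generator: an element belongs to \<open>J + a R\<close> if and only if
  subtracting some \<open>a y\<close> moves it into \<open>J\<close>.\<close>

lemma bpe_mem_ideal:
  assumes N: "noetherian_ring R" and I: "ideal I R"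
  shows "bpe 1 (\<lambda>t. t ! 0 \<in> I)"
proof -
  obtain G where G: "G \<subseteq> carrier R" "finite G" "I = Idl G"
    using noetherian_ring.finetely_gen[OF N I] by blast
  have "bpe 1 (\<lambda>t. t ! 0 \<in> Idl G)"
    using G(2,1)
  proof (induction G rule: finite_induct)
    case empty
    have "Idl {} = {\<zero>}"
      using genideal_minimal[OF zeroideal, of "{}"] ideal_zero[OF genideal_ideal[of "{}"]] by blast
    then show ?case using bpe_zero[OF polyfun_var[of 0 1]] by simp
  next
    case (insert a G)
    then have a: "a \<in> carrier R" and G: "G \<subseteq> carrier R" by auto
    note J = genideal_ideal[OF G]
    have "bpe (1 + 1) (\<lambda>t. map (\<lambda>g. g t) [\<lambda>t. t ! 0 \<ominus> a \<otimes> t ! 1] ! 0 \<in> Idl G)"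
      by (rule bpe_subst[where Q = "\<lambda>t. t ! 0 \<in> Idl G"])
        (use insert.IH[OF G] a in \<open>auto intro!: polyfun_minus polyfun_mult polyfun_const polyfun_var\<close>)
    then have "bpe 1 (\<lambda>t. \<exists>x\<in>points R 1. (t @ x) ! 0 \<ominus> a \<otimes> (t @ x) ! 1 \<in> Idl G)"
      by (intro bpe_ex) simp
    then show ?case
    proof (rule bpe_cong)
      fix t assume "t \<in> points R 1"
      then obtain b where b: "b \<in> carrier R" "t = [b]" by (auto simp: points_def length_Suc_conv)
      have eq: "(\<exists>x\<in>points R 1. (t @ x) ! 0 \<ominus> a \<otimes> (t @ x) ! 1 \<in> Idl G) \<longleftrightarrow>
        (\<exists>y\<in>carrier R. b \<ominus> a \<otimes> y \<in> Idl G)"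
      proof
        assume "\<exists>y\<in>carrier R. b \<ominus> a \<otimes> y \<in> Idl G"
        then obtain y where "y \<in> carrier R" "b \<ominus> a \<otimes> y \<in> Idl G" by blast
        then show "\<exists>x\<in>points R 1. (t @ x) ! 0 \<ominus> a \<otimes> (t @ x) ! 1 \<in> Idl G"
          using b by (intro bexI[of _ "[y]"]) (auto simp: points_def)
      qed (use b in \<open>auto simp: points_def length_Suc_conv\<close>)
      have "(\<exists>y\<in>carrier R. b \<ominus> a \<otimes> y \<in> Idl G) \<longleftrightarrow> b \<in> adjoin (Idl G) a"
      proof
        assume "\<exists>y\<in>carrier R. b \<ominus> a \<otimes> y \<in> Idl G"
        then obtain y where y: "y \<in> carrier R" "b \<ominus> a \<otimes> y \<in> Idl G" by blast
        then have "(b \<ominus> a \<otimes> y) \<oplus> a \<otimes> y \<in> adjoin (Idl G) a" by (intro adjoinI)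
        moreover have "(b \<ominus> a \<otimes> y) \<oplus> a \<otimes> y = b" using b a y by algebra
        ultimately show "b \<in> adjoin (Idl G) a" by simp
      next
        assume "b \<in> adjoin (Idl G) a"
        then obtain i y where y: "i \<in> Idl G" "y \<in> carrier R" "b = i \<oplus> a \<otimes> y" by (rule adjoinE)
        then have "b \<ominus> a \<otimes> y = i" using a ideal_carr[OF J y(1)] by algebra
        then show "\<exists>y\<in>carrier R. b \<ominus> a \<otimes> y \<in> Idl G" using y by blast
      qed
      then show "(\<exists>x\<in>points R 1. (t @ x) ! 0 \<ominus> a \<otimes> (t @ x) ! 1 \<in> Idl G) \<longleftrightarrow> t ! 0 \<in> Idl (insert a G)"
        using eq b Idl_insert[OF insert.prems] by simp
    qed
  qed
  then show ?thesis using G(3) by simp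
qed

lemma pe_mem_ideal:
  assumes "noetherian_ring R" "ideal I R" "polyfun m f"
  shows "pe m (\<lambda>t. f t \<in> I)"
  using bpe_imp_pe[OF bpe_subst[where gs = "[f]" and Q = "\<lambda>t. t ! 0 \<in> I" and m = m]]
    bpe_mem_ideal[OF assms(1,2)] assms(3) by simp

lemma pe_notin_subst:
  assumes "pe 1 (\<lambda>t. t ! 0 \<notin> I)" "polyfun m f"
  shows "pe m (\<lambda>t. f t \<notin> I)"
  using pe_subst[where gs = "[f]" and Q = "\<lambda>t. t ! 0 \<notin> I" and m = m] assms by simp

end

section \<open>The complement of an ideal\<close>

context cring
begin

text \<open>The Taylor expansion to first order that the Newton step needs.\<close>

lemma pow_minus_cong:
  assumes "v \<in> carrier R" "e \<in> carrier R"
  shows "\<exists>g\<in>carrier R. (v \<ominus> e) [^] (n::nat) = v [^] n \<ominus> e \<otimes> g"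
proof (induction n)
  case 0
  show ?case by (rule bexI[of _ \<zero>]) (use assms in \<open>simp_all add: a_minus_def\<close>)
next
  case (Suc n)
  then obtain g where g: "g \<in> carrier R" "(v \<ominus> e) [^] n = v [^] n \<ominus> e \<otimes> g" by blast
  have vn: "v [^] n \<in> carrier R" using assms by simp
  have "(v \<ominus> e) [^] Suc n = (v [^] n \<ominus> e \<otimes> g) \<otimes> (v \<ominus> e)" using g(2) by simp
  also have "\<dots> = v [^] n \<otimes> v \<ominus> e \<otimes> (v [^] n \<oplus> g \<otimes> (v \<ominus> e))" using g(1) assms vn by algebra
  finally show ?case using g(1) assms vn by (intro bexI[of _ "v [^] n \<oplus> g \<otimes> (v \<ominus> e)"]) simp_all
qed

text \<open>Newton iteration \<open>v \<mapsto> v - f v\<close> converges because \<open>f v\<close> is \<open>v - 1\<close> modulo \<open>c\<close>.\<close>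

lemma solvable_mod_powers:
  fixes N :: nat
  assumes b: "b \<in> carrier R" and c: "c \<in> carrier R" and bc: "b \<oplus> c = \<one>"
  defines "f \<equiv> \<lambda>v. b \<otimes> (v \<oplus> c \<otimes> v [^] N) \<ominus> \<one>"
  shows "\<exists>v\<in>carrier R. \<exists>w\<in>carrier R. f v = c [^] (n::nat) \<otimes> w"
proof (induction n)
  case 0
  show ?case using b c by (intro bexI[of _ \<one>] bexI[of _ "f \<one>"]) (simp_all add: f_def)
next
  case (Suc n)
  then obtain v w where vw: "v \<in> carrier R" "w \<in> carrier R" "f v = c [^] n \<otimes> w" by blast
  define e where "e = f v"
  have e: "e \<in> carrier R" unfolding e_def f_def using vw b c by simp
  obtain g where g: "g \<in> carrier R" "(v \<ominus> e) [^] N = v [^] N \<ominus> e \<otimes> g"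
    using pow_minus_cong[OF vw(1) e] by blast
  have vN: "v [^] N \<in> carrier R" and cn: "c [^] n \<in> carrier R" using vw c by auto
  have c': "c = \<one> \<ominus> b" using bc[symmetric] b c by algebra
  \<comment> \<open>Since \<open>1 - b = c\<close>, the linear part leaves the error
    \<open>e - b e = c e\<close>, and the other term carries \<open>c\<close> from the coefficient
    of \<open>v^N\<close>. Every round gains one factor \<open>c\<close>.\<close>
  have "f (v \<ominus> e) = f v \<ominus> b \<otimes> e \<ominus> c \<otimes> b \<otimes> (e \<otimes> g)"
    unfolding f_def g(2) using vw(1) e g(1) b c vN by algebra
  also have "f v = e" by (simp add: e_def)
  also have "e \<ominus> b \<otimes> e \<ominus> c \<otimes> b \<otimes> (e \<otimes> g) = c \<otimes> (e \<otimes> (\<one> \<ominus> b \<otimes> g))"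
    unfolding c' using e b g(1) by algebra
  also have "\<dots> = c [^] Suc n \<otimes> (w \<otimes> (\<one> \<ominus> b \<otimes> g))"
    unfolding e_def vw(3) using vw(2) b c g(1) by (simp add: m_ac)
  finally show ?case using vw e b g(1)
    by (intro bexI[of _ "v \<ominus> e"] bexI[of _ "w \<otimes> (\<one> \<ominus> b \<otimes> g)"]) simp_all
qed

text \<open>Krull's intersection theorem for the ideal generated by \<open>c\<close> in the domain \<open>R / p\<close>.\<close>

lemma exists_power_factor:
  assumes N: "noetherian_ring R" and p: "primeideal p R" and c: "c \<in> carrier R"
    and nu: "\<one> \<notin> adjoin p c" and x: "x \<in> carrier R" "x \<notin> p"
  shows "\<exists>(n::nat). \<exists>y\<in>carrier R. x \<ominus> c [^] n \<otimes> y \<in> p \<and> y \<notin> adjoin p c"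
proof (rule ccontr)
  assume neg: "\<not> ?thesis"
  note pi = primeideal.axioms(1)[OF p]
  define f where "f y = (SOME y'. y' \<in> carrier R \<and> y \<ominus> c \<otimes> y' \<in> p)" for y
  have f: "f y \<in> carrier R \<and> y \<ominus> c \<otimes> f y \<in> p" if y: "y \<in> adjoin p c" for y
    unfolding f_def
  proof (rule someI_ex)
    obtain i z where z: "i \<in> p" "z \<in> carrier R" "y = i \<oplus> c \<otimes> z" using y by (rule adjoinE)
    have "y \<ominus> c \<otimes> z = i" unfolding z(3) using z(2) ideal_carr[OF pi z(1)] c by algebra
    then show "\<exists>y'. y' \<in> carrier R \<and> y \<ominus> c \<otimes> y' \<in> p" using z by metis
  qed
  \<comment> \<open>By \<open>neg\<close> each quotient of \<open>x\<close> by a power of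
    \<open>c\<close> lies in \<open>p + c R\<close> again, so the division never stops.\<close>
  define Y where "Y n = (f ^^ n) x" for n
  have Y0: "Y 0 = x" and YS: "Y (Suc n) = f (Y n)" for n by (simp_all add: Y_def)
  have Y: "Y n \<in> carrier R \<and> x \<ominus> c [^] n \<otimes> Y n \<in> p" for n
  proof (induction n)
    case 0
    show ?case using x ideal_zero[OF pi] by (simp add: Y0 a_minus_def r_neg)
  next
    case (Suc n)
    then have "Y n \<in> adjoin p c" using neg by blast
    note g = f[OF this]
    have cn: "c [^] n \<in> carrier R" using c by simp
    have "x \<ominus> c [^] Suc n \<otimes> f (Y n)
        = (x \<ominus> c [^] n \<otimes> Y n) \<oplus> c [^] n \<otimes> (Y n \<ominus> c \<otimes> f (Y n))"
      unfolding nat_pow_Suc using x(1) cn c Suc.IH g by algebra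
    also have "\<dots> \<in> p"
      by (rule ideal_add[OF pi conjunct2[OF Suc.IH] ideal_lmult[OF pi conjunct2[OF g] cn]])
    finally show ?case using g unfolding YS by blast
  qed
  then have Yc: "Y n \<in> carrier R" and Yx: "x \<ominus> c [^] n \<otimes> Y n \<in> p" for n by blast+
  have Ya: "Y n \<ominus> c \<otimes> Y (Suc n) \<in> p" for n
    using f[of "Y n"] neg Yc Yx YS by metis
  have "adjoin p (Y n) \<subseteq> adjoin p (Y (Suc n))" for n
  proof (rule adjoin_minimal[OF ideal_adjoin[OF pi Yc] subset_adjoin[OF pi Yc]])
    have "(Y n \<ominus> c \<otimes> Y (Suc n)) \<oplus> Y (Suc n) \<otimes> c \<in> adjoin p (Y (Suc n))"
      using Ya c by (rule adjoinI)
    moreover have "(Y n \<ominus> c \<otimes> Y (Suc n)) \<oplus> Y (Suc n) \<otimes> c = Y n"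
      using Yc[of n] Yc[of "Suc n"] c by algebra
    ultimately show "Y n \<in> adjoin p (Y (Suc n))" by simp
  qed
  then have "\<exists>n. \<forall>m\<ge>n. adjoin p (Y m) = adjoin p (Y n)"
    by (intro noetherian_chain[OF N, of "\<lambda>n. adjoin p (Y n)"] ideal_adjoin[OF pi Yc])
  then obtain n where "\<forall>m\<ge>n. adjoin p (Y m) = adjoin p (Y n)" by (rule exE)
  then have "adjoin p (Y (Suc n)) = adjoin p (Y n)" using le_SucI[of n n] by blast
  \<comment> \<open>Together with \<open>Y n = c Y (n+1)\<close> modulo \<open>p\<close>,
    stationarity gives \<open>Y (n+1) (1 - c z) \<in> p\<close>. So \<open>x \<in> p\<close> or
    \<open>c\<close> is a unit modulo \<open>p\<close>, and both are excluded.\<close>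
  then have "Y (Suc n) \<in> adjoin p (Y n)" using mem_adjoin[OF pi Yc[of "Suc n"]] by simp
  then obtain i z where z: "i \<in> p" "z \<in> carrier R" "Y (Suc n) = i \<oplus> Y n \<otimes> z" by (rule adjoinE)
  let ?y = "Y (Suc n)"
  have ic: "i \<in> carrier R" using ideal_carr[OF pi z(1)] .
  have "?y \<otimes> (\<one> \<ominus> c \<otimes> z) = ?y \<ominus> c \<otimes> ?y \<otimes> z" using Yc[of "Suc n"] c z(2) by algebra
  also have "\<dots> = (i \<oplus> Y n \<otimes> z) \<ominus> c \<otimes> ?y \<otimes> z" by (subst (1) z(3)) simp
  also have "\<dots> = i \<oplus> (Y n \<ominus> c \<otimes> ?y) \<otimes> z"
    using Yc[of n] Yc[of "Suc n"] c z(2) ic by algebra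
  also have "\<dots> \<in> p" using ideal_add[OF pi z(1) ideal_rmult[OF pi Ya z(2)]] .
  finally have "?y \<in> p \<or> \<one> \<ominus> c \<otimes> z \<in> p"
    using primeideal.I_prime[OF p Yc] c z(2) by simp
  then show False
  proof
    assume "?y \<in> p"
    then have "(x \<ominus> c [^] Suc n \<otimes> ?y) \<oplus> c [^] Suc n \<otimes> ?y \<in> p"
      using ideal_add[OF pi Yx ideal_lmult[OF pi]] c nat_pow_closed by blast
    moreover have "(x \<ominus> c [^] Suc n \<otimes> ?y) \<oplus> c [^] Suc n \<otimes> ?y = x"
      using x(1) nat_pow_closed[OF c, of "Suc n"] Yc[of "Suc n"] by algebra
    ultimately show False using x(2) by simp
  next
    assume "\<one> \<ominus> c \<otimes> z \<in> p"
    then have "(\<one> \<ominus> c \<otimes> z) \<oplus> c \<otimes> z \<in> adjoin p c" using z(2) by (rule adjoinI)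
    moreover have "(\<one> \<ominus> c \<otimes> z) \<oplus> c \<otimes> z = \<one>" using c z(2) by algebra
    ultimately show False using nu by simp
  qed
qed

lemma points_Suc_ex: "(\<exists>l\<in>points R (Suc n). P l) \<longleftrightarrow> (\<exists>x\<in>carrier R. \<exists>l\<in>points R n. P (x # l))"
proof
  assume "\<exists>l\<in>points R (Suc n). P l"
  then obtain l where l: "l \<in> points R (Suc n)" "P l" by blast
  then obtain x l' where "l = x # l'" by (cases l) (auto simp: points_def)
  then show "\<exists>x\<in>carrier R. \<exists>l\<in>points R n. P (x # l)" using l by (auto simp: points_def)
next
  assume "\<exists>x\<in>carrier R. \<exists>l\<in>points R n. P (x # l)"
  then obtain x l where "x \<in> carrier R" "l \<in> points R n" "P (x # l)" by blast
  then show "\<exists>l\<in>points R (Suc n). P l" by (intro bexI[of _ "x # l"]) (auto simp: points_def)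
qed

text \<open>An element of \<open>I + a R\<close> is \<open>a y\<close> modulo \<open>I\<close>, and
  it lies outside \<open>I\<close> exactly when \<open>y\<close> lies outside
  \<open>(I : a)\<close>. Thus only the complements of \<open>I + a R\<close> and
  \<open>(I : a)\<close> are required, besides membership in \<open>I\<close>.\<close>

lemma pe_notin_split:
  assumes N: "noetherian_ring R" and I: "ideal I R" and a: "a \<in> carrier R"
    and 1: "pe 1 (\<lambda>t. t ! 0 \<notin> adjoin I a)" and 2: "pe 1 (\<lambda>t. t ! 0 \<notin> colon I a)"
  shows "pe 1 (\<lambda>t. t ! 0 \<notin> I)"
proof -
  have "pe (1 + 1) (\<lambda>t. t ! 0 \<ominus> a \<otimes> t ! 1 \<in> I \<and> t ! 1 \<notin> colon I a)"
    by (intro pe_conj pe_mem_ideal[OF N I] pe_notin_subst[OF 2] polyfun_minus polyfun_mult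
        polyfun_const polyfun_var a) simp_all
  then have "pe 1 (\<lambda>t. t ! 0 \<notin> adjoin I a \<or>
      (\<exists>x\<in>points R 1. (t @ x) ! 0 \<ominus> a \<otimes> (t @ x) ! 1 \<in> I \<and> (t @ x) ! 1 \<notin> colon I a))"
    by (intro pe_disj[OF 1] pe_ex)
  then show ?thesis
  proof (rule pe_cong)
    fix t assume "t \<in> points R 1"
    then obtain x where x: "x \<in> carrier R" "t = [x]" by (auto simp: points_def length_Suc_conv)
    have "(x \<notin> adjoin I a \<or> (\<exists>y\<in>carrier R. x \<ominus> a \<otimes> y \<in> I \<and> y \<notin> colon I a)) \<longleftrightarrow> x \<notin> I"
    proof (intro iffI notI)
      assume l: "x \<notin> adjoin I a \<or> (\<exists>y\<in>carrier R. x \<ominus> a \<otimes> y \<in> I \<and> y \<notin> colon I a)" and xI: "x \<in> I"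
      then obtain y where y: "y \<in> carrier R" "x \<ominus> a \<otimes> y \<in> I" "y \<notin> colon I a"
        using subset_adjoin[OF I a] by blast
      have "a \<otimes> y = x \<ominus> (x \<ominus> a \<otimes> y)" using x y a by algebra
      then have "a \<otimes> y \<in> I" using ideal_minus[OF I xI y(2)] by simp
      then show False using y unfolding colon_def by simp
    next
      assume xI: "x \<notin> I"
      show "x \<notin> adjoin I a \<or> (\<exists>y\<in>carrier R. x \<ominus> a \<otimes> y \<in> I \<and> y \<notin> colon I a)"
      proof (cases "x \<in> adjoin I a")
        case True
        then obtain i y where y: "i \<in> I" "y \<in> carrier R" "x = i \<oplus> a \<otimes> y" by (rule adjoinE)
        have "x \<ominus> a \<otimes> y = i" unfolding y(3) using y(2) ideal_carr[OF I y(1)] a by algebra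
        moreover have "y \<notin> colon I a"
          using xI y ideal_add[OF I y(1), of "a \<otimes> y"] unfolding colon_def by blast
        ultimately show ?thesis using y by metis
      qed simp
    qed
    then show "(t ! 0 \<notin> adjoin I a \<or>
      (\<exists>x\<in>points R 1. (t @ x) ! 0 \<ominus> a \<otimes> (t @ x) ! 1 \<in> I \<and> (t @ x) ! 1 \<notin> colon I a)) \<longleftrightarrow> t ! 0 \<notin> I"
      using x by (simp add: points_Suc_ex)
  qed
qed

text \<open>Modulo a maximal ideal, being nonzero means having an inverse, and the inverse is a
  witness.\<close>

lemma pe_notin_maximal:
  assumes N: "noetherian_ring R" and M: "maximalideal M R"
  shows "pe 1 (\<lambda>t. t ! 0 \<notin> M)"
proof -
  note I = maximalideal.axioms(1)[OF M]
  have "pe (1 + 1) (\<lambda>t. \<one> \<ominus> t ! 0 \<otimes> t ! 1 \<in> M)"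
    by (intro pe_mem_ideal[OF N I] polyfun_minus polyfun_mult polyfun_const polyfun_var) simp_all
  then have "pe 1 (\<lambda>t. \<exists>x\<in>points R 1. \<one> \<ominus> (t @ x) ! 0 \<otimes> (t @ x) ! 1 \<in> M)" by (rule pe_ex)
  then show ?thesis
  proof (rule pe_cong)
    fix t assume "t \<in> points R 1"
    then obtain x where x: "x \<in> carrier R" "t = [x]" by (auto simp: points_def length_Suc_conv)
    have "(\<exists>y\<in>carrier R. \<one> \<ominus> x \<otimes> y \<in> M) \<longleftrightarrow> x \<notin> M"
    proof (intro iffI notI)
      assume "\<exists>y\<in>carrier R. \<one> \<ominus> x \<otimes> y \<in> M" "x \<in> M"
      then obtain y where y: "y \<in> carrier R" "\<one> \<ominus> x \<otimes> y \<in> M" by blast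
      then have "(\<one> \<ominus> x \<otimes> y) \<oplus> x \<otimes> y \<in> M" using ideal_add[OF I] ideal_rmult[OF I \<open>x \<in> M\<close>] by blast
      moreover have "(\<one> \<ominus> x \<otimes> y) \<oplus> x \<otimes> y = \<one>" using x y by algebra
      ultimately show False using primeideal_one_notin[OF maximalideal_prime[OF M]] by simp
    next
      assume "x \<notin> M"
      then show "\<exists>y\<in>carrier R. \<one> \<ominus> x \<otimes> y \<in> M" using maximalideal_inverse[OF M x(1)] by metis
    qed
    then show "(\<exists>x\<in>points R 1. \<one> \<ominus> (t @ x) ! 0 \<otimes> (t @ x) ! 1 \<in> M) \<longleftrightarrow> t ! 0 \<notin> M"
      using x by (simp add: points_Suc_ex)
  qed
qed

text \<open>Put \<open>f v = b (v + c v\<^sup>n) - 1\<close>. If \<open>z\<close> divides a value of \<open>f\<close>, then \<open>z \<notin> p\<close>; conversely every power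
  \<open>z = c\<^sup>k\<close> divides a value of \<open>f\<close>.\<close>

lemma pe_notin_prime:
  fixes n :: nat
  assumes N: "noetherian_ring R" and p: "primeideal p R"
    and b: "b \<in> carrier R" and c: "c \<in> carrier R" and bc: "b \<oplus> c = \<one>" and nu: "\<one> \<notin> adjoin p c"
    and ns: "\<And>v. v \<in> carrier R \<Longrightarrow> b \<otimes> (v \<oplus> c \<otimes> v [^] n) \<ominus> \<one> \<notin> p"
    and 1: "pe 1 (\<lambda>t. t ! 0 \<notin> adjoin p c)"
  shows "pe 1 (\<lambda>t. t ! 0 \<notin> p)"
proof -
  note I = primeideal.axioms(1)[OF p]
  let ?Q = "\<lambda>x z y w v. x \<ominus> z \<otimes> y \<in> p \<and> z \<otimes> w \<ominus> (b \<otimes> (v \<oplus> c \<otimes> v [^] n) \<ominus> \<one>) \<in> p \<and> y \<notin> adjoin p c"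
  \<comment> \<open>The coordinates are \<open>x\<close> and its four witnesses \<open>z\<close>,
    \<open>y\<close>, \<open>w\<close>, \<open>v\<close>, where \<open>w\<close> is the quotient of
    the value of \<open>f\<close> at \<open>v\<close> by \<open>z\<close>, modulo
    \<open>p\<close>.\<close>
  have "pe (1 + 4) (\<lambda>t. ?Q (t ! 0) (t ! 1) (t ! 2) (t ! 3) (t ! 4))"
    by (intro pe_conj pe_mem_ideal[OF N I] pe_notin_subst[OF 1] polyfun_minus polyfun_mult polyfun_add
        polyfun_pow polyfun_const polyfun_var b c) simp_all
  then have "pe 1 (\<lambda>t. \<exists>x\<in>points R 4.
      ?Q ((t @ x) ! 0) ((t @ x) ! 1) ((t @ x) ! 2) ((t @ x) ! 3) ((t @ x) ! 4))" by (rule pe_ex)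
  then show ?thesis
  proof (rule pe_cong)
    fix t assume "t \<in> points R 1"
    then obtain x where x: "x \<in> carrier R" "t = [x]" by (auto simp: points_def length_Suc_conv)
    have "(\<exists>z\<in>carrier R. \<exists>y\<in>carrier R. \<exists>w\<in>carrier R. \<exists>v\<in>carrier R. ?Q x z y w v) \<longleftrightarrow> x \<notin> p"
    proof (intro iffI notI)
      assume "\<exists>z\<in>carrier R. \<exists>y\<in>carrier R. \<exists>w\<in>carrier R. \<exists>v\<in>carrier R. ?Q x z y w v" and xp: "x \<in> p"
      then obtain z y w v where zyw: "z \<in> carrier R" "y \<in> carrier R" "w \<in> carrier R" "v \<in> carrier R"
        "?Q x z y w v" by blast
      define fv where "fv = b \<otimes> (v \<oplus> c \<otimes> v [^] n) \<ominus> \<one>"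
      have fv: "fv \<in> carrier R" "fv \<notin> p" unfolding fv_def using ns[OF zyw(4)] zyw(4) b c by auto
      have Q: "x \<ominus> z \<otimes> y \<in> p" "z \<otimes> w \<ominus> fv \<in> p" "y \<notin> adjoin p c"
        using zyw(5) unfolding fv_def by blast+
      have "z \<otimes> y = x \<ominus> (x \<ominus> z \<otimes> y)" using x zyw by algebra
      then have "z \<otimes> y \<in> p" using ideal_minus[OF I xp Q(1)] by simp
      moreover have "y \<notin> p" using Q(3) subset_adjoin[OF I c] by blast
      ultimately have zp: "z \<in> p" using primeideal.I_prime[OF p zyw(1,2)] by blast
      have "fv = z \<otimes> w \<ominus> (z \<otimes> w \<ominus> fv)" using zyw fv by algebra
      then show False using ideal_minus[OF I ideal_rmult[OF I zp zyw(3)] Q(2)] fv(2) by simp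
    next
      assume "x \<notin> p"
      then obtain k :: nat and y where y: "y \<in> carrier R" "x \<ominus> c [^] k \<otimes> y \<in> p" "y \<notin> adjoin p c"
        using exists_power_factor[OF N p c nu x(1)] by blast
      obtain v w where vw: "v \<in> carrier R" "w \<in> carrier R" "b \<otimes> (v \<oplus> c \<otimes> v [^] n) \<ominus> \<one> = c [^] k \<otimes> w"
        using solvable_mod_powers[OF b c bc, of n k] by blast
      have "c [^] k \<otimes> w \<ominus> (b \<otimes> (v \<oplus> c \<otimes> v [^] n) \<ominus> \<one>) = \<zero>"
        unfolding vw(3) using vw(2) c by (simp add: a_minus_def r_neg)
      then have "?Q x (c [^] k) y w v" using y ideal_zero[OF I] by simp
      then show "\<exists>z\<in>carrier R. \<exists>y\<in>carrier R. \<exists>w\<in>carrier R. \<exists>v\<in>carrier R. ?Q x z y w v"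
        using y(1) vw(1,2) nat_pow_closed[OF c, of k] by blast
    qed
    then show "(\<exists>x\<in>points R 4.
      ?Q ((t @ x) ! 0) ((t @ x) ! 1) ((t @ x) ! 2) ((t @ x) ! 3) ((t @ x) ! 4)) \<longleftrightarrow> t ! 0 \<notin> p"
      using x by (simp add: points_Suc_ex numeral_eq_Suc)
  qed
qed

end

section \<open>Localizations and quotients of Noetherian Jacobson rings\<close>

lemma (in cring) rcos_zero_iff:
  assumes "ideal I R" "x \<in> carrier R"
  shows "I +> x = \<zero>\<^bsub>R Quot I\<^esub> \<longleftrightarrow> x \<in> I"
  using a_rcos_zero[OF assms(1)] ideal.rcos_const_imp_mem[OF assms] by (auto simp: FactRing_def)

lemma (in cring) Quot_carrierE:
  assumes "x \<in> carrier (R Quot I)"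
  obtains a where "a \<in> carrier R" "x = I +> a"
proof -
  have "x \<in> (\<Union>a\<in>carrier R. {I +> a})" using assms unfolding FactRing_def A_RCOSETS_def' by simp
  then show thesis using that by blast
qed

lemma (in ring_hom_cring) ring_hom_cring_quotient:
  assumes "ideal I S"
  shows "ring_hom_cring R (S Quot I) (\<lambda>a. I +>\<^bsub>S\<^esub> h a)"
proof (rule ring_hom_cring.intro[OF R.is_cring ideal.quotient_is_cring[OF assms S.is_cring] ring_hom_cring_axioms.intro])
  have "(\<lambda>a. I +>\<^bsub>S\<^esub> h a) = (+>\<^bsub>S\<^esub>) I \<circ> h" by auto
  then show "(\<lambda>a. I +>\<^bsub>S\<^esub> h a) \<in> ring_hom R (S Quot I)"
    using ring_hom_trans[OF homh ideal.rcos_ring_hom[OF assms]] by simp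
qed

text \<open>Every element of \<open>S\<close> is a unit multiple of an image, so an ideal of
  \<open>S\<close> is recovered from its preimage in \<open>R\<close>. The hypothesis
  \<open>loc\<close> holds for quotients, with \<open>s = \<one>\<close>, as well as for rings of
  fractions; this lets one theorem serve both.\<close>

lemma (in ring_hom_cring) localization_noetherian:
  assumes N: "noetherian_ring R"
    and loc: "\<And>x. x \<in> carrier S \<Longrightarrow> \<exists>s\<in>carrier R. \<exists>a\<in>carrier R. h s \<in> Units S \<and> h s \<otimes>\<^bsub>S\<^esub> x = h a"
  shows "noetherian_ring S"
proof (rule S.noetherian_ringI_chain)
  fix J :: "nat \<Rightarrow> _ set" assume J: "\<And>n. ideal (J n) S" "\<And>n. J n \<subseteq> J (Suc n)"
  define I where "I n = {x \<in> carrier R. h x \<in> J n}" for n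
  have I: "ideal (I n) R" for n
    unfolding I_def by (rule R.idealI_cring)
      (auto simp: S.ideal_zero[OF J(1)] S.ideal_add[OF J(1)] S.ideal_lmult[OF J(1)])
  have "I n \<subseteq> I (Suc n)" for n unfolding I_def using J(2) by blast
  then have "\<exists>n. \<forall>m\<ge>n. I m = I n" by (intro R.noetherian_chain[OF N, of I] I)
  then obtain n where "\<forall>m\<ge>n. I m = I n" by (rule exE)
  then have n: "I (Suc n) = I n" using le_SucI[of n n] by blast
  have "J (Suc n) \<subseteq> J n"
  proof
    fix x assume x: "x \<in> J (Suc n)"
    have xc: "x \<in> carrier S" using S.ideal_carr[OF J(1) x] .
    obtain s a where sa: "s \<in> carrier R" "a \<in> carrier R" "h s \<in> Units S" "h s \<otimes>\<^bsub>S\<^esub> x = h a"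
      using loc[OF xc] by blast
    have "h a \<in> J (Suc n)" using S.ideal_lmult[OF J(1) x, of "h s"] sa by simp
    then have "h a \<in> J n" using n sa(2) unfolding I_def by blast
    then have "inv\<^bsub>S\<^esub> (h s) \<otimes>\<^bsub>S\<^esub> (h s \<otimes>\<^bsub>S\<^esub> x) \<in> J n" unfolding sa(4) using S.ideal_lmult[OF J(1)] sa(3) by blast
    moreover have "inv\<^bsub>S\<^esub> (h s) \<otimes>\<^bsub>S\<^esub> (h s \<otimes>\<^bsub>S\<^esub> x) = x"
      using sa(1,3) xc by (simp add: S.m_assoc[symmetric])
    ultimately show "x \<in> J n" by simp
  qed
  then show "\<exists>n. J (Suc n) = J n" using J(2) by blast
qed

theorem (in ring_hom_cring) localization_condition_C:
  assumes N: "noetherian_ring R" and Jac: "jacobson_ring R"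
    and loc: "\<And>x. x \<in> carrier S \<Longrightarrow> \<exists>s\<in>carrier R. \<exists>a\<in>carrier R. h s \<in> Units S \<and> h s \<otimes>\<^bsub>S\<^esub> x = h a"
  shows "condition_C S"
proof (rule S.condition_CI)
  have NS: "noetherian_ring S" by (rule localization_noetherian[OF N loc])
  have "S.pe 1 (\<lambda>t. t ! 0 \<notin> I)" if "ideal I S" for I
    using NS that
  proof (induction rule: S.noetherian_prime_induct)
    case carrier
    show ?case by (rule S.pe_cong[OF S.pe_False]) (auto simp: points_def length_Suc_conv)
  next
    case (split I a b)
    show ?case by (rule S.pe_notin_split[OF NS split(1,2) split(7,9)])
  next
    case (prime p)
    note pI = primeideal.axioms(1)[OF prime(1)]
    show ?case
    proof (cases "maximalideal p S")
      case True
      then show ?thesis by (rule S.pe_notin_maximal[OF NS])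
    next
      case False
      then obtain J where J: "ideal J S" "p \<subseteq> J" "J \<noteq> p" "J \<noteq> carrier S"
        using maximalidealI[OF pI primeideal.I_notcarr[OF prime(1)]] by blast
      then obtain x where x: "x \<in> J" "x \<notin> p" by blast
      have xc: "x \<in> carrier S" using S.ideal_carr[OF J(1) x(1)] .
      obtain s a where sa: "s \<in> carrier R" "a \<in> carrier R" "h s \<in> Units S" "h s \<otimes>\<^bsub>S\<^esub> x = h a"
        using loc[OF xc] by blast
      \<comment> \<open>The unit \<open>h s\<close> is cleared because the Jacobson property is
        available only in \<open>R\<close>, so an element of \<open>R\<close> with image in
        \<open>J\<close> but not in \<open>p\<close> is needed.\<close>
      have aJ: "h a \<in> J" using S.ideal_lmult[OF J(1) x(1), of "h s"] sa by simp
      have unit: "h s \<notin> p" if "s \<in> carrier R" "h s \<in> Units S" for s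
      proof
        assume "h s \<in> p"
        then have "h s \<otimes>\<^bsub>S\<^esub> inv\<^bsub>S\<^esub> (h s) \<in> p"
          by (rule S.ideal_rmult[OF pI]) (rule S.Units_inv_closed[OF that(2)])
        then show False unfolding S.Units_r_inv[OF that(2)] using S.primeideal_one_notin[OF prime(1)] by blast
      qed
      have ap: "h a \<notin> p"
        using primeideal.I_prime[OF prime(1), of "h s" x] unit sa xc x(2) by force
      interpret K: ring_hom_cring R "S Quot p" "\<lambda>a. p +>\<^bsub>S\<^esub> h a"
        by (rule ring_hom_cring_quotient[OF pI])
      interpret KD: domain "S Quot p" by (rule primeideal.quotient_is_domain[OF prime(1)])
      note K0 = S.rcos_zero_iff[OF pI]
      let ?q = "a_kernel R (S Quot p) (\<lambda>a. p +>\<^bsub>S\<^esub> h a)"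
      have q: "x \<in> ?q \<longleftrightarrow> x \<in> carrier R \<and> h x \<in> p" for x
        unfolding a_kernel_def' using K0[OF hom_closed, of x] by blast
      have qp: "primeideal ?q R" by (rule K.primeideal_kernel[OF KD.domain_axioms])
      note qI = primeideal.axioms(1)[OF qp]
      obtain MM where "\<forall>M\<in>MM. maximalideal M R" "?q = \<Inter>MM"
        using Jac qp unfolding jacobson_ring_def by blast
      moreover have "a \<notin> ?q" using ap q by blast
      ultimately obtain M where M: "maximalideal M R" "a \<notin> M" "?q \<subseteq> M" by blast
      note MI = maximalideal.axioms(1)[OF M(1)]
      \<comment> \<open>The two nonunits live in different rings: \<open>b = 1 - a y\<close> lies in
        \<open>M\<close>, hence is a nonunit of \<open>R\<close> modulo \<open>?q\<close>, whereas
        \<open>1 - b = a y\<close> is mapped into the proper ideal \<open>J\<close> of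
        \<open>S\<close>.\<close>
      obtain y where y: "y \<in> carrier R" "\<one> \<ominus> a \<otimes> y \<in> M"
        by (rule R.maximalideal_inverse[OF M(1) sa(2) M(2)])
      define b where "b = \<one> \<ominus> a \<otimes> y"
      have b: "b \<in> carrier R" unfolding b_def using sa y by simp
      have t: "\<one> \<ominus> b = a \<otimes> y" unfolding b_def using sa y by algebra
      have one: "\<one> \<notin> M" by (rule R.primeideal_one_notin[OF R.maximalideal_prime[OF M(1)]])
      have "R.adjoin ?q b \<subseteq> M" using R.adjoin_minimal[OF MI M(3)] y(2) unfolding b_def .
      then have nu: "R.adjoin ?q b \<noteq> carrier R" using one R.one_closed by blast
      obtain n :: nat where n: "\<forall>v\<in>carrier (S Quot p). \<forall>s\<in>carrier R. \<forall>c\<in>carrier R.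
          p +>\<^bsub>S\<^esub> h s \<noteq> \<zero>\<^bsub>S Quot p\<^esub> \<longrightarrow> (p +>\<^bsub>S\<^esub> h s) \<otimes>\<^bsub>S Quot p\<^esub> v = p +>\<^bsub>S\<^esub> h c \<longrightarrow>
          (p +>\<^bsub>S\<^esub> h b) \<otimes>\<^bsub>S Quot p\<^esub> (v \<oplus>\<^bsub>S Quot p\<^esub> (p +>\<^bsub>S\<^esub> h (\<one> \<ominus> b)) \<otimes>\<^bsub>S Quot p\<^esub> v [^]\<^bsub>S Quot p\<^esub> n)
            \<noteq> \<one>\<^bsub>S Quot p\<^esub>"
        using K.exists_exponent[OF N KD.domain_axioms b nu] by (rule exE)
      interpret Q: ring_hom_cring S "S Quot p" "\<lambda>a. p +>\<^bsub>S\<^esub> a"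
        by (rule ring_hom_cring.intro[OF S.is_cring K.S.is_cring ring_hom_cring_axioms.intro[OF ideal.rcos_ring_hom[OF pI]]])
      have hc: "h b \<in> carrier S" "h (\<one> \<ominus> b) \<in> carrier S" using b by auto
      show ?thesis
      proof (rule S.pe_notin_prime[OF NS prime(1) hc])
        show "h b \<oplus>\<^bsub>S\<^esub> h (\<one> \<ominus> b) = \<one>\<^bsub>S\<^esub>"
        proof -
          have "b \<oplus> (\<one> \<ominus> b) = \<one>" using b by algebra
          then have "h (b \<oplus> (\<one> \<ominus> b)) = \<one>\<^bsub>S\<^esub>" by simp
          then show ?thesis using b by simp
        qed
        have tJ: "h (\<one> \<ominus> b) \<in> J" unfolding t using S.ideal_rmult[OF J(1) aJ] sa y by simp
        then have "S.adjoin p (h (\<one> \<ominus> b)) \<subseteq> J" by (rule S.adjoin_minimal[OF J(1,2)])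
        then show "\<one>\<^bsub>S\<^esub> \<notin> S.adjoin p (h (\<one> \<ominus> b))"
          using ideal.one_imp_carrier[OF J(1)] J(4) by blast
        have "h (\<one> \<ominus> b) \<notin> p"
        proof
          assume "h (\<one> \<ominus> b) \<in> p"
          then have "a \<otimes> y \<in> ?q" unfolding t q using sa y by simp
          then have "(\<one> \<ominus> a \<otimes> y) \<oplus> a \<otimes> y \<in> M" using R.ideal_add[OF MI y(2)] M(3) by blast
          moreover have "(\<one> \<ominus> a \<otimes> y) \<oplus> a \<otimes> y = \<one>" using sa y by algebra
          ultimately show False using one by simp
        qed
        then show "S.pe 1 (\<lambda>t. t ! 0 \<notin> S.adjoin p (h (\<one> \<ominus> b)))"
          by (intro prime(2) S.ideal_adjoin[OF pI] S.adjoin_psubset[OF pI] hc)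
        fix v assume v: "v \<in> carrier S"
        \<comment> \<open>As a fraction over \<open>R\<close>, the class of \<open>v\<close> modulo
          \<open>p\<close> falls under the range of the exponent \<open>n\<close>, which was chosen
          from the image of \<open>R\<close> alone.\<close>
        obtain s c where sc: "s \<in> carrier R" "c \<in> carrier R" "h s \<in> Units S" "h s \<otimes>\<^bsub>S\<^esub> v = h c"
          using loc[OF v] by blast
        let ?w = "h b \<otimes>\<^bsub>S\<^esub> (v \<oplus>\<^bsub>S\<^esub> h (\<one> \<ominus> b) \<otimes>\<^bsub>S\<^esub> v [^]\<^bsub>S\<^esub> n)"
        have wc: "?w \<in> carrier S" using hc v by simp
        have "(p +>\<^bsub>S\<^esub> h s) \<otimes>\<^bsub>S Quot p\<^esub> (p +>\<^bsub>S\<^esub> v) = p +>\<^bsub>S\<^esub> h c"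
          unfolding sc(4)[symmetric] using sc(1) v by (simp add: Q.hom_mult)
        moreover have "p +>\<^bsub>S\<^esub> h s \<noteq> \<zero>\<^bsub>S Quot p\<^esub>" using K0 unit[OF sc(1,3)] sc(1) by simp
        ultimately have "(p +>\<^bsub>S\<^esub> h b) \<otimes>\<^bsub>S Quot p\<^esub> ((p +>\<^bsub>S\<^esub> v)
            \<oplus>\<^bsub>S Quot p\<^esub> (p +>\<^bsub>S\<^esub> h (\<one> \<ominus> b)) \<otimes>\<^bsub>S Quot p\<^esub> (p +>\<^bsub>S\<^esub> v) [^]\<^bsub>S Quot p\<^esub> n) \<noteq> \<one>\<^bsub>S Quot p\<^esub>"
          using n Q.hom_closed[OF v] sc(1,2) by blast
        then have "p +>\<^bsub>S\<^esub> ?w \<noteq> \<one>\<^bsub>S Quot p\<^esub>"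
          using hc v by (simp add: Q.hom_mult Q.hom_add Q.hom_pow)
        then show "?w \<ominus>\<^bsub>S\<^esub> \<one>\<^bsub>S\<^esub> \<notin> p"
        proof (rule contrapos_nn)
          assume "?w \<ominus>\<^bsub>S\<^esub> \<one>\<^bsub>S\<^esub> \<in> p"
          then have "p +>\<^bsub>S\<^esub> ?w = p +>\<^bsub>S\<^esub> \<one>\<^bsub>S\<^esub>"
            using S.quotient_eq_iff_same_a_r_cos[OF pI wc S.one_closed] by blast
          then show "p +>\<^bsub>S\<^esub> ?w = \<one>\<^bsub>S Quot p\<^esub>" unfolding Q.hom_one .
        qed
      qed
    qed
  qed
  from this[OF S.zeroideal] show "S.pe 1 (\<lambda>t. t ! 0 \<notin> {\<zero>\<^bsub>S\<^esub>})" .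
qed

section \<open>Quotients and rings of fractions\<close>

lemma condition_Q_noetherian_jacobson:
  assumes "cring A" and N: "noetherian_ring A" and J: "jacobson_ring A"
  shows "condition_Q A"
  unfolding condition_Q_def
proof (intro allI impI, elim conjE)
  fix I assume I: "ideal I A"
  interpret A: cring A by fact
  interpret Q: ring_hom_cring A "A Quot I" "\<lambda>a. I +>\<^bsub>A\<^esub> a"
    by (rule ring_hom_cring.intro[OF A.is_cring ideal.quotient_is_cring[OF I A.is_cring]
          ring_hom_cring_axioms.intro[OF ideal.rcos_ring_hom[OF I]]])
  show "condition_C (A Quot I)"
  proof (rule Q.localization_condition_C[OF N J])
    fix x assume x: "x \<in> carrier (A Quot I)"
    then obtain a where a: "a \<in> carrier A" "x = I +>\<^bsub>A\<^esub> a" by (rule A.Quot_carrierE)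
    show "\<exists>s\<in>carrier A. \<exists>a\<in>carrier A. I +>\<^bsub>A\<^esub> s \<in> Units (A Quot I) \<and> (I +>\<^bsub>A\<^esub> s) \<otimes>\<^bsub>A Quot I\<^esub> x = I +>\<^bsub>A\<^esub> a"
      by (rule bexI[OF _ A.one_closed], rule bexI[OF _ a(1)], unfold Q.hom_one a(2)[symmetric])
        (rule conjI[OF Q.S.Units_one_closed Q.S.l_one[OF x]])
  qed
qed

text \<open>The composite of \<open>A \<rightarrow> fractions A S\<close> with the isomorphism
  satisfies the fraction hypothesis itself. So positive-existential sets do not have to be
  transported along \<open>h\<close>.\<close>

lemma condition_C_iso_fractions:
  assumes "cring A" and N: "noetherian_ring A" and J: "jacobson_ring A" and S: "submonoid S A"
    and B: "cring B" and h: "h \<in> ring_iso (fractions A S) B"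
  shows "condition_C B"
proof -
  interpret mult_subset A S using assms(1) S by (rule mult_subset.intro)
  interpret F: cring "fractions A S" by (rule cring_fractions)
  interpret B: cring B by fact
  interpret h: ring_hom_cring "fractions A S" B h
    by (rule ring_hom_cring.intro[OF F.is_cring B ring_hom_cring_axioms.intro])
      (use h in \<open>simp add: ring_iso_def\<close>)
  have one: "\<one>\<^bsub>A\<^esub> \<in> S" using submonoid.one_closed[OF submonoid_axioms] .
  let ?f = "\<lambda>a. fraction A S a \<one>\<^bsub>A\<^esub>"
  have "?f \<in> ring_hom A (fractions A S)"
    by (rule ring_hom_memI)
      (simp_all add: fraction_in_carrier fractions_mult fractions_add fractions_one one)
  then have "(\<lambda>a. h (?f a)) \<in> ring_hom A B"
    using ring_hom_trans[OF _ h.homh, of ?f] by (simp add: comp_def)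
  then interpret ring_hom_cring A B "\<lambda>a. h (?f a)"
    by (intro ring_hom_cring.intro is_cring B ring_hom_cring_axioms.intro)
  show ?thesis
  proof (rule localization_condition_C[OF N J])
    fix x assume x: "x \<in> carrier B"
    then obtain y where y: "y \<in> carrier (fractions A S)" "x = h y"
      using h unfolding ring_iso_def bij_betw_def by auto
    obtain a s where as: "a \<in> carrier A" "s \<in> S" "y = fraction A S a s" by (rule fractions_cases[OF y(1)])
    note sc = S_carr[OF as(2)]
    have 1: "?f s \<otimes>\<^bsub>fractions A S\<^esub> fraction A S \<one>\<^bsub>A\<^esub> s = \<one>\<^bsub>fractions A S\<^esub>"
      using as sc one by (simp add: fractions_mult fractions_one) (rule fraction_eqI1; simp)
    have 2: "?f s \<otimes>\<^bsub>fractions A S\<^esub> y = ?f a"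
      using as sc one by (simp add: fractions_mult) (rule fraction_eqI1; simp add: m_comm)
    have c: "?f s \<in> carrier (fractions A S)" "fraction A S \<one>\<^bsub>A\<^esub> s \<in> carrier (fractions A S)"
      using as sc one by (auto intro: fraction_in_carrier)
    have "h (?f s) \<otimes>\<^bsub>B\<^esub> h (fraction A S \<one>\<^bsub>A\<^esub> s) = \<one>\<^bsub>B\<^esub>"
      using h.hom_mult[OF c] unfolding 1 by simp
    then have "h (?f s) \<in> Units B"
      using c B.m_comm[of "h (?f s)" "h (fraction A S \<one>\<^bsub>A\<^esub> s)"] unfolding Units_def by auto
    moreover have "h (?f s) \<otimes>\<^bsub>B\<^esub> x = h (?f a)"
      using h.hom_mult[OF c(1) y(1)] unfolding 2 y(2) by simp
    ultimately show "\<exists>s\<in>carrier A. \<exists>a\<in>carrier A. h (?f s) \<in> Units B \<and> h (?f s) \<otimes>\<^bsub>B\<^esub> x = h (?f a)"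
      using as(1) sc by blast
  qed
qed

lemma condition_C_fractions:
  assumes "cring A" "noetherian_ring A" "jacobson_ring A" "submonoid S A"
  shows "condition_C (fractions A S)"
proof -
  interpret mult_subset A S using assms(1,4) by (rule mult_subset.intro)
  show ?thesis
    using condition_C_iso_fractions[OF assms cring_fractions ring_iso_set_refl] .
qed

section \<open>Artinian rings\<close>

context cring
begin

lemma artinian_chain:
  fixes I :: "nat \<Rightarrow> 'a set"
  assumes "artinian_ring R" "\<And>n. ideal (I n) R" "\<And>n. I (Suc n) \<subseteq> I n"
  shows "\<exists>n. \<forall>m\<ge>n. I m = I n"
  using assms unfolding artinian_ring_def by blast

lemma artinian_minimal:
  assumes A: "artinian_ring R" and E: "\<And>I. I \<in> E \<Longrightarrow> ideal I R" "E \<noteq> {}"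
  shows "\<exists>I\<in>E. \<forall>J\<in>E. J \<subseteq> I \<longrightarrow> J = I"
proof (rule ccontr)
  assume neg: "\<not> (\<exists>I\<in>E. \<forall>J\<in>E. J \<subseteq> I \<longrightarrow> J = I)"
  define f where "f I = (SOME J. J \<in> E \<and> J \<subset> I)" for I
  have f: "f I \<in> E \<and> f I \<subset> I" if "I \<in> E" for I
    unfolding f_def by (rule someI_ex) (use neg that in blast)
  obtain I0 where "I0 \<in> E" using E(2) by blast
  define S where "S n = (f ^^ n) I0" for n
  have S: "S n \<in> E" for n by (induction n) (use f \<open>I0 \<in> E\<close> in \<open>auto simp: S_def\<close>)
  have lt: "S (Suc n) \<subset> S n" for n using f[OF S[of n]] by (simp add: S_def)
  have "\<exists>n. \<forall>m\<ge>n. S m = S n" by (intro artinian_chain[OF A] E(1)[OF S] psubset_imp_subset[OF lt])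
  then obtain n where "\<forall>m\<ge>n. S m = S n" by (rule exE)
  then have "S (Suc n) = S n" using le_SucI[of n n] by blast
  then show False using lt[of n] by blast
qed

text \<open>The ideals generated by the powers of \<open>a\<close> become stationary, whence
  \<open>a^n = a^(n+1) c\<close>. The same relation makes primes maximal and inverts the action of
  \<open>a\<close> on the minimal ideal in \<open>artinian_noetherian\<close>.\<close>

lemma artinian_power:
  assumes A: "artinian_ring R" and a: "a \<in> carrier R"
  obtains n c where "c \<in> carrier R" "a [^] (n::nat) \<otimes> (\<one> \<ominus> a \<otimes> c) = \<zero>"
proof -
  have an: "a [^] n \<in> carrier R" for n :: nat using a by simp
  note I = ideal_adjoin[OF zeroideal an]
  have "adjoin {\<zero>} (a [^] Suc n) \<subseteq> adjoin {\<zero>} (a [^] n)" for n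
    using mult_mem_adjoin[OF zeroideal an a] subset_adjoin[OF zeroideal an]
    by (intro adjoin_minimal[OF I]) auto
  then have "\<exists>n::nat. \<forall>m\<ge>n. adjoin {\<zero>} (a [^] m) = adjoin {\<zero>} (a [^] n)"
    by (intro artinian_chain[OF A, of "\<lambda>n::nat. adjoin {\<zero>} (a [^] n)"] I)
  then obtain n :: nat where "\<forall>m\<ge>n. adjoin {\<zero>} (a [^] m) = adjoin {\<zero>} (a [^] n)" by (rule exE)
  then have "adjoin {\<zero>} (a [^] Suc n) = adjoin {\<zero>} (a [^] n)" using le_SucI[of n n] by blast
  then have "a [^] n \<in> adjoin {\<zero>} (a [^] Suc n)" using mem_adjoin[OF zeroideal an] by simp
  then obtain c where c: "c \<in> carrier R" "a [^] n = a [^] Suc n \<otimes> c"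
    using a by (auto elim!: adjoinE)
  have "a [^] n \<otimes> (\<one> \<ominus> a \<otimes> c) = a [^] n \<ominus> a [^] Suc n \<otimes> c"
    unfolding nat_pow_Suc using a an[of n] c(1) by algebra
  also have "\<dots> = \<zero>" unfolding c(2)[symmetric] using an[of n] by (simp add: a_minus_def r_neg)
  finally show thesis using that c(1) by blast
qed

lemma maximalidealI_inverse:
  assumes P: "ideal P R" "\<one> \<notin> P"
    and inv: "\<And>a. \<lbrakk>a \<in> carrier R; a \<notin> P\<rbrakk> \<Longrightarrow> \<exists>c\<in>carrier R. \<one> \<ominus> a \<otimes> c \<in> P"
  shows "maximalideal P R"
proof (rule maximalidealI[OF P(1)])
  show "carrier R \<noteq> P" using P(2) one_closed by blast
  fix J assume J: "ideal J R" "P \<subseteq> J" "J \<subseteq> carrier R"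
  show "J = P \<or> J = carrier R"
  proof (cases "J = P")
    case False
    then obtain a where a: "a \<in> J" "a \<notin> P" using J(2) by blast
    have ac: "a \<in> carrier R" using ideal_carr[OF J(1) a(1)] .
    obtain c where c: "c \<in> carrier R" "\<one> \<ominus> a \<otimes> c \<in> P" using inv[OF ac a(2)] by blast
    have "(\<one> \<ominus> a \<otimes> c) \<oplus> a \<otimes> c \<in> J"
      using ideal_add[OF J(1) subsetD[OF J(2) c(2)] ideal_rmult[OF J(1) a(1) c(1)]] .
    moreover have "(\<one> \<ominus> a \<otimes> c) \<oplus> a \<otimes> c = \<one>" using ac c(1) by algebra
    ultimately have "\<one> \<in> J" by simp
    then show ?thesis using ideal.one_imp_carrier[OF J(1)] by blast
  qed simp
qed

lemma artinian_prime_maximal: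
  assumes A: "artinian_ring R" and P: "primeideal P R"
  shows "maximalideal P R"
proof (rule maximalidealI_inverse[OF primeideal.axioms(1)[OF P] primeideal_one_notin[OF P]])
  fix a assume a: "a \<in> carrier R" "a \<notin> P"
  obtain n c where c: "c \<in> carrier R" "a [^] (n::nat) \<otimes> (\<one> \<ominus> a \<otimes> c) = \<zero>"
    by (rule artinian_power[OF A a(1)])
  have "a [^] n \<otimes> (\<one> \<ominus> a \<otimes> c) \<in> P" unfolding c(2) by (rule ideal_zero[OF primeideal.axioms(1)[OF P]])
  then have "a [^] n \<in> P \<or> \<one> \<ominus> a \<otimes> c \<in> P"
    using primeideal.I_prime[OF P, of "a [^] n" "\<one> \<ominus> a \<otimes> c"] a c by simp
  then show "\<exists>c\<in>carrier R. \<one> \<ominus> a \<otimes> c \<in> P" using primeideal_power[OF P a(1)] a(2) c(1) by blast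
qed

lemma jacobson_if_primes_maximal:
  assumes "\<And>P. primeideal P R \<Longrightarrow> maximalideal P R"
  shows "jacobson_ring R"
  unfolding jacobson_ring_def using is_cring assms by (intro conjI allI impI exI[of _ "{_}"]) auto

section \<open>Artinian rings are Noetherian\<close>

definition fin_gen :: "'a set \<Rightarrow> bool" where
  "fin_gen I \<longleftrightarrow> (\<exists>A \<subseteq> carrier R. finite A \<and> I = Idl A)"

lemma fin_gen_zero: "fin_gen {\<zero>}"
  unfolding fin_gen_def using genideal_zero by (intro exI[of _ "{\<zero>}"]) auto

lemma fin_gen_adjoin: "\<lbrakk>fin_gen I; a \<in> carrier R\<rbrakk> \<Longrightarrow> fin_gen (adjoin I a)"
  unfolding fin_gen_def using Idl_insert by (metis finite_insert insert_subset)

lemma ideal_mult_image: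
  assumes I: "ideal I R" and a: "a \<in> carrier R"
  shows "ideal {z. \<exists>x\<in>I. z = a \<otimes> x} R"
proof (rule idealI_cring)
  show "{z. \<exists>x\<in>I. z = a \<otimes> x} \<subseteq> carrier R" using ideal_carr[OF I] a by auto
  show "\<zero> \<in> {z. \<exists>x\<in>I. z = a \<otimes> x}" using ideal_zero[OF I] a by (auto intro!: bexI[of _ \<zero>])
  fix x y assume "x \<in> {z. \<exists>x\<in>I. z = a \<otimes> x}"
  then obtain u where u: "u \<in> I" "x = a \<otimes> u" by blast
  { assume "y \<in> {z. \<exists>x\<in>I. z = a \<otimes> x}"
    then obtain v where v: "v \<in> I" "y = a \<otimes> v" by blast
    have "x \<oplus> y = a \<otimes> (u \<oplus> v)" using u v ideal_carr[OF I] a by (simp add: r_distr)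
    then show "x \<oplus> y \<in> {z. \<exists>x\<in>I. z = a \<otimes> x}" using ideal_add[OF I u(1) v(1)] by blast }
  { assume y: "y \<in> carrier R"
    have "y \<otimes> x = a \<otimes> (y \<otimes> u)" using u y ideal_carr[OF I] a by (simp add: m_lcomm)
    then show "y \<otimes> x \<in> {z. \<exists>x\<in>I. z = a \<otimes> x}" using ideal_lmult[OF I u(1) y] by blast }
qed

text \<open>The exact sequence of multiplication by \<open>a\<close> on \<open>H\<close>: preimages
  \<open>B\<close> of generators of \<open>a H\<close>, together with generators \<open>C\<close> of
  the kernel, generate \<open>H\<close>.\<close>

lemma fin_gen_extension:
  assumes H: "ideal H R" and a: "a \<in> carrier R"
    and 1: "fin_gen {z. \<exists>x\<in>H. z = a \<otimes> x}" and 2: "fin_gen {x \<in> H. a \<otimes> x = \<zero>}"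
  shows "fin_gen H"
proof -
  obtain A where A: "A \<subseteq> carrier R" "finite A" "{z. \<exists>x\<in>H. z = a \<otimes> x} = Idl A"
    using 1 unfolding fin_gen_def by blast
  obtain C where C: "C \<subseteq> carrier R" "finite C" "{x \<in> H. a \<otimes> x = \<zero>} = Idl C"
    using 2 unfolding fin_gen_def by blast
  have "A \<subseteq> (\<lambda>x. a \<otimes> x) ` H" using genideal_self[OF A(1)] A(3) by blast
  then obtain B where B: "B \<subseteq> H" "finite B" "A = (\<lambda>x. a \<otimes> x) ` B"
    using finite_subset_image[OF A(2)] by blast
  have BC: "B \<union> C \<subseteq> H" using B(1) C(3) genideal_self[OF C(1)] by blast
  have Hc: "H \<subseteq> carrier R" using ideal_carr[OF H] by blast
  have BCc: "B \<union> C \<subseteq> carrier R" and Bc: "B \<subseteq> carrier R" using BC Hc by auto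
  let ?D = "{z. \<exists>y\<in>Idl B. z = a \<otimes> y}"
  have D: "ideal ?D R" by (rule ideal_mult_image[OF genideal_ideal[OF Bc] a])
  have "A \<subseteq> ?D" using B(3) genideal_self[OF Bc] by blast
  then have AD: "Idl A \<subseteq> ?D" by (rule genideal_minimal[OF D])
  note J = genideal_ideal[OF BCc]
  have "H \<subseteq> Idl (B \<union> C)"
  proof
    fix x assume x: "x \<in> H"
    then have "a \<otimes> x \<in> ?D" using A(3) AD by blast
    then obtain y where y: "y \<in> Idl B" "a \<otimes> x = a \<otimes> y" by blast
    have yH: "y \<in> H" using y(1) genideal_minimal[OF H B(1)] by blast
    have c: "x \<in> carrier R" "y \<in> carrier R" using x yH Hc by auto
    have "a \<otimes> (x \<ominus> y) = a \<otimes> x \<ominus> a \<otimes> y" using c a by algebra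
    also have "\<dots> = \<zero>" unfolding y(2) using a c by (simp add: a_minus_def r_neg)
    finally have "x \<ominus> y \<in> Idl C" using C(3) ideal_minus[OF H x yH] by blast
    then have "x \<ominus> y \<in> Idl (B \<union> C)" using subset_Idl_subset[OF BCc, of C] by blast
    moreover have "y \<in> Idl (B \<union> C)" using y(1) subset_Idl_subset[OF BCc, of B] by blast
    ultimately have "(x \<ominus> y) \<oplus> y \<in> Idl (B \<union> C)" by (rule ideal_add[OF J])
    moreover have "(x \<ominus> y) \<oplus> y = x" using c by algebra
    ultimately show "x \<in> Idl (B \<union> C)" by simp
  qed
  then have "H = Idl (B \<union> C)" using genideal_minimal[OF H BC] by blast
  then show ?thesis unfolding fin_gen_def using BCc B(2) C(2) by blast
qed

text \<open>A minimal ideal \<open>H\<close> that is not finitely generated would be a vector space over the field \<open>R / Ann H\<close>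
  all of whose proper subspaces are finite-dimensional.\<close>

lemma artinian_noetherian:
  assumes A: "artinian_ring R"
  shows "noetherian_ring R"
proof (rule noetherian_ringI, rule ccontr)
  fix I0 assume "ideal I0 R" "\<not> (\<exists>A \<subseteq> carrier R. finite A \<and> I0 = Idl A)"
  then have "{I. ideal I R \<and> \<not> fin_gen I} \<noteq> {}" unfolding fin_gen_def by blast
  then have "\<exists>H\<in>{I. ideal I R \<and> \<not> fin_gen I}. \<forall>J\<in>{I. ideal I R \<and> \<not> fin_gen I}. J \<subseteq> H \<longrightarrow> J = H"
    by (intro artinian_minimal[OF A]) blast
  then obtain H where H: "ideal H R" "\<not> fin_gen H"
    and Hmin: "\<And>J. \<lbrakk>ideal J R; J \<subseteq> H; J \<noteq> H\<rbrakk> \<Longrightarrow> fin_gen J"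
    by blast
  note Hc = ideal_carr[OF H(1)]
  \<comment> \<open>If \<open>a\<close> acts on \<open>H\<close> by a nonzero map, then its kernel
    is proper, hence finitely generated. Were \<open>a H\<close> proper as well, it would also be
    finitely generated, and so would be \<open>H\<close>.\<close>
  have surj: "\<exists>x'\<in>H. x = a \<otimes> x'"
    if a: "a \<in> carrier R" and nz: "\<exists>x\<in>H. a \<otimes> x \<noteq> \<zero>" and x: "x \<in> H" for a x
  proof -
    let ?aH = "{z. \<exists>x\<in>H. z = a \<otimes> x}"
    have "ideal ?aH R" by (rule ideal_mult_image[OF H(1) a])
    moreover have "?aH \<subseteq> H" using ideal_lmult[OF H(1) _ a] by blast
    moreover have "ideal {x \<in> H. a \<otimes> x = \<zero>} R"
    proof (rule idealI_cring)
      show "y \<otimes> x \<in> {x \<in> H. a \<otimes> x = \<zero>}" if "x \<in> {x \<in> H. a \<otimes> x = \<zero>}" "y \<in> carrier R" for x y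
        using that ideal_lmult[OF H(1)] Hc a m_lcomm[of a y x] by simp
    qed (use Hc a ideal_zero[OF H(1)] ideal_add[OF H(1)] in \<open>auto simp: r_distr\<close>)
    moreover have "{x \<in> H. a \<otimes> x = \<zero>} \<noteq> H" using nz by blast
    ultimately have "?aH = H" using Hmin fin_gen_extension[OF H(1) a] H(2) by blast
    then show ?thesis using x by blast
  qed
  \<comment> \<open>As \<open>a^n\<close> maps \<open>H\<close> onto itself, the relation
    \<open>a^n (1 - a c) = 0\<close> shows that \<open>1 - a c\<close> kills \<open>H\<close>. So
    \<open>c\<close> acts as the inverse of \<open>a\<close>.\<close>
  have inv: "\<exists>c\<in>carrier R. \<forall>x\<in>H. (\<one> \<ominus> a \<otimes> c) \<otimes> x = \<zero>"
    if a: "a \<in> carrier R" and nz: "\<exists>x\<in>H. a \<otimes> x \<noteq> \<zero>" for a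
  proof -
    obtain n c where c: "c \<in> carrier R" "a [^] (n::nat) \<otimes> (\<one> \<ominus> a \<otimes> c) = \<zero>"
      by (rule artinian_power[OF A a])
    have pow: "\<exists>x'\<in>H. x = a [^] k \<otimes> x'" if "x \<in> H" for x and k :: nat
    proof (induction k)
      case 0
      show ?case using that Hc[OF that] by (intro bexI[of _ x]) auto
    next
      case (Suc k)
      then obtain y where y: "y \<in> H" "x = a [^] k \<otimes> y" by blast
      obtain z where z: "z \<in> H" "y = a \<otimes> z" using surj[OF a nz y(1)] by blast
      show ?case using y z a Hc by (intro bexI[of _ z]) (simp_all add: m_assoc)
    qed
    have "(\<one> \<ominus> a \<otimes> c) \<otimes> x = \<zero>" if x: "x \<in> H" for x
    proof -
      obtain y where y: "y \<in> H" "x = a [^] n \<otimes> y" using pow[OF x] by blast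
      have an: "a [^] n \<in> carrier R" using a by simp
      have "(\<one> \<ominus> a \<otimes> c) \<otimes> x = (a [^] n \<otimes> (\<one> \<ominus> a \<otimes> c)) \<otimes> y"
        unfolding y(2) using a an c(1) Hc[OF y(1)] by algebra
      then show ?thesis unfolding c(2) using Hc[OF y(1)] by simp
    qed
    then show ?thesis using c(1) by blast
  qed
  have "H \<noteq> {\<zero>}" using H(2) fin_gen_zero by blast
  then obtain x where x: "x \<in> H" "x \<noteq> \<zero>" using ideal_zero[OF H(1)] by blast
  \<comment> \<open>\<open>W\<close> plays the part of a hyperplane that is complementary to the
    line through \<open>x\<close>. It is proper in \<open>H\<close>, hence finitely generated, and
    adjoining \<open>x\<close> recovers \<open>H\<close>.\<close>
  let ?W = "{W. ideal W R \<and> W \<subseteq> H \<and> x \<notin> W}"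
  have "\<exists>W\<in>?W. \<forall>V\<in>?W. W \<subseteq> V \<longrightarrow> V = W"
  proof (rule subset_Zorn_nonempty)
    show "?W \<noteq> {}" using zeroideal ideal_zero[OF H(1)] x(2) by blast
    fix \<C> assume C: "\<C> \<noteq> {}" "subset.chain ?W \<C>"
    then have "subset.chain {I. ideal I R} \<C>" unfolding pred_on.chain_def by blast
    then have "ideal (\<Union>\<C>) R" using chain_Union_is_ideal[of \<C>] C(1) by simp
    moreover have "\<forall>W\<in>\<C>. W \<subseteq> H \<and> x \<notin> W" using C(2) unfolding pred_on.chain_def by blast
    ultimately show "\<Union>\<C> \<in> ?W" by blast
  qed
  then obtain W where W0: "W \<in> ?W" "\<forall>V\<in>?W. W \<subseteq> V \<longrightarrow> V = W" by (rule bexE)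
  then have W: "ideal W R" "W \<subseteq> H" "x \<notin> W" by simp_all
  have max: "V = W" if "ideal V R" "V \<subseteq> H" "x \<notin> V" "W \<subseteq> V" for V
  proof -
    have "V \<in> ?W" using that(1-3) by simp
    then show ?thesis using W0(2) that(4) by blast
  qed
  have xc: "x \<in> carrier R" by (rule Hc[OF x(1)])
  note Wc = ideal_carr[OF W(1)]
  have "H \<subseteq> adjoin W x"
  proof
    fix y assume y: "y \<in> H"
    have yc: "y \<in> carrier R" by (rule Hc[OF y])
    show "y \<in> adjoin W x"
    proof (cases "y \<in> W")
      case True
      then show ?thesis using subset_adjoin[OF W(1) xc] by blast
    next
      case False
      then have "x \<in> adjoin W y"
        using max[OF ideal_adjoin[OF W(1) yc] adjoin_minimal[OF H(1) W(2) y]]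
          subset_adjoin[OF W(1) yc] mem_adjoin[OF W(1) yc] by blast
      then obtain w c where w: "w \<in> W" "c \<in> carrier R" "x = w \<oplus> y \<otimes> c" by (rule adjoinE)
      \<comment> \<open>The relation \<open>x = w + y c\<close> can be solved for \<open>y\<close>
        once \<open>c\<close> acts invertibly on \<open>H\<close>, and it does if it does not kill
        \<open>y\<close>.\<close>
      have "c \<otimes> y \<noteq> \<zero>"
      proof
        assume "c \<otimes> y = \<zero>"
        then have "x = w" using w Wc[OF w(1)] yc m_comm[of c y] by simp
        then show False using W(3) w(1) by simp
      qed
      then obtain d where d: "d \<in> carrier R" "(\<one> \<ominus> c \<otimes> d) \<otimes> y = \<zero>" using inv[OF w(2)] y by blast
      have "y = (\<one> \<ominus> c \<otimes> d) \<otimes> y \<oplus> (y \<otimes> c) \<otimes> d" using yc w(2) d(1) by algebra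
      then have "y = (y \<otimes> c) \<otimes> d" using d yc w(2) by simp
      moreover have "(y \<otimes> c) \<otimes> d = \<ominus> (w \<otimes> d) \<oplus> (w \<oplus> y \<otimes> c) \<otimes> d"
        using yc w(2) Wc[OF w(1)] d(1) by algebra
      ultimately have "y = \<ominus> (w \<otimes> d) \<oplus> x \<otimes> d" using w(3) by simp
      moreover have "\<ominus> (w \<otimes> d) \<in> W" by (rule ideal_neg[OF W(1) ideal_rmult[OF W(1) w(1) d(1)]])
      ultimately show ?thesis using adjoinI d(1) by metis
    qed
  qed
  moreover have "adjoin W x \<subseteq> H" by (rule adjoin_minimal[OF H(1) W(2) x(1)])
  moreover have "fin_gen W" using Hmin[OF W(1,2)] W(3) x(1) by blast
  ultimately show False using fin_gen_adjoin[OF _ xc, of W] H(2) by simp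
qed

lemma artinian_condition_C:
  assumes A: "artinian_ring R"
  shows "condition_C R"
proof -
  interpret ring_hom_cring R R id
    by (rule ring_hom_cring.intro[OF is_cring is_cring ring_hom_cring_axioms.intro]) (rule id_ring_hom)
  show ?thesis
  proof (rule localization_condition_C[OF artinian_noetherian[OF A]
        jacobson_if_primes_maximal[OF artinian_prime_maximal[OF A]]])
    fix x assume "x \<in> carrier R"
    then show "\<exists>s\<in>carrier R. \<exists>a\<in>carrier R. id s \<in> Units R \<and> id s \<otimes> x = id a"
      by (intro bexI[of _ \<one>] bexI[of _ x]) simp_all
  qed
qed

end

section \<open>Algebras generated by one element\<close>

context ring_hom_cring
begin

text \<open>The span over \<open>R\<close> of the powers \<open>x^i\<close> with
  \<open>i < n\<close>. Filtering \<open>S\<close> by degree in \<open>x\<close> keeps the arguments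
  inside \<open>S\<close>, without a polynomial ring mapping onto it.\<close>

primrec pspan :: "'c \<Rightarrow> nat \<Rightarrow> 'c set" where
  "pspan x 0 = {\<zero>\<^bsub>S\<^esub>}"
| "pspan x (Suc n) = {y. \<exists>r\<in>carrier R. \<exists>v\<in>pspan x n. y = h r \<otimes>\<^bsub>S\<^esub> x [^]\<^bsub>S\<^esub> n \<oplus>\<^bsub>S\<^esub> v}"

definition submod :: "'c set \<Rightarrow> bool" where
  "submod M \<longleftrightarrow> M \<subseteq> carrier S \<and> \<zero>\<^bsub>S\<^esub> \<in> M \<and> (\<forall>u\<in>M. \<forall>v\<in>M. u \<oplus>\<^bsub>S\<^esub> v \<in> M) \<and>
     (\<forall>u\<in>M. \<forall>r\<in>carrier R. h r \<otimes>\<^bsub>S\<^esub> u \<in> M)"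

lemma submodI:
  assumes "M \<subseteq> carrier S" "\<zero>\<^bsub>S\<^esub> \<in> M" "\<And>u v. \<lbrakk>u \<in> M; v \<in> M\<rbrakk> \<Longrightarrow> u \<oplus>\<^bsub>S\<^esub> v \<in> M"
    "\<And>u r. \<lbrakk>u \<in> M; r \<in> carrier R\<rbrakk> \<Longrightarrow> h r \<otimes>\<^bsub>S\<^esub> u \<in> M"
  shows "submod M"
  using assms unfolding submod_def by blast

lemma submodD:
  assumes "submod M"
  shows "u \<in> M \<Longrightarrow> u \<in> carrier S" "\<zero>\<^bsub>S\<^esub> \<in> M" "\<lbrakk>u \<in> M; v \<in> M\<rbrakk> \<Longrightarrow> u \<oplus>\<^bsub>S\<^esub> v \<in> M"
    "\<lbrakk>u \<in> M; r \<in> carrier R\<rbrakk> \<Longrightarrow> h r \<otimes>\<^bsub>S\<^esub> u \<in> M"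
  using assms unfolding submod_def by blast+

lemma submod_minus:
  assumes M: "submod M" and u: "u \<in> M" "v \<in> M"
  shows "u \<ominus>\<^bsub>S\<^esub> v \<in> M"
proof -
  have "h (\<ominus> \<one>) = \<ominus>\<^bsub>S\<^esub> \<one>\<^bsub>S\<^esub>" by simp
  then have "u \<ominus>\<^bsub>S\<^esub> v = u \<oplus>\<^bsub>S\<^esub> h (\<ominus> \<one>) \<otimes>\<^bsub>S\<^esub> v"
    using submodD(1)[OF M u(2)] by (simp add: a_minus_def S.l_minus)
  moreover have "h (\<ominus> \<one>) \<otimes>\<^bsub>S\<^esub> v \<in> M" by (rule submodD(4)[OF M u(2)]) simp
  ultimately show ?thesis using submodD(3)[OF M u(1)] by (simp only:)
qed

lemma submod_ideal: "ideal I S \<Longrightarrow> submod I"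
  by (rule submodI) (auto intro: S.ideal_zero S.ideal_add S.ideal_lmult dest: S.ideal_carr)

lemma pspanI: "\<lbrakk>r \<in> carrier R; v \<in> pspan x n\<rbrakk> \<Longrightarrow> h r \<otimes>\<^bsub>S\<^esub> x [^]\<^bsub>S\<^esub> n \<oplus>\<^bsub>S\<^esub> v \<in> pspan x (Suc n)"
  by auto

lemma pspanE:
  assumes "y \<in> pspan x (Suc n)"
  obtains r v where "r \<in> carrier R" "v \<in> pspan x n" "y = h r \<otimes>\<^bsub>S\<^esub> x [^]\<^bsub>S\<^esub> n \<oplus>\<^bsub>S\<^esub> v"
  using assms by auto

lemma submod_pspan:
  assumes x: "x \<in> carrier S"
  shows "submod (pspan x n)"
proof (induction n)
  case 0
  show ?case by (rule submodI) auto
next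
  case (Suc n)
  note M = submodD[OF Suc]
  have xn: "x [^]\<^bsub>S\<^esub> n \<in> carrier S" using x by simp
  show ?case
  proof (rule submodI)
    show "pspan x (Suc n) \<subseteq> carrier S" using M(1) xn by (auto elim!: pspanE)
    show "\<zero>\<^bsub>S\<^esub> \<in> pspan x (Suc n)" using pspanI[OF R.zero_closed M(2)] xn by simp
    fix u assume "u \<in> pspan x (Suc n)"
    then obtain r v where 1: "r \<in> carrier R" "v \<in> pspan x n" "u = h r \<otimes>\<^bsub>S\<^esub> x [^]\<^bsub>S\<^esub> n \<oplus>\<^bsub>S\<^esub> v"
      by (rule pspanE)
    { fix u' assume "u' \<in> pspan x (Suc n)"
      then obtain r' v' where 2: "r' \<in> carrier R" "v' \<in> pspan x n" "u' = h r' \<otimes>\<^bsub>S\<^esub> x [^]\<^bsub>S\<^esub> n \<oplus>\<^bsub>S\<^esub> v'"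
        by (rule pspanE)
      have "u \<oplus>\<^bsub>S\<^esub> u' = h (r \<oplus> r') \<otimes>\<^bsub>S\<^esub> x [^]\<^bsub>S\<^esub> n \<oplus>\<^bsub>S\<^esub> (v \<oplus>\<^bsub>S\<^esub> v')"
        using 1 2 xn M(1)[OF 1(2)] M(1)[OF 2(2)] by (simp add: S.l_distr S.a_ac)
      then show "u \<oplus>\<^bsub>S\<^esub> u' \<in> pspan x (Suc n)"
        using pspanI[OF R.a_closed[OF 1(1) 2(1)] M(3)[OF 1(2) 2(2)]] by (simp only:) }
    { fix r' assume r': "r' \<in> carrier R"
      have "h r' \<otimes>\<^bsub>S\<^esub> u = h (r' \<otimes> r) \<otimes>\<^bsub>S\<^esub> x [^]\<^bsub>S\<^esub> n \<oplus>\<^bsub>S\<^esub> h r' \<otimes>\<^bsub>S\<^esub> v"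
        using 1 xn M(1)[OF 1(2)] r' by (simp add: S.r_distr S.m_assoc)
      then show "h r' \<otimes>\<^bsub>S\<^esub> u \<in> pspan x (Suc n)"
        using pspanI[OF R.m_closed[OF r' 1(1)] M(4)[OF 1(2) r']] by (simp only:) }
  qed
qed

lemma pspan_mono:
  assumes x: "x \<in> carrier S" and "m \<le> n"
  shows "pspan x m \<subseteq> pspan x n"
proof (rule lift_Suc_mono_le[OF _ assms(2)])
  fix k
  show "pspan x k \<subseteq> pspan x (Suc k)"
  proof
    fix v assume v: "v \<in> pspan x k"
    then show "v \<in> pspan x (Suc k)"
      using pspanI[OF R.zero_closed v] submodD(1)[OF submod_pspan[OF x] v] x by simp
  qed
qed

lemma pow_in_pspan: "x \<in> carrier S \<Longrightarrow> r \<in> carrier R \<Longrightarrow> h r \<otimes>\<^bsub>S\<^esub> x [^]\<^bsub>S\<^esub> n \<in> pspan x (Suc n)"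
  using pspanI[OF _ submodD(2)[OF submod_pspan], of r x n] by simp

lemma hom_in_pspan: "x \<in> carrier S \<Longrightarrow> r \<in> carrier R \<Longrightarrow> h r \<in> pspan x (Suc n)"
  using pow_in_pspan[of x r 0] pspan_mono[of x "Suc 0" "Suc n"] by auto

lemma one_in_pspan: "x \<in> carrier S \<Longrightarrow> \<one>\<^bsub>S\<^esub> \<in> pspan x (Suc n)"
  using hom_in_pspan[OF _ R.one_closed] by simp

lemma pow_mult_pspan:
  assumes x: "x \<in> carrier S" and v: "v \<in> pspan x n"
  shows "x [^]\<^bsub>S\<^esub> m \<otimes>\<^bsub>S\<^esub> v \<in> pspan x (m + n)"
  using v
proof (induction n arbitrary: v)
  case 0
  then show ?case using x submodD(2)[OF submod_pspan[OF x]] by simp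
next
  case (Suc n)
  obtain r w where w: "r \<in> carrier R" "w \<in> pspan x n" "v = h r \<otimes>\<^bsub>S\<^esub> x [^]\<^bsub>S\<^esub> n \<oplus>\<^bsub>S\<^esub> w"
    using Suc.prems by (rule pspanE)
  have xm: "x [^]\<^bsub>S\<^esub> m \<in> carrier S" "x [^]\<^bsub>S\<^esub> n \<in> carrier S" using x by auto
  have "x [^]\<^bsub>S\<^esub> m \<otimes>\<^bsub>S\<^esub> v = h r \<otimes>\<^bsub>S\<^esub> (x [^]\<^bsub>S\<^esub> m \<otimes>\<^bsub>S\<^esub> x [^]\<^bsub>S\<^esub> n) \<oplus>\<^bsub>S\<^esub> x [^]\<^bsub>S\<^esub> m \<otimes>\<^bsub>S\<^esub> w"
    unfolding w(3) using w(1) xm submodD(1)[OF submod_pspan[OF x] w(2)]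
    by (simp add: S.r_distr S.m_lcomm)
  also have "\<dots> \<in> pspan x (Suc (m + n))"
    unfolding S.nat_pow_mult[OF x] by (rule pspanI[OF w(1) Suc.IH[OF w(2)]])
  finally show ?case by simp
qed

lemma pspan_mult:
  assumes x: "x \<in> carrier S" and u: "u \<in> pspan x m" and v: "v \<in> pspan x n"
  shows "u \<otimes>\<^bsub>S\<^esub> v \<in> pspan x (m + n)"
  using u
proof (induction m arbitrary: u)
  case 0
  then show ?case using submodD(1,2)[OF submod_pspan[OF x]] v by simp
next
  case (Suc m)
  obtain r w where w: "r \<in> carrier R" "w \<in> pspan x m" "u = h r \<otimes>\<^bsub>S\<^esub> x [^]\<^bsub>S\<^esub> m \<oplus>\<^bsub>S\<^esub> w"
    using Suc.prems by (rule pspanE)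
  note M = submodD[OF submod_pspan[OF x]]
  have "u \<otimes>\<^bsub>S\<^esub> v = h r \<otimes>\<^bsub>S\<^esub> (x [^]\<^bsub>S\<^esub> m \<otimes>\<^bsub>S\<^esub> v) \<oplus>\<^bsub>S\<^esub> w \<otimes>\<^bsub>S\<^esub> v"
    unfolding w(3) using w(1) x M(1)[OF w(2)] M(1)[OF v] by (simp add: S.l_distr S.m_assoc)
  also have "\<dots> \<in> pspan x (m + n)"
    by (rule M(3)[OF M(4)[OF pow_mult_pspan[OF x v] w(1)] Suc.IH[OF w(2)]])
  finally show ?case using pspan_mono[OF x, of "m + n" "Suc m + n"] by auto
qed

lemma pspan_pow:
  assumes x: "x \<in> carrier S" and y: "y \<in> pspan x k"
  shows "y [^]\<^bsub>S\<^esub> i \<in> pspan x (Suc (i * k))"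
proof (induction i)
  case 0
  show ?case using one_in_pspan[OF x, of 0] by simp
next
  case (Suc i)
  then show ?case using pspan_mult[OF x Suc y] by (simp add: add.commute)
qed

text \<open>Horner's form, in which the constant term is split off instead of the leading
  one.\<close>

lemma pspan_Suc_shift:
  assumes x: "x \<in> carrier S" and y: "y \<in> pspan x (Suc n)"
  shows "\<exists>r\<in>carrier R. \<exists>w\<in>pspan x n. y = h r \<oplus>\<^bsub>S\<^esub> x \<otimes>\<^bsub>S\<^esub> w"
  using y
proof (induction n arbitrary: y)
  case 0
  then obtain r where "r \<in> carrier R" "y = h r \<otimes>\<^bsub>S\<^esub> x [^]\<^bsub>S\<^esub> (0::nat) \<oplus>\<^bsub>S\<^esub> \<zero>\<^bsub>S\<^esub>" by auto
  then show ?case using x by (intro bexI[of _ r] bexI[of _ "\<zero>\<^bsub>S\<^esub>"]) auto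
next
  case (Suc n)
  obtain r v where v: "r \<in> carrier R" "v \<in> pspan x (Suc n)"
    "y = h r \<otimes>\<^bsub>S\<^esub> x [^]\<^bsub>S\<^esub> Suc n \<oplus>\<^bsub>S\<^esub> v" using Suc.prems by (rule pspanE)
  obtain s w where w: "s \<in> carrier R" "w \<in> pspan x n" "v = h s \<oplus>\<^bsub>S\<^esub> x \<otimes>\<^bsub>S\<^esub> w" using Suc.IH[OF v(2)] by blast
  have "y = h s \<oplus>\<^bsub>S\<^esub> x \<otimes>\<^bsub>S\<^esub> (h r \<otimes>\<^bsub>S\<^esub> x [^]\<^bsub>S\<^esub> n \<oplus>\<^bsub>S\<^esub> w)"
    unfolding v(3) w(3) using v(1) w(1) x submodD(1)[OF submod_pspan[OF x] w(2)]
    by (simp add: S.r_distr S.m_ac S.a_ac)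
  then show ?case using w(1) pspanI[OF v(1) w(2)] by blast
qed

section \<open>Leading coefficients\<close>

definition lead :: "'c \<Rightarrow> nat \<Rightarrow> 'c set \<Rightarrow> 'a set" where
  "lead x n M = {r \<in> carrier R. \<exists>v\<in>pspan x n. h r \<otimes>\<^bsub>S\<^esub> x [^]\<^bsub>S\<^esub> n \<oplus>\<^bsub>S\<^esub> v \<in> M}"

text \<open>As \<open>x\<close> may satisfy relations, an element need not have a unique leading
  coefficient. Collecting the coefficients of all representations still gives an ideal.\<close>

lemma ideal_lead:
  assumes x: "x \<in> carrier S" and M: "submod M"
  shows "ideal (lead x n M) R"
proof (rule R.idealI_cring)
  note V = submodD[OF submod_pspan[OF x]] and M = submodD[OF M]
  have xn: "x [^]\<^bsub>S\<^esub> n \<in> carrier S" using x by simp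
  show "lead x n M \<subseteq> carrier R" by (auto simp: lead_def)
  show "\<zero> \<in> lead x n M" unfolding lead_def using V(2) M(2) xn by (auto intro!: bexI[of _ "\<zero>\<^bsub>S\<^esub>"])
  fix r s assume "r \<in> lead x n M"
  then obtain v where v: "r \<in> carrier R" "v \<in> pspan x n" "h r \<otimes>\<^bsub>S\<^esub> x [^]\<^bsub>S\<^esub> n \<oplus>\<^bsub>S\<^esub> v \<in> M"
    unfolding lead_def by blast
  note vc = V(1)[OF v(2)]
  { assume "s \<in> lead x n M"
    then obtain w where w: "s \<in> carrier R" "w \<in> pspan x n" "h s \<otimes>\<^bsub>S\<^esub> x [^]\<^bsub>S\<^esub> n \<oplus>\<^bsub>S\<^esub> w \<in> M"
      unfolding lead_def by blast
    note wc = V(1)[OF w(2)]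
    have "(h r \<otimes>\<^bsub>S\<^esub> x [^]\<^bsub>S\<^esub> n \<oplus>\<^bsub>S\<^esub> v) \<oplus>\<^bsub>S\<^esub> (h s \<otimes>\<^bsub>S\<^esub> x [^]\<^bsub>S\<^esub> n \<oplus>\<^bsub>S\<^esub> w)
        = h (r \<oplus> s) \<otimes>\<^bsub>S\<^esub> x [^]\<^bsub>S\<^esub> n \<oplus>\<^bsub>S\<^esub> (v \<oplus>\<^bsub>S\<^esub> w)"
      using v(1) w(1) vc wc xn by (simp add: S.l_distr S.a_ac)
    then have "h (r \<oplus> s) \<otimes>\<^bsub>S\<^esub> x [^]\<^bsub>S\<^esub> n \<oplus>\<^bsub>S\<^esub> (v \<oplus>\<^bsub>S\<^esub> w) \<in> M" using M(3)[OF v(3) w(3)] by (simp only:)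
    then show "r \<oplus> s \<in> lead x n M" unfolding lead_def using v(1) w(1) V(3)[OF v(2) w(2)] by blast }
  { assume s: "s \<in> carrier R"
    have "h s \<otimes>\<^bsub>S\<^esub> (h r \<otimes>\<^bsub>S\<^esub> x [^]\<^bsub>S\<^esub> n \<oplus>\<^bsub>S\<^esub> v) = h (s \<otimes> r) \<otimes>\<^bsub>S\<^esub> x [^]\<^bsub>S\<^esub> n \<oplus>\<^bsub>S\<^esub> h s \<otimes>\<^bsub>S\<^esub> v"
      using v(1) s vc xn by (simp add: S.r_distr S.m_assoc)
    then have "h (s \<otimes> r) \<otimes>\<^bsub>S\<^esub> x [^]\<^bsub>S\<^esub> n \<oplus>\<^bsub>S\<^esub> h s \<otimes>\<^bsub>S\<^esub> v \<in> M" using M(4)[OF v(3) s] by (simp only:)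
    then show "s \<otimes> r \<in> lead x n M" unfolding lead_def using v(1) s V(4)[OF v(2) s] by blast }
qed

lemma lead_mono: "M \<subseteq> N \<Longrightarrow> lead x n M \<subseteq> lead x n N"
  unfolding lead_def by blast

text \<open>An element of \<open>M\<close> with the same leading coefficient is subtracted from the
  given element of \<open>N\<close>, which lowers the degree; induction treats the
  difference.\<close>

lemma submod_subset_if_lead_eq:
  assumes x: "x \<in> carrier S" and M: "submod M" and N: "submod N" "M \<subseteq> N"
    and eq: "\<And>k. k < n \<Longrightarrow> lead x k N \<subseteq> lead x k M"
  shows "N \<inter> pspan x n \<subseteq> M"
  using eq
proof (induction n)
  case 0
  show ?case using submodD(2)[OF M] by auto
next
  case (Suc n)
  show ?case
  proof
    fix y assume "y \<in> N \<inter> pspan x (Suc n)"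
    then have y: "y \<in> N" "y \<in> pspan x (Suc n)" by auto
    note V = submod_pspan[OF x, of n]
    obtain r v where v: "r \<in> carrier R" "v \<in> pspan x n" "y = h r \<otimes>\<^bsub>S\<^esub> x [^]\<^bsub>S\<^esub> n \<oplus>\<^bsub>S\<^esub> v"
      using y(2) by (rule pspanE)
    have "r \<in> lead x n N" unfolding lead_def using v y(1) by blast
    then have "r \<in> lead x n M" using Suc.prems[of n] by blast
    then obtain w where w: "w \<in> pspan x n" "h r \<otimes>\<^bsub>S\<^esub> x [^]\<^bsub>S\<^esub> n \<oplus>\<^bsub>S\<^esub> w \<in> M" unfolding lead_def by blast
    let ?z = "h r \<otimes>\<^bsub>S\<^esub> x [^]\<^bsub>S\<^esub> n \<oplus>\<^bsub>S\<^esub> w"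
    have c: "h r \<otimes>\<^bsub>S\<^esub> x [^]\<^bsub>S\<^esub> n \<in> carrier S" "v \<in> carrier S" "w \<in> carrier S"
      using v(1) x submodD(1)[OF V v(2)] submodD(1)[OF V w(1)] by auto
    have "y \<ominus>\<^bsub>S\<^esub> ?z \<in> N" using submod_minus[OF N(1) y(1)] w(2) N(2) by blast
    moreover have "y \<ominus>\<^bsub>S\<^esub> ?z = v \<ominus>\<^bsub>S\<^esub> w" unfolding v(3) using c by algebra
    ultimately have "v \<ominus>\<^bsub>S\<^esub> w \<in> N \<inter> pspan x n" using submod_minus[OF V v(2) w(1)] by simp
    then have "v \<ominus>\<^bsub>S\<^esub> w \<in> M" using Suc.IH Suc.prems by force
    then have "?z \<oplus>\<^bsub>S\<^esub> (v \<ominus>\<^bsub>S\<^esub> w) \<in> M" by (rule submodD(3)[OF M w(2)])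
    moreover have "?z \<oplus>\<^bsub>S\<^esub> (v \<ominus>\<^bsub>S\<^esub> w) = y" unfolding v(3) using c by algebra
    ultimately show "y \<in> M" by simp
  qed
qed

lemma lead_chain_stable:
  fixes M :: "nat \<Rightarrow> 'c set"
  assumes N: "noetherian_ring R" and x: "x \<in> carrier S"
    and M: "\<And>j. submod (M j)" "\<And>j. M j \<subseteq> M (Suc j)"
  shows "\<exists>J. \<forall>j\<ge>J. \<forall>k<n. lead x k (M j) = lead x k (M J)"
proof (induction n)
  case (Suc n)
  then obtain J where J: "\<forall>j\<ge>J. \<forall>k<n. lead x k (M j) = lead x k (M J)" by blast
  have "\<exists>J. \<forall>j\<ge>J. lead x n (M j) = lead x n (M J)"
    by (rule R.noetherian_chain[OF N, of "\<lambda>j. lead x n (M j)"])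
      (rule ideal_lead[OF x M(1)], rule lead_mono[OF M(2)])
  then obtain J' where J': "\<forall>j\<ge>J'. lead x n (M j) = lead x n (M J')" by (rule exE)
  have "lead x k (M j) = lead x k (M (max J J'))" if "j \<ge> max J J'" "k < Suc n" for j k
  proof (cases "k = n")
    case True
    have "lead x n (M j) = lead x n (M J')" "lead x n (M (max J J')) = lead x n (M J')"
      using J' that(1) by (meson max.boundedE max.cobounded2)+
    then show ?thesis using True by blast
  next
    case False
    then have "k < n" using that(2) by simp
    then have "lead x k (M j) = lead x k (M J)" "lead x k (M (max J J')) = lead x k (M J)"
      using J that(1) by (meson max.boundedE max.cobounded1)+
    then show ?thesis by blast
  qed
  then show ?case by blast
qed simp

text \<open>A submodule of the finitely generated module \<open>pspan x n\<close> is controlled by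
  the \<open>n\<close> ideals \<open>lead x k\<close> with \<open>k < n\<close>, so the chain
  condition is inherited from \<open>R\<close>.\<close>

lemma submod_chain:
  fixes M :: "nat \<Rightarrow> 'c set"
  assumes N: "noetherian_ring R" and x: "x \<in> carrier S"
    and M: "\<And>j. submod (M j)" "\<And>j. M j \<subseteq> M (Suc j)" "\<And>j. M j \<subseteq> pspan x n"
  shows "\<exists>j. M (Suc j) = M j"
proof -
  obtain J where J: "\<forall>j\<ge>J. \<forall>k<n. lead x k (M j) = lead x k (M J)"
    using lead_chain_stable[of x M n, OF N x M(1,2)] by (rule exE)
  have "M (Suc J) \<inter> pspan x n \<subseteq> M J"
    by (rule submod_subset_if_lead_eq[OF x M(1) M(1) M(2)]) (use J le_SucI[of J J] in blast)
  then show ?thesis using M(2)[of J] M(3)[of "Suc J"] by blast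
qed

section \<open>Linear dependence in finitely generated modules\<close>

primrec seq_span :: "(nat \<Rightarrow> 'c) \<Rightarrow> nat \<Rightarrow> 'c set" where
  "seq_span y 0 = {\<zero>\<^bsub>S\<^esub>}"
| "seq_span y (Suc n) = {z. \<exists>w\<in>seq_span y n. \<exists>c\<in>carrier R. z = w \<oplus>\<^bsub>S\<^esub> h c \<otimes>\<^bsub>S\<^esub> y n}"

lemma submod_seq_span:
  assumes y: "\<And>n. y n \<in> carrier S"
  shows "submod (seq_span y n)"
proof (induction n)
  case 0
  show ?case by (rule submodI) auto
next
  case (Suc n)
  note M = submodD[OF Suc]
  show ?case
  proof (rule submodI)
    show "seq_span y (Suc n) \<subseteq> carrier S" using M(1) y by auto
    show "\<zero>\<^bsub>S\<^esub> \<in> seq_span y (Suc n)" using M(2) y by (auto intro!: bexI[of _ "\<zero>\<^bsub>S\<^esub>"] bexI[of _ \<zero>])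
    fix u assume "u \<in> seq_span y (Suc n)"
    then obtain w c where 1: "w \<in> seq_span y n" "c \<in> carrier R" "u = w \<oplus>\<^bsub>S\<^esub> h c \<otimes>\<^bsub>S\<^esub> y n" by auto
    note wc = M(1)[OF 1(1)]
    { fix u' assume "u' \<in> seq_span y (Suc n)"
      then obtain w' c' where 2: "w' \<in> seq_span y n" "c' \<in> carrier R" "u' = w' \<oplus>\<^bsub>S\<^esub> h c' \<otimes>\<^bsub>S\<^esub> y n" by auto
      have "u \<oplus>\<^bsub>S\<^esub> u' = (w \<oplus>\<^bsub>S\<^esub> w') \<oplus>\<^bsub>S\<^esub> h (c \<oplus> c') \<otimes>\<^bsub>S\<^esub> y n"
        using 1(2,3) 2(2,3) wc M(1)[OF 2(1)] y by (simp add: S.l_distr S.a_ac)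
      then show "u \<oplus>\<^bsub>S\<^esub> u' \<in> seq_span y (Suc n)"
        using M(3)[OF 1(1) 2(1)] R.a_closed[OF 1(2) 2(2)] unfolding seq_span.simps by blast }
    { fix r assume r: "r \<in> carrier R"
      have "h r \<otimes>\<^bsub>S\<^esub> u = h r \<otimes>\<^bsub>S\<^esub> w \<oplus>\<^bsub>S\<^esub> h (r \<otimes> c) \<otimes>\<^bsub>S\<^esub> y n"
        using 1(2,3) wc r y by (simp add: S.r_distr S.m_assoc)
      then show "h r \<otimes>\<^bsub>S\<^esub> u \<in> seq_span y (Suc n)"
        using M(4)[OF 1(1) r] R.m_closed[OF r 1(2)] unfolding seq_span.simps by blast }
  qed
qed

text \<open>The spans increase inside a Noetherian module, so two successive ones agree. Applied to
  scaled powers of an element of \<open>S\<close>, the dependence is an algebraic equation for that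
  element.\<close>

lemma seq_span_dependent:
  assumes N: "noetherian_ring R" and x: "x \<in> carrier S" and y: "\<And>i. y i \<in> pspan x n"
  shows "\<exists>m. y m \<in> seq_span y m"
proof -
  note V = submodD[OF submod_pspan[OF x]]
  have yc: "y i \<in> carrier S" for i using V(1)[OF y] .
  note M = submod_seq_span[of y, OF yc]
  have sub: "seq_span y j \<subseteq> seq_span y (Suc j)" for j
  proof
    fix w assume w: "w \<in> seq_span y j"
    then have "w = w \<oplus>\<^bsub>S\<^esub> h \<zero> \<otimes>\<^bsub>S\<^esub> y j" using submodD(1)[OF M w] yc by simp
    then show "w \<in> seq_span y (Suc j)" using w R.zero_closed unfolding seq_span.simps by blast
  qed
  have "seq_span y j \<subseteq> pspan x n" for j
  proof (induction j)
    case 0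
    show ?case using V(2) by simp
  next
    case (Suc j)
    then show ?case using V(3) V(4) y by auto
  qed
  then obtain j where j: "seq_span y (Suc j) = seq_span y j"
    using submod_chain[of x "seq_span y" n, OF N x M sub] by blast
  have "y j = \<zero>\<^bsub>S\<^esub> \<oplus>\<^bsub>S\<^esub> h \<one> \<otimes>\<^bsub>S\<^esub> y j" using yc by simp
  then have "y j \<in> seq_span y (Suc j)"
    using submodD(2)[OF M] R.one_closed unfolding seq_span.simps by blast
  then show ?thesis using j by blast
qed

text \<open>Hilbert's basis theorem. The diagonal chain \<open>lead x n (I n)\<close> takes care of
  all large degrees at once, and only finitely many degrees remain.\<close>

lemma noetherian_simple_extension:
  assumes N: "noetherian_ring R" and x: "x \<in> carrier S" and gen: "carrier S \<subseteq> (\<Union>n. pspan x n)"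
  shows "noetherian_ring S"
proof (rule S.noetherian_ringI_chain)
  fix I :: "nat \<Rightarrow> _ set" assume I: "\<And>n. ideal (I n) S" "\<And>n. I n \<subseteq> I (Suc n)"
  note M = submod_ideal[OF I(1)]
  have lead_Suc: "lead x k (I j) \<subseteq> lead x (Suc k) (I j)" for k j
  proof
    fix r assume "r \<in> lead x k (I j)"
    then obtain v where v: "r \<in> carrier R" "v \<in> pspan x k" "h r \<otimes>\<^bsub>S\<^esub> x [^]\<^bsub>S\<^esub> k \<oplus>\<^bsub>S\<^esub> v \<in> I j"
      unfolding lead_def by blast
    have xk: "x [^]\<^bsub>S\<^esub> k \<in> carrier S" using x by simp
    have "x \<otimes>\<^bsub>S\<^esub> (h r \<otimes>\<^bsub>S\<^esub> x [^]\<^bsub>S\<^esub> k \<oplus>\<^bsub>S\<^esub> v) = h r \<otimes>\<^bsub>S\<^esub> x [^]\<^bsub>S\<^esub> Suc k \<oplus>\<^bsub>S\<^esub> x \<otimes>\<^bsub>S\<^esub> v"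
      using v(1) x xk submodD(1)[OF submod_pspan[OF x] v(2)] by (simp add: S.r_distr S.m_ac)
    then have "h r \<otimes>\<^bsub>S\<^esub> x [^]\<^bsub>S\<^esub> Suc k \<oplus>\<^bsub>S\<^esub> x \<otimes>\<^bsub>S\<^esub> v \<in> I j"
      using S.ideal_lmult[OF I(1) v(3) x] by (simp only:)
    moreover have "x \<otimes>\<^bsub>S\<^esub> v \<in> pspan x (Suc k)" using pow_mult_pspan[OF x v(2), of 1] x by simp
    ultimately show "r \<in> lead x (Suc k) (I j)" unfolding lead_def using v(1) by blast
  qed
  have I_mono: "I i \<subseteq> I j" if "i \<le> j" for i j by (rule lift_Suc_mono_le[of I, OF I(2) that])
  have lm: "lead x k (I i) \<subseteq> lead x l (I j)" if "k \<le> l" "i \<le> j" for k l i j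
    using lift_Suc_mono_le[of "\<lambda>k. lead x k (I i)", OF lead_Suc that(1)] lead_mono[OF I_mono[OF that(2)]]
    by (meson subset_trans)
  have "\<exists>n. \<forall>m\<ge>n. lead x m (I m) = lead x n (I n)"
    by (rule R.noetherian_chain[OF N, of "\<lambda>n. lead x n (I n)"])
      (rule ideal_lead[OF x M], rule lm, simp_all)
  then obtain n where n: "\<forall>m\<ge>n. lead x m (I m) = lead x n (I n)" by (rule exE)
  obtain J where J: "\<forall>j\<ge>J. \<forall>k<n. lead x k (I j) = lead x k (I J)"
    using lead_chain_stable[of x I n, OF N x M I(2)] by (rule exE)
  define j where "j = max n J"
  have eq: "lead x k (I (Suc j)) \<subseteq> lead x k (I j)" for k
  proof (cases "k < n")
    case True
    have "J \<le> j" "J \<le> Suc j" by (auto simp: j_def)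
    then have "lead x k (I (Suc j)) = lead x k (I J)" "lead x k (I j) = lead x k (I J)"
      using J True by blast+
    then show ?thesis by blast
  next
    case False
    \<comment> \<open>A degree \<open>k \<ge> n\<close> is squeezed by the diagonal: the ideal at
      \<open>Suc j\<close> lies below the member at \<open>m\<close>, which equals the member at
      \<open>n\<close>, and this one lies below the ideal at \<open>j\<close>.\<close>
    define m where "m = max k (Suc j)"
    have "lead x k (I (Suc j)) \<subseteq> lead x m (I m)" by (rule lm) (auto simp: m_def)
    also have "lead x m (I m) = lead x n (I n)"
    proof -
      have "n \<le> m" by (auto simp: m_def j_def)
      then show ?thesis using n by blast
    qed
    also have "\<dots> \<subseteq> lead x k (I j)" by (rule lm) (use False in \<open>auto simp: j_def\<close>)
    finally show ?thesis .
  qed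
  have "I (Suc j) \<subseteq> I j"
  proof
    fix y assume y: "y \<in> I (Suc j)"
    then obtain m where "y \<in> pspan x m" using gen S.ideal_carr[OF I(1)] by blast
    then show "y \<in> I j" using submod_subset_if_lead_eq[OF x M M I(2) eq] y by blast
  qed
  then show "\<exists>n. I (Suc n) = I n" using I(2) by blast
qed

end

section \<open>Simple extensions of Jacobson rings\<close>

context ring_hom_cring
begin

text \<open>An algebraic relation for \<open>a\<close> whose lowest coefficient is nonzero shows that \<open>a\<close> divides it.\<close>

lemma algebraic_divides:
  assumes S: "domain S" and a: "a \<in> carrier S" "a \<noteq> \<zero>\<^bsub>S\<^esub>"
    and c: "c \<in> carrier R" "h c \<noteq> \<zero>\<^bsub>S\<^esub>" and rel: "h c \<otimes>\<^bsub>S\<^esub> a [^]\<^bsub>S\<^esub> n \<in> pspan a n"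
  shows "\<exists>s\<in>carrier R. \<exists>a'\<in>carrier S. h s \<noteq> \<zero>\<^bsub>S\<^esub> \<and> a \<otimes>\<^bsub>S\<^esub> a' = h s"
  using rel
proof (induction n)
  case 0
  then show ?case using c by simp
next
  case (Suc n)
  interpret S: domain S by fact
  obtain r w where w: "r \<in> carrier R" "w \<in> pspan a n" "h c \<otimes>\<^bsub>S\<^esub> a [^]\<^bsub>S\<^esub> Suc n = h r \<oplus>\<^bsub>S\<^esub> a \<otimes>\<^bsub>S\<^esub> w"
    using pspan_Suc_shift[OF a(1) Suc.prems] by blast
  have wc: "w \<in> carrier S" using submodD(1)[OF submod_pspan[OF a(1)] w(2)] .
  have an: "h c \<otimes>\<^bsub>S\<^esub> a [^]\<^bsub>S\<^esub> n \<in> carrier S" using a c by simp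
  have "a \<otimes>\<^bsub>S\<^esub> (h c \<otimes>\<^bsub>S\<^esub> a [^]\<^bsub>S\<^esub> n) = h r \<oplus>\<^bsub>S\<^esub> a \<otimes>\<^bsub>S\<^esub> w"
    unfolding w(3)[symmetric] using a c by (simp add: S.m_ac)
  moreover have "a \<otimes>\<^bsub>S\<^esub> (h c \<otimes>\<^bsub>S\<^esub> a [^]\<^bsub>S\<^esub> n \<ominus>\<^bsub>S\<^esub> w) = a \<otimes>\<^bsub>S\<^esub> (h c \<otimes>\<^bsub>S\<^esub> a [^]\<^bsub>S\<^esub> n) \<ominus>\<^bsub>S\<^esub> a \<otimes>\<^bsub>S\<^esub> w"
    using a(1) an wc by algebra
  moreover have "(h r \<oplus>\<^bsub>S\<^esub> a \<otimes>\<^bsub>S\<^esub> w) \<ominus>\<^bsub>S\<^esub> a \<otimes>\<^bsub>S\<^esub> w = h r" using hom_closed[OF w(1)] a(1) wc by algebra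
  ultimately have eq: "a \<otimes>\<^bsub>S\<^esub> (h c \<otimes>\<^bsub>S\<^esub> a [^]\<^bsub>S\<^esub> n \<ominus>\<^bsub>S\<^esub> w) = h r" by (simp only:)
  show ?case
  proof (cases "h r = \<zero>\<^bsub>S\<^esub>")
    case False
    then show ?thesis using eq w(1) an wc S.minus_closed by blast
  next
    \<comment> \<open>A vanishing constant term allows cancelling \<open>a\<close>, which lowers the
      degree of the relation.\<close>
    case True
    then have "h c \<otimes>\<^bsub>S\<^esub> a [^]\<^bsub>S\<^esub> n \<ominus>\<^bsub>S\<^esub> w = \<zero>\<^bsub>S\<^esub>"
      using eq S.integral[OF _ a(1), of "h c \<otimes>\<^bsub>S\<^esub> a [^]\<^bsub>S\<^esub> n \<ominus>\<^bsub>S\<^esub> w"] a an wc S.m_comm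
      by (metis S.integral S.minus_closed)
    then have "h c \<otimes>\<^bsub>S\<^esub> a [^]\<^bsub>S\<^esub> n = w" using an wc by simp
    then show ?thesis using Suc.IH w(2) by simp
  qed
qed

text \<open>Pseudo-division by a relation with leading coefficient \<open>r\<close>: each factor
  \<open>r\<close> lowers the degree bound by one as long as it exceeds \<open>n\<close>. As
  \<open>pspan x k\<close> lies in \<open>pspan x (n + k)\<close>, \<open>k\<close> factors are
  enough.\<close>

lemma pspan_reduce:
  assumes x: "x \<in> carrier S" and r: "r \<in> carrier R" "h r \<otimes>\<^bsub>S\<^esub> x [^]\<^bsub>S\<^esub> n \<in> pspan x n"
    and y: "y \<in> pspan x k"
  shows "h (r [^] k) \<otimes>\<^bsub>S\<^esub> y \<in> pspan x n"
proof -
  have step: "h r \<otimes>\<^bsub>S\<^esub> y \<in> pspan x (n + i)" if y: "y \<in> pspan x (Suc (n + i))" for y i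
  proof -
    obtain s w where w: "s \<in> carrier R" "w \<in> pspan x (n + i)"
      "y = h s \<otimes>\<^bsub>S\<^esub> x [^]\<^bsub>S\<^esub> (n + i) \<oplus>\<^bsub>S\<^esub> w" using y by (rule pspanE)
    note V = submodD[OF submod_pspan[OF x]]
    have c: "x [^]\<^bsub>S\<^esub> n \<in> carrier S" "x [^]\<^bsub>S\<^esub> i \<in> carrier S" "h r \<in> carrier S" "h s \<in> carrier S"
      "w \<in> carrier S" using x r(1) w(1) V(1)[OF w(2)] by auto
    have "h r \<otimes>\<^bsub>S\<^esub> y = h s \<otimes>\<^bsub>S\<^esub> (x [^]\<^bsub>S\<^esub> i \<otimes>\<^bsub>S\<^esub> (h r \<otimes>\<^bsub>S\<^esub> x [^]\<^bsub>S\<^esub> n)) \<oplus>\<^bsub>S\<^esub> h r \<otimes>\<^bsub>S\<^esub> w"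
      unfolding w(3) S.nat_pow_mult[OF x, symmetric] using c by (simp add: S.r_distr S.m_ac)
    moreover have "x [^]\<^bsub>S\<^esub> i \<otimes>\<^bsub>S\<^esub> (h r \<otimes>\<^bsub>S\<^esub> x [^]\<^bsub>S\<^esub> n) \<in> pspan x (n + i)"
      using pow_mult_pspan[OF x r(2), of i] by (simp only: add.commute)
    ultimately show ?thesis using V(3)[OF V(4)[OF _ w(1)] V(4)[OF w(2) r(1)]] by (simp only:)
  qed
  have "h (r [^] k) \<otimes>\<^bsub>S\<^esub> y \<in> pspan x n" if "y \<in> pspan x (n + k)" for y
    using that
  proof (induction k arbitrary: y)
    case 0
    then show ?case using submodD(1)[OF submod_pspan[OF x]] by simp
  next
    case (Suc k)
    have y: "y \<in> carrier S" using submodD(1)[OF submod_pspan[OF x] Suc.prems] .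
    have "h (r [^] k) \<otimes>\<^bsub>S\<^esub> (h r \<otimes>\<^bsub>S\<^esub> y) \<in> pspan x n"
      using Suc.IH[OF step] Suc.prems by simp
    then show ?case using r(1) y by (simp add: S.m_assoc)
  qed
  then show ?thesis using y pspan_mono[OF x le_add2, of k n] by blast
qed

text \<open>Scaled by enough factors \<open>r\<close>, all powers of \<open>a\<close> lie in the one
  module \<open>pspan x n\<close>. Their dependence is an algebraic relation for \<open>a\<close>
  whose leading coefficient, a power of \<open>r\<close>, is nonzero, and
  \<open>algebraic_divides\<close> applies to it.\<close>

lemma divides_some_scalar:
  assumes N: "noetherian_ring R" and S: "domain S" and x: "x \<in> carrier S"
    and r: "r \<in> carrier R" "h r \<noteq> \<zero>\<^bsub>S\<^esub>" "h r \<otimes>\<^bsub>S\<^esub> x [^]\<^bsub>S\<^esub> n \<in> pspan x n"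
    and a: "a \<in> pspan x k" "a \<noteq> \<zero>\<^bsub>S\<^esub>"
  shows "\<exists>s\<in>carrier R. \<exists>a'\<in>carrier S. h s \<noteq> \<zero>\<^bsub>S\<^esub> \<and> a \<otimes>\<^bsub>S\<^esub> a' = h s"
proof -
  interpret S: domain S by fact
  have ac: "a \<in> carrier S" using submodD(1)[OF submod_pspan[OF x] a(1)] .
  \<comment> \<open>The exponent of \<open>r\<close> is the degree bound of \<open>a^i\<close> given
    by \<open>pspan_pow\<close>.\<close>
  define y where "y i = h (r [^] Suc (i * k)) \<otimes>\<^bsub>S\<^esub> a [^]\<^bsub>S\<^esub> i" for i
  have rc: "r [^] Suc (i * k) \<in> carrier R" for i using r(1) by (rule R.nat_pow_closed)
  have "y i \<in> pspan x n" for i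
    unfolding y_def by (rule pspan_reduce[OF x r(1,3) pspan_pow[OF x a(1)]])
  then obtain m where m: "y m \<in> seq_span y m" using seq_span_dependent[of x y n, OF N x] by blast
  have "seq_span y j \<subseteq> pspan a j" for j
  proof (induction j)
    case (Suc j)
    note V = submodD[OF submod_pspan[OF ac]]
    show ?case
    proof
      fix z assume "z \<in> seq_span y (Suc j)"
      then obtain w c where w: "w \<in> seq_span y j" "c \<in> carrier R" "z = w \<oplus>\<^bsub>S\<^esub> h c \<otimes>\<^bsub>S\<^esub> y j" by auto
      have "w \<in> pspan a (Suc j)" using w(1) Suc pspan_mono[OF ac, of j "Suc j"] by auto
      moreover have "y j \<in> pspan a (Suc j)" unfolding y_def by (rule pow_in_pspan[OF ac rc])
      ultimately show "z \<in> pspan a (Suc j)" unfolding w(3) using V(3)[OF _ V(4)[OF _ w(2)]] by blast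
    qed
  qed simp
  then have "h (r [^] Suc (m * k)) \<otimes>\<^bsub>S\<^esub> a [^]\<^bsub>S\<^esub> m \<in> pspan a m" using m unfolding y_def by blast
  moreover have "h (r [^] Suc (m * k)) \<noteq> \<zero>\<^bsub>S\<^esub>"
  proof -
    have "h (r [^] i) \<noteq> \<zero>\<^bsub>S\<^esub>" for i :: nat
      by (induction i) (use r in \<open>simp_all add: S.integral_iff\<close>)
    then show ?thesis .
  qed
  ultimately show ?thesis using algebraic_divides[OF S ac a(2) rc] by blast
qed

text \<open>If \<open>x\<close> is not algebraic, then degrees are additive, so that \<open>1 + x a\<close> cannot be a unit.\<close>

lemma algebraic_if_power_divisible:
  assumes S: "domain S" and x: "x \<in> carrier S" and gen: "carrier S \<subseteq> (\<Union>n. pspan x n)"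
    and a: "a \<in> carrier S" "a \<noteq> \<zero>\<^bsub>S\<^esub>"
    and G: "\<And>y. \<lbrakk>y \<in> carrier S; y \<noteq> \<zero>\<^bsub>S\<^esub>\<rbrakk> \<Longrightarrow> \<exists>n::nat. \<exists>z\<in>carrier S. y \<otimes>\<^bsub>S\<^esub> z = a [^]\<^bsub>S\<^esub> n"
  shows "\<exists>n. \<exists>r\<in>carrier R. h r \<noteq> \<zero>\<^bsub>S\<^esub> \<and> h r \<otimes>\<^bsub>S\<^esub> x [^]\<^bsub>S\<^esub> n \<in> pspan x n"
proof (rule ccontr)
  assume neg: "\<not> ?thesis"
  interpret S: domain S by fact
  note V = submodD[OF submod_pspan[OF x]]
  have lead: "\<exists>n. \<exists>r\<in>carrier R. \<exists>v\<in>pspan x n. h r \<noteq> \<zero>\<^bsub>S\<^esub> \<and> y = h r \<otimes>\<^bsub>S\<^esub> x [^]\<^bsub>S\<^esub> n \<oplus>\<^bsub>S\<^esub> v"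
    if y: "y \<in> carrier S" "y \<noteq> \<zero>\<^bsub>S\<^esub>" for y
  proof -
    obtain m where "y \<in> pspan x m" using gen y(1) by blast
    then show ?thesis
    proof (induction m)
      case 0
      then show ?case using y(2) by simp
    next
      case (Suc m)
      obtain r v where v: "r \<in> carrier R" "v \<in> pspan x m" "y = h r \<otimes>\<^bsub>S\<^esub> x [^]\<^bsub>S\<^esub> m \<oplus>\<^bsub>S\<^esub> v"
        using Suc.prems by (rule pspanE)
      show ?case
      proof (cases "h r = \<zero>\<^bsub>S\<^esub>")
        case True
        then have "y = v" using v(3) V(1)[OF v(2)] x by simp
        then show ?thesis using Suc.IH v(2) by simp
      next
        case False
        then show ?thesis using v by blast
      qed
    qed
  qed
  obtain n r v where v: "r \<in> carrier R" "v \<in> pspan x n" "h r \<noteq> \<zero>\<^bsub>S\<^esub>" "a = h r \<otimes>\<^bsub>S\<^esub> x [^]\<^bsub>S\<^esub> n \<oplus>\<^bsub>S\<^esub> v"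
    using lead[OF a] by blast
  define y where "y = \<one>\<^bsub>S\<^esub> \<oplus>\<^bsub>S\<^esub> x \<otimes>\<^bsub>S\<^esub> a"
  define v' where "v' = \<one>\<^bsub>S\<^esub> \<oplus>\<^bsub>S\<^esub> x \<otimes>\<^bsub>S\<^esub> v"
  have xn: "x [^]\<^bsub>S\<^esub> n \<in> carrier S" using x by simp
  have yc: "y \<in> carrier S" unfolding y_def using x a by simp
  have v': "v' \<in> pspan x (Suc n)"
    unfolding v'_def using V(3)[OF one_in_pspan[OF x]] pow_mult_pspan[OF x v(2), of 1] x by simp
  have y: "y = h r \<otimes>\<^bsub>S\<^esub> x [^]\<^bsub>S\<^esub> Suc n \<oplus>\<^bsub>S\<^esub> v'"
    unfolding y_def v'_def v(4) using x xn v(1) V(1)[OF v(2)] by (simp add: S.r_distr S.m_ac S.a_ac)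
  have "y \<noteq> \<zero>\<^bsub>S\<^esub>"
  proof
    assume y0: "y = \<zero>\<^bsub>S\<^esub>"
    have c: "h r \<otimes>\<^bsub>S\<^esub> x [^]\<^bsub>S\<^esub> Suc n \<in> carrier S" "v' \<in> carrier S" using v(1) x V(1)[OF v'] by auto
    have "h r \<otimes>\<^bsub>S\<^esub> x [^]\<^bsub>S\<^esub> Suc n = (h r \<otimes>\<^bsub>S\<^esub> x [^]\<^bsub>S\<^esub> Suc n \<oplus>\<^bsub>S\<^esub> v') \<ominus>\<^bsub>S\<^esub> v'" using c by algebra
    also have "\<dots> = \<zero>\<^bsub>S\<^esub> \<ominus>\<^bsub>S\<^esub> v'" using y y0 by (simp only:)
    also have "\<dots> \<in> pspan x (Suc n)" by (rule submod_minus[OF submod_pspan[OF x] V(2) v'])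
    finally show False using neg v(1,3) by blast
  qed
  then obtain m :: nat and z where z: "z \<in> carrier S" "y \<otimes>\<^bsub>S\<^esub> z = a [^]\<^bsub>S\<^esub> m" using G[OF yc] by blast
  let ?x = "\<ominus>\<^bsub>S\<^esub> x"
  \<comment> \<open>The geometric series: \<open>- x a\<close> is \<open>1\<close> modulo
    \<open>y = 1 + x a\<close>, hence so are its powers. As \<open>y\<close> divides
    \<open>a^m\<close>, it must be a unit.\<close>
  have "\<exists>w\<in>carrier S. \<one>\<^bsub>S\<^esub> = y \<otimes>\<^bsub>S\<^esub> w \<oplus>\<^bsub>S\<^esub> (?x \<otimes>\<^bsub>S\<^esub> a) [^]\<^bsub>S\<^esub> k" for k :: nat
  proof (induction k)
    case 0
    show ?case using yc by (intro bexI[of _ "\<zero>\<^bsub>S\<^esub>"]) simp_all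
  next
    case (Suc k)
    then obtain w where w: "w \<in> carrier S" "\<one>\<^bsub>S\<^esub> = y \<otimes>\<^bsub>S\<^esub> w \<oplus>\<^bsub>S\<^esub> (?x \<otimes>\<^bsub>S\<^esub> a) [^]\<^bsub>S\<^esub> k" by blast
    let ?p = "(?x \<otimes>\<^bsub>S\<^esub> a) [^]\<^bsub>S\<^esub> k"
    have p: "?p \<in> carrier S" using x a by simp
    have "y \<otimes>\<^bsub>S\<^esub> (w \<oplus>\<^bsub>S\<^esub> ?p) \<oplus>\<^bsub>S\<^esub> ?p \<otimes>\<^bsub>S\<^esub> (?x \<otimes>\<^bsub>S\<^esub> a) = y \<otimes>\<^bsub>S\<^esub> w \<oplus>\<^bsub>S\<^esub> ?p"
    proof -
      have "y \<otimes>\<^bsub>S\<^esub> (w \<oplus>\<^bsub>S\<^esub> ?p) \<oplus>\<^bsub>S\<^esub> ?p \<otimes>\<^bsub>S\<^esub> (?x \<otimes>\<^bsub>S\<^esub> a) = y \<otimes>\<^bsub>S\<^esub> w \<oplus>\<^bsub>S\<^esub> ?p \<otimes>\<^bsub>S\<^esub> (y \<ominus>\<^bsub>S\<^esub> x \<otimes>\<^bsub>S\<^esub> a)"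
        using yc w(1) p x a(1) by algebra
      also have "y \<ominus>\<^bsub>S\<^esub> x \<otimes>\<^bsub>S\<^esub> a = \<one>\<^bsub>S\<^esub>" unfolding y_def using x a(1) by algebra
      finally show ?thesis using p by simp
    qed
    then have "\<one>\<^bsub>S\<^esub> = y \<otimes>\<^bsub>S\<^esub> (w \<oplus>\<^bsub>S\<^esub> ?p) \<oplus>\<^bsub>S\<^esub> (?x \<otimes>\<^bsub>S\<^esub> a) [^]\<^bsub>S\<^esub> Suc k"
      unfolding w(2)[symmetric] S.nat_pow_Suc by (rule sym)
    then show ?case using w(1) p by blast
  qed
  then obtain w where w: "w \<in> carrier S" "\<one>\<^bsub>S\<^esub> = y \<otimes>\<^bsub>S\<^esub> w \<oplus>\<^bsub>S\<^esub> (?x \<otimes>\<^bsub>S\<^esub> a) [^]\<^bsub>S\<^esub> m" by blast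
  define u where "u = w \<oplus>\<^bsub>S\<^esub> z \<otimes>\<^bsub>S\<^esub> ?x [^]\<^bsub>S\<^esub> m"
  have u: "u \<in> carrier S" unfolding u_def using w z x by simp
  have "y \<otimes>\<^bsub>S\<^esub> u = y \<otimes>\<^bsub>S\<^esub> w \<oplus>\<^bsub>S\<^esub> (y \<otimes>\<^bsub>S\<^esub> z) \<otimes>\<^bsub>S\<^esub> ?x [^]\<^bsub>S\<^esub> m"
    unfolding u_def using yc w(1) z(1) x by (simp add: S.r_distr S.m_assoc)
  also have "\<dots> = \<one>\<^bsub>S\<^esub>"
    unfolding z(2) using w(2) x a by (simp add: S.nat_pow_distrib S.m_comm)
  finally have yu: "y \<otimes>\<^bsub>S\<^esub> u = \<one>\<^bsub>S\<^esub>" .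
  then have "u \<noteq> \<zero>\<^bsub>S\<^esub>" using yc by auto
  then obtain k s w' where k: "s \<in> carrier R" "w' \<in> pspan x k" "h s \<noteq> \<zero>\<^bsub>S\<^esub>"
    "u = h s \<otimes>\<^bsub>S\<^esub> x [^]\<^bsub>S\<^esub> k \<oplus>\<^bsub>S\<^esub> w'" using lead[OF u] by blast
  let ?n = "Suc n + k"
  have xk: "x [^]\<^bsub>S\<^esub> k \<in> carrier S" "x [^]\<^bsub>S\<^esub> Suc n \<in> carrier S" using x by (auto simp del: S.nat_pow_Suc)
  note c = V(1)[OF v'] V(1)[OF k(2)] hom_closed[OF v(1)] hom_closed[OF k(1)]
  define t where "t = h s \<otimes>\<^bsub>S\<^esub> (x [^]\<^bsub>S\<^esub> k \<otimes>\<^bsub>S\<^esub> v') \<oplus>\<^bsub>S\<^esub> (h r \<otimes>\<^bsub>S\<^esub> (x [^]\<^bsub>S\<^esub> Suc n \<otimes>\<^bsub>S\<^esub> w') \<oplus>\<^bsub>S\<^esub> v' \<otimes>\<^bsub>S\<^esub> w')"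
  have "x [^]\<^bsub>S\<^esub> k \<otimes>\<^bsub>S\<^esub> v' \<in> pspan x ?n" using pow_mult_pspan[OF x v', of k] by (simp only: add.commute)
  then have t: "t \<in> pspan x ?n"
    unfolding t_def by (intro V(3) V(4) k(1) v(1) pow_mult_pspan[OF x k(2)] pspan_mult[OF x v' k(2)])
  \<comment> \<open>The leading coefficients of \<open>y\<close> and of its inverse \<open>u\<close>
    multiply to a nonzero scalar in degree \<open>Suc n + k\<close>. As the product is
    \<open>1\<close>, of lower degree, this is an algebraic relation for \<open>x\<close>.\<close>
  have "y \<otimes>\<^bsub>S\<^esub> u = (h r \<otimes>\<^bsub>S\<^esub> h s) \<otimes>\<^bsub>S\<^esub> (x [^]\<^bsub>S\<^esub> Suc n \<otimes>\<^bsub>S\<^esub> x [^]\<^bsub>S\<^esub> k) \<oplus>\<^bsub>S\<^esub> t"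
    unfolding y k(4) t_def using c xk by algebra
  then have eq: "\<one>\<^bsub>S\<^esub> = h (r \<otimes> s) \<otimes>\<^bsub>S\<^esub> x [^]\<^bsub>S\<^esub> ?n \<oplus>\<^bsub>S\<^esub> t"
    unfolding yu S.nat_pow_mult[OF x] using v(1) k(1) by simp
  have "h (r \<otimes> s) \<otimes>\<^bsub>S\<^esub> x [^]\<^bsub>S\<^esub> ?n \<in> carrier S" using v(1) k(1) x by simp
  then have "h (r \<otimes> s) \<otimes>\<^bsub>S\<^esub> x [^]\<^bsub>S\<^esub> ?n = (h (r \<otimes> s) \<otimes>\<^bsub>S\<^esub> x [^]\<^bsub>S\<^esub> ?n \<oplus>\<^bsub>S\<^esub> t) \<ominus>\<^bsub>S\<^esub> t"
    using V(1)[OF t] by algebra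
  also have "\<dots> \<in> pspan x ?n"
    unfolding eq[symmetric] using submod_minus[OF submod_pspan[OF x] one_in_pspan[OF x, of "n + k"]] t by simp
  finally show False
    using neg v(1,3) k(1,3) S.integral_iff[OF hom_closed hom_closed] R.m_closed hom_mult by metis
qed

text \<open>Such an \<open>S\<close> is a Goldman domain; that it is a field is the Nullstellensatz for Jacobson rings.\<close>

lemma goldman_simple_extension_unit:
  assumes N: "noetherian_ring R" and J: "jacobson_ring R" and S: "domain S"
    and x: "x \<in> carrier S" and gen: "carrier S \<subseteq> (\<Union>n. pspan x n)"
    and a: "a \<in> carrier S" "a \<noteq> \<zero>\<^bsub>S\<^esub>"
    and G: "\<And>y. \<lbrakk>y \<in> carrier S; y \<noteq> \<zero>\<^bsub>S\<^esub>\<rbrakk> \<Longrightarrow> \<exists>n::nat. \<exists>z\<in>carrier S. y \<otimes>\<^bsub>S\<^esub> z = a [^]\<^bsub>S\<^esub> n"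
    and y: "y \<in> carrier S" "y \<noteq> \<zero>\<^bsub>S\<^esub>"
  shows "\<exists>z\<in>carrier S. y \<otimes>\<^bsub>S\<^esub> z = \<one>\<^bsub>S\<^esub>"
proof -
  interpret S: domain S by fact
  have "\<exists>n. \<exists>r\<in>carrier R. h r \<noteq> \<zero>\<^bsub>S\<^esub> \<and> h r \<otimes>\<^bsub>S\<^esub> x [^]\<^bsub>S\<^esub> n \<in> pspan x n"
    by (rule algebraic_if_power_divisible[OF S x gen a G])
  then obtain n r where r: "r \<in> carrier R" "h r \<noteq> \<zero>\<^bsub>S\<^esub>" "h r \<otimes>\<^bsub>S\<^esub> x [^]\<^bsub>S\<^esub> n \<in> pspan x n" by blast
  have scalar: "\<exists>s\<in>carrier R. \<exists>b'\<in>carrier S. h s \<noteq> \<zero>\<^bsub>S\<^esub> \<and> b \<otimes>\<^bsub>S\<^esub> b' = h s"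
    if b: "b \<in> carrier S" "b \<noteq> \<zero>\<^bsub>S\<^esub>" for b
  proof -
    obtain k where "b \<in> pspan x k" using gen b(1) by blast
    then show ?thesis using divides_some_scalar[OF N S x r] b(2) by blast
  qed
  obtain s a' where s: "s \<in> carrier R" "a' \<in> carrier S" "h s \<noteq> \<zero>\<^bsub>S\<^esub>" "a \<otimes>\<^bsub>S\<^esub> a' = h s"
    using scalar[OF a] by blast
  \<comment> \<open>Divisibility is brought down from \<open>S\<close> to \<open>R\<close>: in
    \<open>S\<close> the scalar \<open>t\<close> divides a power of \<open>s\<close>, and the
    quotient \<open>z\<close> is integral up to powers of \<open>r\<close>. Hence \<open>t\<close>
    divides a power of \<open>r s\<close> modulo the kernel.\<close>
  have power: "\<exists>(m::nat). \<exists>d\<in>carrier R. h ((r \<otimes> s) [^] m) = h (t \<otimes> d)"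
    if t: "t \<in> carrier R" "h t \<noteq> \<zero>\<^bsub>S\<^esub>" for t
  proof -
    obtain e :: nat and z0 where z0: "z0 \<in> carrier S" "h t \<otimes>\<^bsub>S\<^esub> z0 = a [^]\<^bsub>S\<^esub> e"
      using G[OF hom_closed[OF t(1)] t(2)] by blast
    define z where "z = z0 \<otimes>\<^bsub>S\<^esub> a' [^]\<^bsub>S\<^esub> e"
    have zc: "z \<in> carrier S" unfolding z_def using z0 s by simp
    have "h t \<otimes>\<^bsub>S\<^esub> z = (h t \<otimes>\<^bsub>S\<^esub> z0) \<otimes>\<^bsub>S\<^esub> a' [^]\<^bsub>S\<^esub> e"
      unfolding z_def using t z0(1) s by (simp add: S.m_assoc)
    also have "\<dots> = (a \<otimes>\<^bsub>S\<^esub> a') [^]\<^bsub>S\<^esub> e" unfolding z0(2) using a(1) s(2) by (simp add: S.nat_pow_distrib)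
    also have "\<dots> = h (s [^] e)" unfolding s(4) using s by (simp add: hom_pow)
    finally have z: "h t \<otimes>\<^bsub>S\<^esub> z = h (s [^] e)" .
    obtain k where k: "z \<in> pspan x k" using gen zc by blast
    define Y where "Y i = h (r [^] Suc (i * k)) \<otimes>\<^bsub>S\<^esub> z [^]\<^bsub>S\<^esub> i" for i
    have rc: "r [^] i \<in> carrier R" for i :: nat using r(1) by (rule R.nat_pow_closed)
    have Yc: "Y i \<in> carrier S" for i unfolding Y_def using rc zc by (intro S.m_closed hom_closed S.nat_pow_closed)
    have "Y i \<in> pspan x n" for i
      unfolding Y_def by (rule pspan_reduce[OF x r(1,3) pspan_pow[OF x k]])
    then obtain m where m: "Y m \<in> seq_span Y m" using seq_span_dependent[of x Y n, OF N x] by blast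
    have Ym: "h (t [^] i) \<otimes>\<^bsub>S\<^esub> Y i = h (r [^] Suc (i * k) \<otimes> s [^] (e * i))" for i
    proof -
      have "h (t [^] i) \<otimes>\<^bsub>S\<^esub> Y i = h (r [^] Suc (i * k)) \<otimes>\<^bsub>S\<^esub> (h t \<otimes>\<^bsub>S\<^esub> z) [^]\<^bsub>S\<^esub> i"
        unfolding Y_def using t(1) rc[of "Suc (i * k)"] zc
        by (simp add: S.nat_pow_distrib hom_pow S.m_lcomm del: R.nat_pow_Suc S.nat_pow_Suc)
      also have "(h t \<otimes>\<^bsub>S\<^esub> z) [^]\<^bsub>S\<^esub> i = h (s [^] (e * i))"
        unfolding z using s(1) by (simp add: hom_pow S.nat_pow_pow)
      finally show ?thesis using rc[of "Suc (i * k)"] s(1) by (simp del: R.nat_pow_Suc hom_pow)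
    qed
    \<comment> \<open>Only terms \<open>Y i\<close> with \<open>i < j\<close> occur in
      \<open>w\<close>. So \<open>t^j\<close> clears their denominators \<open>t^i\<close> with at
      least one factor \<open>t\<close> to spare.\<close>
    have "\<exists>d\<in>carrier R. h (t [^] j) \<otimes>\<^bsub>S\<^esub> w = h (t \<otimes> d)" if "w \<in> seq_span Y j" for w j
      using that
    proof (induction j arbitrary: w)
      case 0
      then show ?case using t(1) by (intro bexI[of _ \<zero>]) simp_all
    next
      case (Suc j)
      then obtain w' c where w: "w' \<in> seq_span Y j" "c \<in> carrier R" "w = w' \<oplus>\<^bsub>S\<^esub> h c \<otimes>\<^bsub>S\<^esub> Y j" by auto
      obtain d where d: "d \<in> carrier R" "h (t [^] j) \<otimes>\<^bsub>S\<^esub> w' = h (t \<otimes> d)" using Suc.IH[OF w(1)] by blast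
      have wc: "w' \<in> carrier S" using submodD(1)[OF submod_seq_span[of Y, OF Yc] w(1)] .
      let ?q = "r [^] Suc (j * k) \<otimes> s [^] (e * j)"
      have q: "?q \<in> carrier R" by (rule R.m_closed[OF rc R.nat_pow_closed[OF s(1)]])
      have tj: "h (t [^] j) \<in> carrier S" "h t \<in> carrier S" "h c \<in> carrier S" using t(1) w(2) by auto
      have "h (t [^] Suc j) = h (t [^] j) \<otimes>\<^bsub>S\<^esub> h t" using t(1) by simp
      then have "h (t [^] Suc j) \<otimes>\<^bsub>S\<^esub> w
          = h t \<otimes>\<^bsub>S\<^esub> (h (t [^] j) \<otimes>\<^bsub>S\<^esub> w' \<oplus>\<^bsub>S\<^esub> h c \<otimes>\<^bsub>S\<^esub> (h (t [^] j) \<otimes>\<^bsub>S\<^esub> Y j))"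
        unfolding w(3) using tj wc Yc[of j] by (simp only:) algebra
      also have "\<dots> = h (t \<otimes> (t \<otimes> d \<oplus> c \<otimes> ?q))"
        unfolding d(2) Ym using t(1) d(1) w(2) q by (simp del: R.nat_pow_Suc hom_pow)
      finally show ?case using t(1) d(1) w(2) q R.a_closed R.m_closed by blast
    qed
    from this[OF m] obtain d where d: "d \<in> carrier R"
      "h (r [^] Suc (m * k) \<otimes> s [^] (e * m)) = h (t \<otimes> d)" unfolding Ym by blast
    \<comment> \<open>A common exponent for \<open>r\<close> and \<open>s\<close>; the factor
      \<open>g\<close> supplies the missing powers.\<close>
    define B where "B = Suc (m * k) + e * m"
    define g where "g = r [^] (e * m) \<otimes> s [^] Suc (m * k)"
    have g: "g \<in> carrier R" unfolding g_def by (rule R.m_closed[OF rc R.nat_pow_closed[OF s(1)]])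
    have "(r \<otimes> s) [^] B = r [^] B \<otimes> s [^] B" using r(1) s(1) by (rule R.nat_pow_distrib)
    also have "r [^] B = r [^] Suc (m * k) \<otimes> r [^] (e * m)"
      unfolding B_def by (rule R.nat_pow_mult[OF r(1), symmetric])
    also have "s [^] B = s [^] Suc (m * k) \<otimes> s [^] (e * m)"
      unfolding B_def by (rule R.nat_pow_mult[OF s(1), symmetric])
    also have "(r [^] Suc (m * k) \<otimes> r [^] (e * m)) \<otimes> (s [^] Suc (m * k) \<otimes> s [^] (e * m))
        = (r [^] Suc (m * k) \<otimes> s [^] (e * m)) \<otimes> g"
      unfolding g_def using rc[of "Suc (m * k)"] rc[of "e * m"] R.nat_pow_closed[OF s(1), of "Suc (m * k)"]
        R.nat_pow_closed[OF s(1), of "e * m"] by (simp add: R.m_ac del: R.nat_pow_Suc)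
    finally have "h ((r \<otimes> s) [^] B) = h (r [^] Suc (m * k) \<otimes> s [^] (e * m)) \<otimes>\<^bsub>S\<^esub> h g"
      using hom_mult[OF R.m_closed[OF rc R.nat_pow_closed[OF s(1)]] g] by (simp only:)
    also have "\<dots> = h (t \<otimes> (d \<otimes> g))" unfolding d(2) using t(1) d(1) g by (simp add: S.m_assoc)
    finally show ?thesis using R.m_closed[OF d(1) g] by blast
  qed
  let ?q = "a_kernel R S h"
  have q: "c \<in> ?q \<longleftrightarrow> c \<in> carrier R \<and> h c = \<zero>\<^bsub>S\<^esub>" for c unfolding a_kernel_def' by blast
  note qp = primeideal_kernel[OF S]
  note qI = primeideal.axioms(1)[OF qp]
  have rs: "r \<otimes> s \<in> carrier R" using r(1) s(1) by simp
  have "r \<otimes> s \<notin> ?q" unfolding q using r s by (simp add: S.integral_iff)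
  moreover obtain \<M> where "\<forall>M\<in>\<M>. maximalideal M R" "?q = \<Inter>\<M>"
    using J qp unfolding jacobson_ring_def by blast
  ultimately obtain M where M: "maximalideal M R" "r \<otimes> s \<notin> M" "?q \<subseteq> M" by blast
  note MI = maximalideal.axioms(1)[OF M(1)]
  \<comment> \<open>An element \<open>t\<close> of \<open>M\<close> outside the kernel would divide
    a power of \<open>r s\<close> modulo the kernel, and then \<open>r s \<in> M\<close>. So the
    kernel is maximal and the image of \<open>R\<close> is a field.\<close>
  have Mq: "t \<in> ?q" if t: "t \<in> M" for t
  proof (rule ccontr)
    assume "t \<notin> ?q"
    then have t': "t \<in> carrier R" "h t \<noteq> \<zero>\<^bsub>S\<^esub>" using R.ideal_carr[OF MI t] q by auto
    obtain m :: nat and d where d: "d \<in> carrier R" "h ((r \<otimes> s) [^] m) = h (t \<otimes> d)" using power[OF t'] by blast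
    have c: "(r \<otimes> s) [^] m \<in> carrier R" "t \<otimes> d \<in> carrier R" using rs t'(1) d(1) by auto
    have "h ((r \<otimes> s) [^] m \<ominus> t \<otimes> d) = h ((r \<otimes> s) [^] m) \<ominus>\<^bsub>S\<^esub> h (t \<otimes> d)"
      using c by (simp add: a_minus_def del: hom_pow hom_mult)
    also have "\<dots> = \<zero>\<^bsub>S\<^esub>" unfolding d(2) using c by (simp add: a_minus_def S.r_neg del: hom_mult)
    finally have "(r \<otimes> s) [^] m \<ominus> t \<otimes> d \<in> M" using q M(3) R.minus_closed[OF c] by blast
    then have "((r \<otimes> s) [^] m \<ominus> t \<otimes> d) \<oplus> t \<otimes> d \<in> M"
      using R.ideal_rmult[OF MI t d(1)] by (rule R.ideal_add[OF MI])
    moreover have "((r \<otimes> s) [^] m \<ominus> t \<otimes> d) \<oplus> t \<otimes> d = (r \<otimes> s) [^] m" using c by algebra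
    ultimately have "(r \<otimes> s) [^] m \<in> M" by (simp only:)
    then show False using R.primeideal_power[OF R.maximalideal_prime[OF M(1)] rs] M(2) by blast
  qed
  obtain t y' where t: "t \<in> carrier R" "y' \<in> carrier S" "h t \<noteq> \<zero>\<^bsub>S\<^esub>" "y \<otimes>\<^bsub>S\<^esub> y' = h t"
    using scalar[OF y] by blast
  then have "t \<notin> M" using Mq q by blast
  then obtain c where c: "c \<in> carrier R" "\<one> \<ominus> t \<otimes> c \<in> M" by (rule R.maximalideal_inverse[OF M(1) t(1)])
  have "h (\<one> \<ominus> t \<otimes> c) = \<zero>\<^bsub>S\<^esub>" using Mq[OF c(2)] q by blast
  then have "\<one>\<^bsub>S\<^esub> \<ominus>\<^bsub>S\<^esub> h t \<otimes>\<^bsub>S\<^esub> h c = \<zero>\<^bsub>S\<^esub>" using t(1) c(1) by (simp add: a_minus_def)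
  then have "h t \<otimes>\<^bsub>S\<^esub> h c = \<one>\<^bsub>S\<^esub>" using t(1) c(1) by simp
  then have "y \<otimes>\<^bsub>S\<^esub> (y' \<otimes>\<^bsub>S\<^esub> h c) = \<one>\<^bsub>S\<^esub>" using y(1) t(2) c(1) by (simp add: S.m_assoc[symmetric] t(4))
  then show ?thesis using t(2) c(1) by blast
qed

end

text \<open>\<open>Q\<close> is maximal among the ideals over \<open>P\<close> that contain no power
  of \<open>a\<close>. If \<open>u\<close> and \<open>v\<close> lie outside, then
  \<open>Q + u R\<close> and \<open>Q + v R\<close> contain powers of \<open>a\<close>, and the
  product of these would lie in \<open>Q\<close> if \<open>u v\<close> did. The last conclusion is
  the divisibility that \<open>goldman_simple_extension_unit\<close> asks for in the quotient by
  \<open>Q\<close>.\<close>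

lemma (in cring) exists_prime_avoiding_powers:
  assumes N: "noetherian_ring R" and a: "a \<in> carrier R" and P: "ideal P R" "\<And>n::nat. a [^] n \<notin> P"
  obtains Q where "primeideal Q R" "P \<subseteq> Q" "a \<notin> Q"
    "\<And>y. \<lbrakk>y \<in> carrier R; y \<notin> Q\<rbrakk> \<Longrightarrow> \<exists>n::nat. a [^] n \<in> adjoin Q y"
proof -
  have "(\<forall>n::nat. a [^] n \<notin> I) \<longrightarrow> (\<exists>Q. ideal Q R \<and> I \<subseteq> Q \<and> (\<forall>n::nat. a [^] n \<notin> Q) \<and>
      (\<forall>K. ideal K R \<and> Q \<subset> K \<longrightarrow> (\<exists>n::nat. a [^] n \<in> K)))" if "ideal I R" for I
    using N that
  proof (induction rule: noetherian_induct)
    case (less I)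
    show ?case
    proof (cases "\<exists>K. ideal K R \<and> I \<subset> K \<and> (\<forall>n::nat. a [^] n \<notin> K)")
      case True
      then obtain K where K: "ideal K R" "I \<subset> K" "\<forall>n::nat. a [^] n \<notin> K" by blast
      then obtain Q where "ideal Q R" "K \<subseteq> Q" "\<forall>n::nat. a [^] n \<notin> Q"
        "\<forall>K. ideal K R \<and> Q \<subset> K \<longrightarrow> (\<exists>n::nat. a [^] n \<in> K)" using less.IH[OF K(1,2)] by (elim impE exE conjE) auto
      then show ?thesis using K(2) by (intro impI exI[of _ Q]) blast
    next
      case False
      then show ?thesis using less.hyps by blast
    qed
  qed
  then have "\<exists>Q. ideal Q R \<and> P \<subseteq> Q \<and> (\<forall>n::nat. a [^] n \<notin> Q) \<and>
      (\<forall>K. ideal K R \<and> Q \<subset> K \<longrightarrow> (\<exists>n::nat. a [^] n \<in> K))" using P by simp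
  then obtain Q where Q: "ideal Q R" "P \<subseteq> Q" "\<forall>n::nat. a [^] n \<notin> Q"
    "\<forall>K. ideal K R \<and> Q \<subset> K \<longrightarrow> (\<exists>n::nat. a [^] n \<in> K)"
    by (elim exE conjE) (rule that)
  have pow: "\<exists>n::nat. a [^] n \<in> adjoin Q y" if "y \<in> carrier R" "y \<notin> Q" for y
    using Q(4) ideal_adjoin[OF Q(1) that(1)] adjoin_psubset[OF Q(1) that] by blast
  have "primeideal Q R"
  proof (rule primeidealI[OF Q(1) is_cring])
    show "carrier R \<noteq> Q" using Q(3) a nat_pow_closed by blast
    fix u v assume uv: "u \<in> carrier R" "v \<in> carrier R" "u \<otimes> v \<in> Q"
    show "u \<in> Q \<or> v \<in> Q"
    proof (rule ccontr)
      assume "\<not> (u \<in> Q \<or> v \<in> Q)"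
      then obtain m n :: nat where mn: "a [^] m \<in> adjoin Q u" "a [^] n \<in> adjoin Q v" using pow uv(1,2) by blast
      obtain i y where 1: "i \<in> Q" "y \<in> carrier R" "a [^] m = i \<oplus> u \<otimes> y" using mn(1) by (rule adjoinE)
      obtain j z where 2: "j \<in> Q" "z \<in> carrier R" "a [^] n = j \<oplus> v \<otimes> z" using mn(2) by (rule adjoinE)
      note c = ideal_carr[OF Q(1) 1(1)] ideal_carr[OF Q(1) 2(1)]
      have "a [^] (m + n) = (i \<oplus> u \<otimes> y) \<otimes> (j \<oplus> v \<otimes> z)"
        unfolding 1(3)[symmetric] 2(3)[symmetric] by (rule nat_pow_mult[OF a, symmetric])
      also have "\<dots> = i \<otimes> (j \<oplus> v \<otimes> z) \<oplus> (j \<otimes> (u \<otimes> y) \<oplus> (u \<otimes> v) \<otimes> (y \<otimes> z))"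
        using c uv(1,2) 1(2) 2(2) by algebra
      also have "\<dots> \<in> Q"
        by (intro ideal_add[OF Q(1)] ideal_rmult[OF Q(1)] 1(1) 2(1) uv(3)) (use c uv 1(2) 2(2) in simp_all)
      finally show False using Q(3) by blast
    qed
  qed
  moreover have "a \<notin> Q" using Q(3) a by (metis nat_pow_eone)
  ultimately show thesis using that Q(2) pow by blast
qed

text \<open>For \<open>a \<notin> P\<close> take a prime \<open>Q\<close> over \<open>P\<close> from
  \<open>exists_prime_avoiding_powers\<close>. The quotient of \<open>S\<close> by \<open>Q\<close>
  is a simple extension of \<open>R\<close> to which \<open>goldman_simple_extension_unit\<close>
  applies, so it is a field, and \<open>Q\<close> is a maximal ideal over \<open>P\<close> that
  misses \<open>a\<close>.\<close>

lemma (in ring_hom_cring) jacobson_simple_extension: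
  assumes N: "noetherian_ring R" and J: "jacobson_ring R"
    and x: "x \<in> carrier S" and gen: "carrier S \<subseteq> (\<Union>n. pspan x n)"
  shows "jacobson_ring S"
  unfolding jacobson_ring_def
proof (intro conjI allI impI)
  show "cring S" by (rule S.is_cring)
  note NS = noetherian_simple_extension[OF N x gen]
  fix P assume P: "primeideal P S"
  note PI = primeideal.axioms(1)[OF P]
  have ex: "\<exists>M. maximalideal M S \<and> P \<subseteq> M \<and> a \<notin> M" if a: "a \<in> carrier S" "a \<notin> P" for a
  proof -
    have "a [^]\<^bsub>S\<^esub> n \<notin> P" for n :: nat using S.primeideal_power[OF P a(1)] a(2) by blast
    then obtain Q where Q: "primeideal Q S" "P \<subseteq> Q" "a \<notin> Q"
      "\<And>y. \<lbrakk>y \<in> carrier S; y \<notin> Q\<rbrakk> \<Longrightarrow> \<exists>n::nat. a [^]\<^bsub>S\<^esub> n \<in> S.adjoin Q y"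
      by (rule S.exists_prime_avoiding_powers[OF NS a(1) PI]) (rule that)
    note QI = primeideal.axioms(1)[OF Q(1)]
    let ?K = "S Quot Q"
    note K0 = S.rcos_zero_iff[OF QI]
    have Kc: "\<exists>y\<in>carrier S. Y = Q +>\<^bsub>S\<^esub> y" if "Y \<in> carrier ?K" for Y
      using that by (blast elim: S.Quot_carrierE)
    interpret K: ring_hom_cring R ?K "\<lambda>r. Q +>\<^bsub>S\<^esub> h r" by (rule ring_hom_cring_quotient[OF QI])
    interpret KD: domain ?K by (rule primeideal.quotient_is_domain[OF Q(1)])
    interpret c: ring_hom_cring S ?K "\<lambda>y. Q +>\<^bsub>S\<^esub> y"
      by (rule ring_hom_cring.intro[OF S.is_cring K.S.is_cring ring_hom_cring_axioms.intro[OF ideal.rcos_ring_hom[OF QI]]])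
    have span: "Q +>\<^bsub>S\<^esub> y \<in> K.pspan (Q +>\<^bsub>S\<^esub> x) n" if "y \<in> pspan x n" for y n
      using that
    proof (induction n arbitrary: y)
      case (Suc n)
      obtain r v where v: "r \<in> carrier R" "v \<in> pspan x n" "y = h r \<otimes>\<^bsub>S\<^esub> x [^]\<^bsub>S\<^esub> n \<oplus>\<^bsub>S\<^esub> v"
        using Suc.prems by (rule pspanE)
      have "Q +>\<^bsub>S\<^esub> y = (Q +>\<^bsub>S\<^esub> h r) \<otimes>\<^bsub>?K\<^esub> (Q +>\<^bsub>S\<^esub> x) [^]\<^bsub>?K\<^esub> n \<oplus>\<^bsub>?K\<^esub> (Q +>\<^bsub>S\<^esub> v)"
        unfolding v(3) using v(1) x submodD(1)[OF submod_pspan[OF x] v(2)]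
        by (simp add: c.hom_add c.hom_mult c.hom_pow)
      then show ?case using K.pspanI[OF v(1) Suc.IH[OF v(2)]] by (simp only:)
    qed (use c.hom_zero in simp)
    have Kgen: "carrier ?K \<subseteq> (\<Union>n. K.pspan (Q +>\<^bsub>S\<^esub> x) n)"
    proof
      fix Y assume "Y \<in> carrier ?K"
      then obtain y where "y \<in> carrier S" "Y = Q +>\<^bsub>S\<^esub> y" using Kc by blast
      moreover then obtain n where "y \<in> pspan x n" using gen by blast
      ultimately show "Y \<in> (\<Union>n. K.pspan (Q +>\<^bsub>S\<^esub> x) n)" using span by blast
    qed
    have aK: "Q +>\<^bsub>S\<^esub> a \<in> carrier ?K" "Q +>\<^bsub>S\<^esub> a \<noteq> \<zero>\<^bsub>?K\<^esub>" using c.hom_closed[OF a(1)] K0[OF a(1)] Q(3) by auto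
    have G: "\<exists>n::nat. \<exists>Z\<in>carrier ?K. Y \<otimes>\<^bsub>?K\<^esub> Z = (Q +>\<^bsub>S\<^esub> a) [^]\<^bsub>?K\<^esub> n"
      if Y: "Y \<in> carrier ?K" "Y \<noteq> \<zero>\<^bsub>?K\<^esub>" for Y
    proof -
      obtain y where y: "y \<in> carrier S" "Y = Q +>\<^bsub>S\<^esub> y" using Kc[OF Y(1)] by blast
      then have "y \<notin> Q" using K0 Y(2) by blast
      then obtain n :: nat where "a [^]\<^bsub>S\<^esub> n \<in> S.adjoin Q y" using Q(4) y(1) by blast
      then obtain i z where z: "i \<in> Q" "z \<in> carrier S" "a [^]\<^bsub>S\<^esub> n = i \<oplus>\<^bsub>S\<^esub> y \<otimes>\<^bsub>S\<^esub> z" by (rule S.adjoinE)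
      have ic: "i \<in> carrier S" using S.ideal_carr[OF QI z(1)] .
      have i0: "Q +>\<^bsub>S\<^esub> i = \<zero>\<^bsub>?K\<^esub>" using K0[OF ic] z(1) by blast
      have "(Q +>\<^bsub>S\<^esub> a) [^]\<^bsub>?K\<^esub> n = Q +>\<^bsub>S\<^esub> (a [^]\<^bsub>S\<^esub> n)" by (rule c.hom_pow[OF a(1), symmetric])
      also have "\<dots> = (Q +>\<^bsub>S\<^esub> i) \<oplus>\<^bsub>?K\<^esub> (Q +>\<^bsub>S\<^esub> y) \<otimes>\<^bsub>?K\<^esub> (Q +>\<^bsub>S\<^esub> z)"
        unfolding z(3) using ic y(1) z(2) by (simp add: c.hom_add c.hom_mult)
      also have "\<dots> = Y \<otimes>\<^bsub>?K\<^esub> (Q +>\<^bsub>S\<^esub> z)"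
        unfolding i0 y(2) using K.S.l_zero[OF K.S.m_closed[OF c.hom_closed[OF y(1)] c.hom_closed[OF z(2)]]] .
      finally show ?thesis using c.hom_closed[OF z(2)] by metis
    qed
    have "maximalideal Q S"
    proof (rule S.maximalidealI_inverse[OF QI S.primeideal_one_notin[OF Q(1)]])
      fix y assume y: "y \<in> carrier S" "y \<notin> Q"
      then have Y: "Q +>\<^bsub>S\<^esub> y \<in> carrier ?K" "Q +>\<^bsub>S\<^esub> y \<noteq> \<zero>\<^bsub>?K\<^esub>" using c.hom_closed K0 by auto
      have "\<exists>Z\<in>carrier ?K. (Q +>\<^bsub>S\<^esub> y) \<otimes>\<^bsub>?K\<^esub> Z = \<one>\<^bsub>?K\<^esub>"
        by (rule K.goldman_simple_extension_unit[OF N J KD.domain_axioms c.hom_closed[OF x] Kgen aK G Y])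
      then obtain Z where Z: "Z \<in> carrier ?K" "(Q +>\<^bsub>S\<^esub> y) \<otimes>\<^bsub>?K\<^esub> Z = \<one>\<^bsub>?K\<^esub>" by blast
      then obtain z where z: "z \<in> carrier S" "Z = Q +>\<^bsub>S\<^esub> z" using Kc by blast
      have "Q +>\<^bsub>S\<^esub> \<one>\<^bsub>S\<^esub> = Q +>\<^bsub>S\<^esub> (y \<otimes>\<^bsub>S\<^esub> z)"
        using Z(2) unfolding z(2) c.hom_one c.hom_mult[OF y(1) z(1)] by (rule sym)
      then have "\<one>\<^bsub>S\<^esub> \<ominus>\<^bsub>S\<^esub> y \<otimes>\<^bsub>S\<^esub> z \<in> Q"
        using S.quotient_eq_iff_same_a_r_cos[OF QI S.one_closed S.m_closed[OF y(1) z(1)]] by blast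
      then show "\<exists>z\<in>carrier S. \<one>\<^bsub>S\<^esub> \<ominus>\<^bsub>S\<^esub> y \<otimes>\<^bsub>S\<^esub> z \<in> Q" using z(1) by blast
    qed
    then show ?thesis using Q(2,3) by blast
  qed
  show "\<exists>\<M>. (\<forall>M\<in>\<M>. maximalideal M S) \<and> P = \<Inter>\<M>"
  proof (intro exI[of _ "{M. maximalideal M S \<and> P \<subseteq> M}"] conjI)
    show "P = \<Inter>{M. maximalideal M S \<and> P \<subseteq> M}"
    proof
      show "\<Inter>{M. maximalideal M S \<and> P \<subseteq> M} \<subseteq> P"
      proof
        fix a assume a: "a \<in> \<Inter>{M. maximalideal M S \<and> P \<subseteq> M}"
        \<comment> \<open>The intersection of an empty family would be the whole type; one maximal
          ideal is needed to place \<open>a\<close> in the carrier.\<close>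
        obtain M0 where M0: "maximalideal M0 S" "P \<subseteq> M0"
          using ex[OF S.one_closed S.primeideal_one_notin[OF P]] by blast
        then have "a \<in> carrier S" using a S.ideal_carr[OF maximalideal.axioms(1)[OF M0(1)]] by blast
        then show "a \<in> P" using ex[of a] a by blast
      qed
    qed blast
  qed blast
qed

section \<open>Algebras of finite type and Dedekind domains\<close>

lemma (in cring) generate_ring_cring:
  assumes "H \<subseteq> carrier R"
  shows "cring (R\<lparr>carrier := generate_ring R H\<rparr>)"
proof -
  interpret G: ring "R\<lparr>carrier := generate_ring R H\<rparr>" by (rule generate_ring_is_ring[OF assms])
  show ?thesis
    by unfold_locales (use generate_ring_in_carrier[OF assms] m_comm in simp)
qed

text \<open>Induction on the generators: each subalgebra \<open>E (insert x G)\<close> is a simple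
  extension of \<open>E G\<close>.\<close>

lemma finite_type_noetherian_jacobson:
  assumes N: "noetherian_ring k" and J: "jacobson_ring k" and C: "finite_type_algebra k C \<eta>"
  shows "noetherian_ring C \<and> jacobson_ring C"
proof -
  from C obtain G where hom: "cring k" "cring C" "\<eta> \<in> ring_hom k C"
    and G: "finite G" "G \<subseteq> carrier C" "generate_ring C (\<eta> ` carrier k \<union> G) = carrier C"
    unfolding finite_type_algebra_def algebra_over_def by blast
  interpret k: cring k by fact
  interpret C: cring C by fact
  interpret \<eta>: ring_hom_cring k C \<eta>
    by (intro ring_hom_cring.intro ring_hom_cring_axioms.intro hom)
  define E where "E H = C\<lparr>carrier := generate_ring C (\<eta> ` carrier k \<union> H)\<rparr>" for H
  have Ec: "cring (E H)" if "H \<subseteq> carrier C" for H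
    unfolding E_def by (rule C.generate_ring_cring) (use that in auto)
  have "noetherian_ring (E G) \<and> jacobson_ring (E G)"
    using G(1,2)
  proof (induction G rule: finite_induct)
    case empty
    have im: "generate_ring C (\<eta> ` carrier k \<union> {}) = \<eta> ` carrier k"
    proof
      show "generate_ring C (\<eta> ` carrier k \<union> {}) \<subseteq> \<eta> ` carrier k"
      proof
        fix y assume "y \<in> generate_ring C (\<eta> ` carrier k \<union> {})"
        then show "y \<in> \<eta> ` carrier k"
        proof induction
          case one
          show ?case by (rule image_eqI[of _ _ "\<one>\<^bsub>k\<^esub>"]) simp_all
        next
          case (a_inv y)
          then obtain r where "r \<in> carrier k" "y = \<eta> r" by blast
          then show ?case by (intro image_eqI[of _ _ "\<ominus>\<^bsub>k\<^esub> r"]) simp_all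
        next
          case (eng_add y z)
          then obtain r s where "r \<in> carrier k" "y = \<eta> r" "s \<in> carrier k" "z = \<eta> s" by blast
          then show ?case by (intro image_eqI[of _ _ "r \<oplus>\<^bsub>k\<^esub> s"]) simp_all
        next
          case (eng_mult y z)
          then obtain r s where "r \<in> carrier k" "y = \<eta> r" "s \<in> carrier k" "z = \<eta> s" by blast
          then show ?case by (intro image_eqI[of _ _ "r \<otimes>\<^bsub>k\<^esub> s"]) simp_all
        qed simp
      qed
    qed (auto intro: generate_ring.incl)
    interpret E: ring_hom_cring k "E {}" \<eta>
      by (rule ring_hom_cring.intro[OF hom(1) Ec ring_hom_cring_axioms.intro], simp, rule ring_hom_memI)
        (auto simp: E_def intro: generate_ring.incl)
    \<comment> \<open>The image of \<open>k\<close> counts as the simple extension generated by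
      zero, so quotients of \<open>k\<close> need no separate argument.\<close>
    have gen: "carrier (E {}) \<subseteq> (\<Union>n. E.pspan \<zero>\<^bsub>E {}\<^esub> n)"
    proof
      fix y assume "y \<in> carrier (E {})"
      then obtain r where "r \<in> carrier k" "y = \<eta> r" unfolding E_def using im by auto
      then show "y \<in> (\<Union>n. E.pspan \<zero>\<^bsub>E {}\<^esub> n)" using E.hom_in_pspan[of "\<zero>\<^bsub>E {}\<^esub>" r 0] by blast
    qed
    show ?case
      using E.noetherian_simple_extension[OF N _ gen] E.jacobson_simple_extension[OF N J _ gen] by simp
  next
    case (insert x G)
    then have x: "x \<in> carrier C" and Gc: "G \<subseteq> carrier C" "insert x G \<subseteq> carrier C" by auto
    let ?A = "\<eta> ` carrier k \<union> G" and ?B = "\<eta> ` carrier k \<union> insert x G"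
    have AB: "?A \<subseteq> ?B" "?A \<subseteq> carrier C" "?B \<subseteq> carrier C" using Gc by auto
    have sub: "generate_ring C ?A \<subseteq> generate_ring C ?B" by (rule C.mono_generate_ring[OF AB(1,3)])
    interpret E: ring_hom_cring "E G" "E (insert x G)" id
      by (rule ring_hom_cring.intro[OF Ec[OF Gc(1)] Ec[OF Gc(2)] ring_hom_cring_axioms.intro], rule ring_hom_memI)
        (use sub in \<open>auto simp: E_def\<close>)
    have xE: "x \<in> carrier (E (insert x G))" by (auto simp: E_def intro: generate_ring.incl)
    have hm: "r \<in> (\<Union>n. E.pspan x n)" if "r \<in> carrier (E G)" for r
      using E.hom_in_pspan[OF xE that, of 0] unfolding id_apply by blast
    have up: "y \<in> E.pspan x (max m n)" if "y \<in> E.pspan x m \<or> y \<in> E.pspan x n" for y m n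
      using that E.pspan_mono[OF xE, of m "max m n"] E.pspan_mono[OF xE, of n "max m n"] by auto
    have gen: "carrier (E (insert x G)) \<subseteq> (\<Union>n. E.pspan x n)"
    proof
      fix y assume "y \<in> carrier (E (insert x G))"
      then have "y \<in> generate_ring C ?B" by (simp add: E_def)
      then show "y \<in> (\<Union>n. E.pspan x n)"
      proof induction
        case one
        show ?case by (rule hm) (simp add: E_def generate_ring.one)
      next
        case (incl y)
        then consider "y \<in> ?A" | "y = x" by blast
        then show ?case
        proof cases
          case 1
          then show ?thesis by (intro hm) (simp add: E_def generate_ring.incl)
        next
          case 2
          have "id \<one>\<^bsub>E G\<^esub> \<otimes>\<^bsub>E (insert x G)\<^esub> x [^]\<^bsub>E (insert x G)\<^esub> (1::nat) = x"
            by (simp only: E.hom_one E.S.nat_pow_eone E.S.l_one xE)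
          then have "x \<in> E.pspan x (Suc 1)" using E.pow_in_pspan[OF xE E.R.one_closed, of 1] by (simp only:)
          then show ?thesis unfolding 2 by blast
        qed
      next
        case (a_inv y)
        then obtain n where n: "y \<in> E.pspan x n" by blast
        have m1: "\<ominus>\<^bsub>C\<^esub> \<one>\<^bsub>C\<^esub> \<in> carrier (E G)" by (simp add: E_def generate_ring.a_inv generate_ring.one)
        have "id (\<ominus>\<^bsub>C\<^esub> \<one>\<^bsub>C\<^esub>) \<otimes>\<^bsub>E (insert x G)\<^esub> y \<in> E.pspan x n"
          by (rule E.submodD(4)[OF E.submod_pspan[OF xE] n m1])
        moreover have "y \<in> carrier C" using C.generate_ring_in_carrier[OF AB(3) a_inv.hyps] .
        ultimately have "\<ominus>\<^bsub>C\<^esub> y \<in> E.pspan x n" by (simp add: E_def C.l_minus)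
        then show ?case by blast
      next
        case (eng_add y z)
        then obtain m n where "y \<in> E.pspan x m" "z \<in> E.pspan x n" by blast
        then have "y \<oplus>\<^bsub>E (insert x G)\<^esub> z \<in> E.pspan x (max m n)"
          by (intro E.submodD(3)[OF E.submod_pspan[OF xE]] up) simp_all
        moreover have "y \<oplus>\<^bsub>E (insert x G)\<^esub> z = y \<oplus>\<^bsub>C\<^esub> z" by (simp add: E_def)
        ultimately have "y \<oplus>\<^bsub>C\<^esub> z \<in> E.pspan x (max m n)" by (simp only:)
        then show ?case by blast
      next
        case (eng_mult y z)
        then obtain m n where "y \<in> E.pspan x m" "z \<in> E.pspan x n" by blast
        then have "y \<otimes>\<^bsub>E (insert x G)\<^esub> z \<in> E.pspan x (m + n)" by (rule E.pspan_mult[OF xE])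
        moreover have "y \<otimes>\<^bsub>E (insert x G)\<^esub> z = y \<otimes>\<^bsub>C\<^esub> z" by (simp add: E_def)
        ultimately have "y \<otimes>\<^bsub>C\<^esub> z \<in> E.pspan x (m + n)" by (simp only:)
        then show ?case by blast
      qed
    qed
    show ?case
      using E.noetherian_simple_extension[OF _ xE gen] E.jacobson_simple_extension[OF _ _ xE gen]
        insert.IH[OF Gc(1)] by blast
  qed
  moreover have "E G = C" unfolding E_def G(3) by simp
  ultimately show ?thesis by simp
qed

section \<open>Fields and Dedekind domains\<close>

lemma field_noetherian_jacobson:
  assumes "field k"
  shows "noetherian_ring k \<and> jacobson_ring k"
proof -
  interpret field k by fact
  have "noetherian_ring k"
  proof (rule noetherian_ringI)
    fix I assume "ideal I k"
    then have "I = {\<zero>\<^bsub>k\<^esub>} \<or> I = carrier k" using all_ideals by blast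
    then show "\<exists>A\<subseteq>carrier k. finite A \<and> I = Idl\<^bsub>k\<^esub> A"
      using genideal_zero genideal_one
      by (metis empty_subsetI finite.emptyI finite_insert insert_subset one_closed zero_closed)
  qed
  moreover have "maximalideal P k" if P: "primeideal P k" for P
  proof -
    have "P = {\<zero>\<^bsub>k\<^esub>} \<or> P = carrier k" using all_ideals primeideal.axioms(1)[OF P] by blast
    then show ?thesis using zeromaximalideal primeideal.I_notcarr[OF P] by blast
  qed
  ultimately show ?thesis using jacobson_if_primes_maximal by blast
qed

text \<open>A nonzero ideal lies in only finitely many maximal ideals: a nonzero prime is itself
  maximal, and across a splitting each maximal ideal lies over one of the two larger ideals. An
  element common to infinitely many maximal ideals is therefore zero, which settles the prime
  \<open>{\<zero>}\<close>.\<close>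

lemma dedekind_jacobson:
  assumes D: "dedekind_domain k" and inf: "infinite {M. maximalideal M k}"
  shows "noetherian_ring k \<and> jacobson_ring k"
proof -
  have N: "noetherian_ring k" and max: "\<And>P. \<lbrakk>primeideal P k; P \<noteq> {\<zero>\<^bsub>k\<^esub>}\<rbrakk> \<Longrightarrow> maximalideal P k"
    and "domain k"
    using D unfolding dedekind_domain_def integrally_closed_domain_def by blast+
  interpret domain k by fact
  have prime: "primeideal M k" "\<one>\<^bsub>k\<^esub> \<notin> M" if "maximalideal M k" for M
    using maximalideal_prime[OF that] primeideal_one_notin by blast+
  have fin: "I \<noteq> {\<zero>\<^bsub>k\<^esub>} \<longrightarrow> finite {M. maximalideal M k \<and> I \<subseteq> M}" if "ideal I k" for I
    using N that
  proof (induction rule: noetherian_prime_induct)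
    case carrier
    have "{M. maximalideal M k \<and> carrier k \<subseteq> M} = {}" using prime(2) one_closed by blast
    then show ?case by (simp only: finite.emptyI simp_thms)
  next
    case (prime I)
    show ?case
    proof
      assume "I \<noteq> {\<zero>\<^bsub>k\<^esub>}"
      then have I: "maximalideal I k" by (rule max[OF prime(1)])
      have "{M. maximalideal M k \<and> I \<subseteq> M} \<subseteq> {I}"
      proof
        fix M assume "M \<in> {M. maximalideal M k \<and> I \<subseteq> M}"
        then have M: "maximalideal M k" "I \<subseteq> M" by blast+
        note MI = maximalideal.axioms(1)[OF M(1)]
        have "M \<subseteq> carrier k" using ideal_carr[OF MI] by blast
        then show "M \<in> {I}"
          using maximalideal.I_maximal[OF I MI M(2)] maximalideal.I_notcarr[OF M(1)] by blast
      qed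
      then show "finite {M. maximalideal M k \<and> I \<subseteq> M}" by (rule finite_subset) simp
    qed
  next
    case (split I a b)
    show ?case
    proof
      assume nz: "I \<noteq> {\<zero>\<^bsub>k\<^esub>}"
      have "adjoin I c \<noteq> {\<zero>\<^bsub>k\<^esub>}" if "c \<in> carrier k" for c
        using subset_adjoin[OF split(1) that] nz ideal_zero[OF split(1)] by blast
      then have f: "finite {M. maximalideal M k \<and> adjoin I a \<subseteq> M}"
        "finite {M. maximalideal M k \<and> adjoin I b \<subseteq> M}" using split by blast+
      have "{M. maximalideal M k \<and> I \<subseteq> M}
          \<subseteq> {M. maximalideal M k \<and> adjoin I a \<subseteq> M} \<union> {M. maximalideal M k \<and> adjoin I b \<subseteq> M}"
        using primeideal_split[OF maximalideal_prime _ split(2-4)] by blast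
      then show "finite {M. maximalideal M k \<and> I \<subseteq> M}"
        by (rule finite_subset) (use f in simp)
    qed
  qed
  have "jacobson_ring k"
    unfolding jacobson_ring_def
  proof (intro conjI allI impI)
    show "cring k" by (rule is_cring)
    fix P assume P: "primeideal P k"
    show "\<exists>\<M>. (\<forall>M\<in>\<M>. maximalideal M k) \<and> P = \<Inter>\<M>"
    proof (cases "P = {\<zero>\<^bsub>k\<^esub>}")
      case False
      then show ?thesis using max[OF P] by (intro exI[of _ "{P}"]) simp
    next
      case True
      let ?\<M> = "{M. maximalideal M k}"
      have sub: "a = \<zero>\<^bsub>k\<^esub>" if a: "a \<in> \<Inter>?\<M>" for a
      proof (rule ccontr)
        assume a0: "a \<noteq> \<zero>\<^bsub>k\<^esub>"
        \<comment> \<open>Again some maximal ideal is needed to know that \<open>a\<close> belongs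
          to the carrier.\<close>
        obtain M0 where M0: "maximalideal M0 k" using inf not_finite_existsD by blast
        have ac: "a \<in> carrier k" using a M0 ideal_carr[OF maximalideal.axioms(1)[OF M0]] by blast
        note I = ideal_adjoin[OF zeroideal ac]
        have "adjoin {\<zero>\<^bsub>k\<^esub>} a \<noteq> {\<zero>\<^bsub>k\<^esub>}" using mem_adjoin[OF zeroideal ac] a0 by blast
        then have "finite {M. maximalideal M k \<and> adjoin {\<zero>\<^bsub>k\<^esub>} a \<subseteq> M}" using fin[OF I] by blast
        moreover have "adjoin {\<zero>\<^bsub>k\<^esub>} a \<subseteq> M" if M: "maximalideal M k" for M
          using adjoin_minimal[OF maximalideal.axioms(1)[OF M], of "{\<zero>\<^bsub>k\<^esub>}" a]
            ideal_zero[OF maximalideal.axioms(1)[OF M]] a M by blast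
        then have "{M. maximalideal M k \<and> adjoin {\<zero>\<^bsub>k\<^esub>} a \<subseteq> M} = {M. maximalideal M k}" by blast
        ultimately show False using inf by (simp only:)
      qed
      have "\<zero>\<^bsub>k\<^esub> \<in> \<Inter>?\<M>"
      proof
        fix M assume "M \<in> ?\<M>"
        then have "maximalideal M k" by simp
        then show "\<zero>\<^bsub>k\<^esub> \<in> M" by (rule ideal_zero[OF maximalideal.axioms(1)])
      qed
      then have "P = \<Inter>?\<M>" unfolding True by (intro equalityI subsetI singletonI) (simp, simp only: sub singleton_iff)
      then show ?thesis by (intro exI[of _ ?\<M>]) simp
    qed
  qed
  with N show ?thesis by blast
qed

lemma essentially_finite_type_condition_C:
  assumes N: "noetherian_ring k" and J: "jacobson_ring k"
    and B: "essentially_finite_type_algebra TYPE('c) k B \<phi>"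
  shows "condition_C B"
proof -
  obtain C :: "'c ring" and \<eta> S h where C: "finite_type_algebra k C \<eta>" "submonoid S C"
    "h \<in> ring_iso (fractions C S) B" and "cring B"
    using B unfolding essentially_finite_type_algebra_def algebra_over_def by blast
  moreover have "cring C" using C(1) unfolding finite_type_algebra_def algebra_over_def by blast
  moreover have "noetherian_ring C" "jacobson_ring C"
    using finite_type_noetherian_jacobson[OF N J C(1)] by blast+
  ultimately show ?thesis using condition_C_iso_fractions by blast
qed

theorem mainTheorem3:
  shows
    "(\<forall>A :: ('a, 'm) ring_scheme.
        cring A \<and> noetherian_ring A \<and> jacobson_ring A \<longrightarrow> condition_Q A) \<and>
     (\<forall>(A :: ('a, 'm) ring_scheme) S.
        cring A \<and> noetherian_ring A \<and> jacobson_ring A \<and> submonoid S A \<longrightarrow>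
        condition_C (fractions A S)) \<and>
     (\<forall>A :: ('a, 'm) ring_scheme. artinian_ring A \<longrightarrow> condition_C A) \<and>
     (\<forall>(k :: ('k, 'l) ring_scheme) (B :: ('b, 'n) ring_scheme) \<phi>.
        (field k \<or> dedekind_domain k \<and> infinite {M. maximalideal M k}) \<and>
        essentially_finite_type_algebra TYPE('c) k B \<phi> \<longrightarrow>
        condition_C B)"
proof (intro conjI allI impI; (elim conjE)?)
  fix A :: "('a, 'm) ring_scheme"
  assume "cring A" "noetherian_ring A" "jacobson_ring A"
  then show "condition_Q A" by (rule condition_Q_noetherian_jacobson)
next
  fix A :: "('a, 'm) ring_scheme" and S
  assume "cring A" "noetherian_ring A" "jacobson_ring A" "submonoid S A"
  then show "condition_C (fractions A S)" by (rule condition_C_fractions)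
next
  fix A :: "('a, 'm) ring_scheme"
  assume A: "artinian_ring A"
  then have "cring A" unfolding artinian_ring_def by blast
  then show "condition_C A" using A by (rule cring.artinian_condition_C)
next
  fix k :: "('k, 'l) ring_scheme" and B :: "('b, 'n) ring_scheme" and \<phi>
  assume k: "field k \<or> dedekind_domain k \<and> infinite {M. maximalideal M k}"
    and B: "essentially_finite_type_algebra TYPE('c) k B \<phi>"
  have "noetherian_ring k \<and> jacobson_ring k"
    using k field_noetherian_jacobson dedekind_jacobson by blast
  then show "condition_C B" using essentially_finite_type_condition_C B by blast
qed

end
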